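(* Let $G$ be a reduced quotient-divisible abelian group that has no nonzero free direct summands. Then $G$ is self-small of finite torsion-free rank, and for every positive integer $n$ there exists a torsion-free abelian group $H$ such that: (I) there exists a rigid epimorphism $\alpha:H\to G(n)/nG(n)$, where $G=T_n(G)\oplus G(n)$; (II) $\mathrm{Hom}(G,H)=0$; (III) $\mathrm{Hom}(H,G)$ is a torsion group. Consequently, if $G$ has the cancellation property, then $\mathrm{End}_{\mathrm{W}}(G)$ has the unit lifting property.
   Context: All groups are abelian. A group $G$ of finite torsion-free rank is quotient-divisible if its torsion subgroup is reduced and there exists a full free subgroup $F\le G$ (i.e. $F$ is free and $G/F$ is torsion) such that $G/F$ is divisible. A group is reduced if it has no nonzero divisible subgroup. A group $G$ is self-small if for every index set $I$ the natural homomorphism $\mathrm{Hom}(G,G)^{(I)}\to\mathrm{Hom}(G,G^{(I)})$ is an isomorphism, where $X^{(I)}$ denotes the direct sum of $I$ copies of $X$. $T(G)$ denotes the torsion subgroup of $G$ and $T_p(G)$ its $p$-component for a prime $p$. For a positive integer $n$, $T_n(G)=\bigoplus_{p\mid n,\ p\text{ prime}}T_p(G)$. If $G$ is self-small of finite torsion-free rank, then all $T_p(G)$ are finite and $T_n(G)$ is a direct summand of $G$; $G(n)$ denotes a fixed complement, so $G=T_n(G)\oplus G(n)$. The Walk-endomorphism ring of $G$ is $\mathrm{End}_{\mathrm{W}}(G)=\mathrm{End}(G)/\mathrm{Hom}(G,T(G))$, where $\mathrm{Hom}(G,T(G))$ is viewed as the two-sided ideal of endomorphisms with image in $T(G)$.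 A group $G$ has the cancellation property if whenever $H,K$ are (abelian) groups with $G\oplus H\cong G\oplus K$, then $H\cong K$. A ring $R$ has the unit lifting property if for every positive integer $n$ every unit of $R/nR$ is the image of a unit of $R$. An epimorphism $\alpha:H\to L$ is rigid if whenever $\psi:H\to H$ and $\phi:L\to L$ are isomorphisms with $\alpha\psi=\phi\alpha$, one has $\phi=1_L$ or $\phi=-1_L$. *)

theory Defs
  imports "HOL-Algebra.Algebra" "HOL-Library.Extended_Nat"
begin

text \<open>
  Groups are HOL-Algebra groups in multiplicative notation, so a multiple
  \<open>n x\<close> of the additive literature is \<open>x [^] n\<close> here, and the subgroup \<open>0\<close> is the
  subgroup consisting of the unit element. A subgroup \<open>A\<close> of \<open>G\<close>, taken as a group in its own right,
  is \<open>G\<lparr>carrier := A\<rparr>\<close>.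
\<close>

section \<open>Torsion, divisibility, freeness\<close>

definition torsion_part :: "('a, 'b) monoid_scheme \<Rightarrow> 'a set" where
  "torsion_part G = {x \<in> carrier G. \<exists>n::nat. n > 0 \<and> x [^]\<^bsub>G\<^esub> n = \<one>\<^bsub>G\<^esub>}"

definition torsion_group :: "('a, 'b) monoid_scheme \<Rightarrow> bool" where
  "torsion_group G \<longleftrightarrow> comm_group G \<and> torsion_part G = carrier G"

definition torsion_free_group :: "('a, 'b) monoid_scheme \<Rightarrow> bool" where
  "torsion_free_group G \<longleftrightarrow> comm_group G \<and> torsion_part G = {\<one>\<^bsub>G\<^esub>}"

definition p_part :: "('a, 'b) monoid_scheme \<Rightarrow> nat \<Rightarrow> 'a set" where
  "p_part G p = {x \<in> carrier G. \<exists>k::nat. x [^]\<^bsub>G\<^esub> (p ^ k) = \<one>\<^bsub>G\<^esub>}"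

text \<open>The internal sum of the \<open>p\<close>-components for \<open>p\<close> dividing \<open>n\<close>; in an abelian group
  it is automatically direct.\<close>

definition n_part :: "('a, 'b) monoid_scheme \<Rightarrow> nat \<Rightarrow> 'a set" where
  "n_part G n = generate G (\<Union>p \<in> {p. Factorial_Ring.prime p \<and> p dvd n}. p_part G p)"

definition multiples :: "('a, 'b) monoid_scheme \<Rightarrow> nat \<Rightarrow> 'a set" where
  "multiples G n = {x [^]\<^bsub>G\<^esub> n | x. x \<in> carrier G}"

definition divisible_group :: "('a, 'b) monoid_scheme \<Rightarrow> bool" where
  "divisible_group G \<longleftrightarrow> comm_group G \<and>
     (\<forall>n::nat. n > 0 \<longrightarrow> (\<forall>x \<in> carrier G. \<exists>y \<in> carrier G. y [^]\<^bsub>G\<^esub> n = x))"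

definition reduced_group :: "('a, 'b) monoid_scheme \<Rightarrow> bool" where
  "reduced_group G \<longleftrightarrow> comm_group G \<and>
     (\<forall>D. subgroup D G \<and> divisible_group (G\<lparr>carrier := D\<rparr>) \<longrightarrow> D = {\<one>\<^bsub>G\<^esub>})"

text \<open>A basis of \<open>G\<close> is a subset of \<open>G\<close>, so it suffices to look for basis sets in the
  type of its elements.\<close>

definition free_abelian :: "('a, 'b) monoid_scheme \<Rightarrow> bool" where
  "free_abelian G \<longleftrightarrow> comm_group G \<and> (\<exists>S :: 'a set. G \<cong> free_Abelian_group S)"

definition internal_direct_sum ::
    "('a, 'b) monoid_scheme \<Rightarrow> 'a set \<Rightarrow> 'a set \<Rightarrow> bool" where
  "internal_direct_sum G A B \<longleftrightarrow>
     subgroup A G \<and> subgroup B G \<and> A \<inter> B = {\<one>\<^bsub>G\<^esub>} \<and> A <#>\<^bsub>G\<^esub> B = carrier G"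

definition no_nonzero_free_summand :: "('a, 'b) monoid_scheme \<Rightarrow> bool" where
  "no_nonzero_free_summand G \<longleftrightarrow>
     (\<forall>A B. internal_direct_sum G A B \<and> free_abelian (G\<lparr>carrier := A\<rparr>) \<longrightarrow> A = {\<one>\<^bsub>G\<^esub>})"

section \<open>Torsion-free rank and quotient-divisible groups\<close>

text \<open>Linear independence over the integers; members of an independent set have infinite order.\<close>

definition Z_independent :: "('a, 'b) monoid_scheme \<Rightarrow> 'a set \<Rightarrow> bool" where
  "Z_independent G S \<longleftrightarrow> finite S \<and> S \<subseteq> carrier G \<and>
     (\<forall>c :: 'a \<Rightarrow> int.
        finprod G (\<lambda>x. x [^]\<^bsub>G\<^esub> c x) S = \<one>\<^bsub>G\<^esub> \<longrightarrow> (\<forall>x \<in> S. c x = 0))"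

definition torsion_free_rank :: "('a, 'b) monoid_scheme \<Rightarrow> enat" where
  "torsion_free_rank G = (SUP S \<in> {S. Z_independent G S}. enat (card S))"

definition quotient_divisible :: "('a, 'b) monoid_scheme \<Rightarrow> bool" where
  "quotient_divisible G \<longleftrightarrow>
     comm_group G \<and> torsion_free_rank G < \<infinity> \<and>
     reduced_group (G\<lparr>carrier := torsion_part G\<rparr>) \<and>
     (\<exists>F. subgroup F G \<and> free_abelian (G\<lparr>carrier := F\<rparr>) \<and>
          torsion_group (G Mod F) \<and> divisible_group (G Mod F))"

section \<open>Groups of homomorphisms and self-small groups\<close>

text \<open>Homomorphisms are restricted to be \<open>undefined\<close> off the carrier, so that they are equal
  as soon as they agree on the carrier.\<close>

definition hom_group ::
    "('a, 'b) monoid_scheme \<Rightarrow> ('c, 'd) monoid_scheme \<Rightarrow> ('a \<Rightarrow> 'c) monoid" where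
  "hom_group G H =
     \<lparr>carrier = hom G H \<inter> extensional (carrier G),
      monoid.mult = (\<lambda>f g. \<lambda>x \<in> carrier G. f x \<otimes>\<^bsub>H\<^esub> g x),
      one = (\<lambda>x \<in> carrier G. \<one>\<^bsub>H\<^esub>)\<rparr>"

text \<open>The type argument is the type of indices; index sets are arbitrary subsets of it.\<close>

definition self_small :: "'i itself \<Rightarrow> ('a, 'b) monoid_scheme \<Rightarrow> bool" where
  "self_small TI G \<longleftrightarrow> comm_group G \<and>
     (\<forall>I :: 'i set.
        (\<lambda>f. \<lambda>x \<in> carrier G. \<lambda>i \<in> I. f i x)
          \<in> iso (sum_group I (\<lambda>i. hom_group G G)) (hom_group G (sum_group I (\<lambda>i. G))))"

section \<open>The Walk-endomorphism ring and the unit lifting property\<close>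

definition End_ring :: "('a, 'b) monoid_scheme \<Rightarrow> ('a \<Rightarrow> 'a) ring" where
  "End_ring G =
     \<lparr>carrier = hom G G \<inter> extensional (carrier G),
      monoid.mult = (\<lambda>f g. compose (carrier G) f g),
      one = (\<lambda>x \<in> carrier G. x),
      ring.zero = (\<lambda>x \<in> carrier G. \<one>\<^bsub>G\<^esub>),
      ring.add = (\<lambda>f g. \<lambda>x \<in> carrier G. f x \<otimes>\<^bsub>G\<^esub> g x)\<rparr>"

definition Walk_End :: "('a, 'b) monoid_scheme \<Rightarrow> ('a \<Rightarrow> 'a) set ring" where
  "Walk_End G =
     End_ring G Quot {f \<in> carrier (End_ring G). f ` carrier G \<subseteq> torsion_part G}"

definition ring_multiples :: "('a, 'b) ring_scheme \<Rightarrow> nat \<Rightarrow> 'a set" where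
  "ring_multiples R n = {[n] \<cdot>\<^bsub>R\<^esub> r | r. r \<in> carrier R}"

definition unit_lifting_property :: "('a, 'b) ring_scheme \<Rightarrow> bool" where
  "unit_lifting_property R \<longleftrightarrow>
     (\<forall>n::nat. n > 0 \<longrightarrow>
        (\<forall>u \<in> Units (R Quot ring_multiples R n).
           \<exists>v \<in> Units R. ring_multiples R n +>\<^bsub>R\<^esub> v = u))"

section \<open>Cancellation and rigid epimorphisms\<close>

text \<open>HOL cannot quantify over all groups of all types inside a formula. The type argument is the
  type carrying the groups \<open>H\<close> and \<open>K\<close>; theorems are to be stated for an arbitrary infinite type.\<close>

definition cancellation_property :: "'u itself \<Rightarrow> ('a, 'b) monoid_scheme \<Rightarrow> bool" where
  "cancellation_property TU G \<longleftrightarrow>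
     (\<forall>(H :: 'u monoid) (K :: 'u monoid). comm_group H \<and> comm_group K \<and>
        G \<times>\<times> H \<cong> G \<times>\<times> K \<longrightarrow> H \<cong> K)"

definition rigid_epi ::
    "('a, 'b) monoid_scheme \<Rightarrow> ('c, 'd) monoid_scheme \<Rightarrow> ('a \<Rightarrow> 'c) \<Rightarrow> bool" where
  "rigid_epi H L \<alpha> \<longleftrightarrow> \<alpha> \<in> epi H L \<and>
     (\<forall>\<psi> \<in> iso H H. \<forall>\<phi> \<in> iso L L.
        (\<forall>x \<in> carrier H. \<alpha> (\<psi> x) = \<phi> (\<alpha> x)) \<longrightarrow>
        (\<forall>y \<in> carrier L. \<phi> y = y) \<or> (\<forall>y \<in> carrier L. \<phi> y = inv\<^bsub>L\<^esub> y))"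

end

theory Submission
  imports Defs "HOL-Analysis.Finite_Cartesian_Product"
begin

text \<open>Let \<open>F\<close> be a full free subgroup of \<open>G\<close> with divisible quotient. It is finitely generated, so
  every \<open>G/nG\<close> is finite, and reducedness makes the primary parts of \<open>G\<close> finite and the
  intersection of all \<open>nG\<close> trivial. For a finite group \<open>L\<close> and a tuple \<open>a\<close> of profinite integers
  indexed by \<open>L\<close>, let \<open>H\<close> be the group of rational vectors \<open>(r, x)\<close> with \<open>x - r a\<close> integral; the
  profinite powers \<open>l^(x\<^sub>l - r a\<^sub>l)\<close> map it onto \<open>L\<close>. Each of countably many conditions excludes only
  a nowhere dense set of tuples \<open>a\<close>, so for a generic \<open>a\<close> all endomorphisms of \<open>H\<close> are scalars,
  \<open>Hom(G, H) = 0\<close> and \<open>Hom(H, G)\<close> is torsion.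

  For the unit lifting, a unit of \<open>End\<^sub>W(G)\<close> modulo \<open>n\<close> twists the projection \<open>G \<rightarrow> L = G(n)/nG(n)\<close>.
  The pullbacks along \<open>H \<rightarrow> L\<close> of the projection and of its twist by the unit \<open>u\<close> become isomorphic after
  adding \<open>G\<close>, because \<open>diag(u, u\<^sup>-\<^sup>1)\<close> is a product of elementary matrices. By cancellation the pullbacks
  are isomorphic, and the rigidity of \<open>H \<rightarrow> L\<close> forces such an isomorphism to lift \<open>u\<close> or \<open>- u\<close>.\<close>

section \<open>Multiples and primary parts\<close>

text \<open>The projection to \<open>r\<close> makes \<open>H\<close> an extension of the rationals
  by the free group Z^I, where I is the set of elements of L, and the tuple \<open>a\<close>
  determines the extension. Sending the l-th basis vector of Z^I to \<open>l\<close> is the obvious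
  epimorphism onto L; it extends to \<open>H\<close> because profinite exponents make sense in a
  finite group. The vector (1, a) can be divided by every integer, up to the precision to which
  \<open>a\<close> is known. Hence a homomorphism out of \<open>H\<close> imposes a relation with
  coefficients in \<open>a\<close>, and one into \<open>H\<close> imposes an integrality condition
  on \<open>a\<close>. Since \<open>G\<close> is countable, there are only countably many of these.
  A free summand of \<open>G\<close> would map into Z^I for every \<open>a\<close>; this is the
  obstacle that the hypothesis on summands removes. If \<open>G\<close> has torsion, nonzero torsion
  homomorphisms from \<open>H\<close> to \<open>G\<close> remain, so an isomorphism of pullbacks
  determines an endomorphism of \<open>G\<close> only up to torsion: this is how the
  Walk-endomorphism ring enters. Cancellation is available only for groups on the given type, so
  \<open>H\<close> and the pullbacks, all countable, are copied onto that type.\<close>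

lemma group_homI: "group G \<Longrightarrow> group H \<Longrightarrow> h \<in> hom G H \<Longrightarrow> group_hom G H h"
  by (simp add: group_hom_def group_hom_axioms_def)

context comm_group
begin

lemma subgroup_comm_group: "subgroup H G \<Longrightarrow> comm_group (G\<lparr>carrier := H\<rparr>)"
  by (intro group.group_comm_groupI subgroup_imp_group) (auto intro: m_comm simp: subgroup.mem_carrier[of H])

lemma pow_inv_eq_one:
  assumes "x \<in> carrier G" "y \<in> carrier G" "x [^] (n::nat) = y [^] n"
  shows "(x \<otimes> inv y) [^] n = \<one>"
  using assms by (simp add: nat_pow_distrib nat_pow_inv)

lemma subgroup_nat_pow_closed:
  assumes "subgroup C G" "x \<in> C"
  shows "x [^] (n::nat) \<in> C"
  using subgroup_int_pow_closed[OF assms, of "int n"] by (simp add: int_pow_int)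

lemma subgroup_mult_cancel_right:
  assumes "subgroup C G" "x \<in> carrier G" "y \<in> C" "x \<otimes> y \<in> C"
  shows "x \<in> C"
proof -
  have "x = (x \<otimes> y) \<otimes> inv y"
    using assms(2) subgroup.mem_carrier[OF assms(1,3)] by (simp add: m_assoc)
  then show ?thesis
    using assms by (metis subgroup.m_closed subgroup.m_inv_closed)
qed

lemma coprime_pow_mem:
  fixes a b :: nat
  assumes C: "subgroup C G" and x: "x \<in> carrier G" and "coprime a b"
    and a: "x [^] a \<in> C" and b: "x [^] b \<in> C"
  shows "x \<in> C"
proof -
  from \<open>coprime a b\<close> have "gcd (int a) (int b) = 1"
    by (simp add: coprime_iff_gcd_eq_1)
  then obtain u v where uv: "u * int a + v * int b = 1"
    by (metis bezout_int)
  have "x = x [^] (int a * u + int b * v)"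
    using uv x by (simp add: mult.commute)
  also have "\<dots> = (x [^] a) [^] u \<otimes> (x [^] b) [^] v"
    using x by (simp add: int_pow_mult int_pow_pow flip: int_pow_int)
  also have "\<dots> \<in> C"
    using subgroup_int_pow_closed[OF C] a b subgroup.m_closed[OF C] by blast
  finally show ?thesis .
qed

lemma subgroup_multiples: "subgroup (multiples G n) G"
proof (rule subgroupI)
  show "multiples G n \<subseteq> carrier G" "multiples G n \<noteq> {}"
    by (auto simp: multiples_def)
next
  fix a assume "a \<in> multiples G n"
  then obtain x where "x \<in> carrier G" "a = x [^] n" by (auto simp: multiples_def)
  then show "inv a \<in> multiples G n"
    by (auto simp: multiples_def nat_pow_inv intro!: exI[of _ "inv x"])
next
  fix a b assume "a \<in> multiples G n" "b \<in> multiples G n"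
  then obtain x y where "x \<in> carrier G" "a = x [^] n" "y \<in> carrier G" "b = y [^] n"
    by (auto simp: multiples_def)
  then show "a \<otimes> b \<in> multiples G n"
    by (auto simp: multiples_def nat_pow_distrib intro!: exI[of _ "x \<otimes> y"])
qed

lemma subgroup_torsion_part: "subgroup (torsion_part G) G"
proof (rule subgroupI)
  show "torsion_part G \<subseteq> carrier G" "torsion_part G \<noteq> {}"
    by (auto simp: torsion_part_def intro!: exI[of _ \<one>] exI[of _ "1::nat"])
next
  fix a assume "a \<in> torsion_part G"
  then show "inv a \<in> torsion_part G"
    by (auto simp: torsion_part_def nat_pow_inv)
next
  fix a b assume "a \<in> torsion_part G" "b \<in> torsion_part G"
  then obtain m n :: nat where *: "a \<in> carrier G" "a [^] m = \<one>" "m > 0"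
      "b \<in> carrier G" "b [^] n = \<one>" "n > 0"
    by (auto simp: torsion_part_def)
  have "(a \<otimes> b) [^] (m * n) = (a [^] m) [^] n \<otimes> (b [^] n) [^] m"
    using *(1,4) by (simp add: nat_pow_distrib nat_pow_pow mult.commute)
  with * show "a \<otimes> b \<in> torsion_part G"
    by (auto simp: torsion_part_def intro!: exI[of _ "m * n"])
qed

lemma divisible_subgroupI:
  assumes D: "subgroup D G"
    and p: "\<And>p x. Factorial_Ring.prime (p::nat) \<Longrightarrow> x \<in> D \<Longrightarrow> \<exists>y \<in> D. y [^] p = x"
  shows "divisible_group (G\<lparr>carrier := D\<rparr>)"
proof -
  have "\<exists>y \<in> D. y [^] n = x" if "n > 0" "x \<in> D" for n :: nat and x
    using that
  proof (induction n arbitrary: x rule: less_induct)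
    case (less n)
    show ?case
    proof (cases "n = 1")
      case True
      then show ?thesis using less subgroup.mem_carrier[OF D] by (auto intro!: bexI[of _ x])
    next
      case False
      then obtain p where pr: "Factorial_Ring.prime p" "p dvd n" using prime_factor_nat by blast
      then obtain m where m: "n = p * m" by auto
      with less.prems pr have "m > 0" "m < n" using prime_gt_1_nat by auto
      obtain z where z: "z \<in> D" "z [^] p = x" using p pr less.prems by blast
      obtain y where y: "y \<in> D" "y [^] m = z" using less.IH \<open>m > 0\<close> \<open>m < n\<close> z by blast
      then have "y [^] n = x"
        using z m subgroup.mem_carrier[OF D] by (simp add: mult.commute flip: nat_pow_pow)
      with y show ?thesis by blast
    qed
  qed
  moreover have "comm_group (G\<lparr>carrier := D\<rparr>)"
    using D by (rule subgroup_comm_group)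
  ultimately show ?thesis
    by (auto simp: divisible_group_def simp flip: nat_pow_consistent)
qed

text \<open>Prime roots suffice because an n-th root can be extracted one prime factor at a time.
  Every later use of reducedness exhibits a subgroup closed under prime roots in this sense.\<close>

lemma reduced_subgroup_trivial:
  assumes "reduced_group G" "subgroup D G"
    and "\<And>p x. Factorial_Ring.prime (p::nat) \<Longrightarrow> x \<in> D \<Longrightarrow> \<exists>y \<in> D. y [^] p = x"
  shows "D = {\<one>}"
  using assms divisible_subgroupI[of D] unfolding reduced_group_def by blast

text \<open>Replaces the generated subgroup by a condition on single elements, which is how the
  n-part is handled from here on.\<close>

lemma n_part_iff:
  assumes "n > 0"
  shows "x \<in> n_part G n \<longleftrightarrow> x \<in> carrier G \<and> (\<exists>k::nat. x [^] (n ^ k) = \<one>)"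
proof
  let ?P = "\<Union>p \<in> {p. Factorial_Ring.prime p \<and> p dvd n}. p_part G p"
  have sub: "?P \<subseteq> carrier G" by (auto simp: p_part_def)
  have pn: "\<exists>k::nat. x [^] (n ^ k) = \<one>" if "x \<in> ?P" for x
  proof -
    from that obtain p k where "p dvd n" "x [^] (p ^ k :: nat) = \<one>" "x \<in> carrier G"
      by (auto simp: p_part_def)
    moreover obtain m where "n = p * m" using \<open>p dvd n\<close> by auto
    ultimately have "x [^] (n ^ k) = \<one>" 
      by (simp add: power_mult_distrib flip: nat_pow_pow)
    then show ?thesis by blast
  qed
  show "x \<in> carrier G \<and> (\<exists>k::nat. x [^] (n ^ k) = \<one>)" if "x \<in> n_part G n"
    using that unfolding n_part_def
  proof (induction rule: generate.induct)
    case one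
    then show ?case by auto
  next
    case (incl h)
    then show ?case using pn sub by blast
  next
    case (inv h)
    then obtain k where "h [^] (n ^ k) = \<one>" "h \<in> carrier G" using pn sub by blast
    then show ?case by (auto simp: nat_pow_inv)
  next
    case (eng a b)
    then obtain j k where *: "a [^] (n ^ j) = \<one>" "b [^] (n ^ k) = \<one>" by auto
    have "(a \<otimes> b) [^] (n ^ (j + k)) = (a [^] (n ^ j)) [^] (n ^ k) \<otimes> (b [^] (n ^ k)) [^] (n ^ j)"
      using eng by (simp add: nat_pow_distrib nat_pow_pow power_add mult.commute)
    also have "\<dots> = \<one>" using * by simp
    finally show ?case using eng by blast
  qed
  \<comment> \<open>Stated for any exponent \<open>m\<close> whose primes divide \<open>n\<close>,
    not just for powers of \<open>n\<close>: the induction splits \<open>m\<close> into a full prime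
    power \<open>p ^ k\<close> and a smaller cofactor \<open>b\<close>, and recovers
    \<open>x\<close> from its powers with these coprime exponents.\<close>
  have key: "x \<in> generate G ?P"
    if "m > 0" "x [^] m = \<one>" "x \<in> carrier G" "\<forall>p. Factorial_Ring.prime p \<longrightarrow> p dvd m \<longrightarrow> p dvd n"
    for m x using that
  proof (induction m arbitrary: x rule: less_induct)
    case (less m)
    have gen: "subgroup (generate G ?P) G" using sub by (rule generate_is_subgroup)
    show ?case
    proof (cases "m = 1")
      case True
      then show ?thesis using less.prems by (auto intro: generate.one)
    next
      case False
      then obtain p where pr: "Factorial_Ring.prime p" "p dvd m" using prime_factor_nat by blast
      obtain k b where b: "m = p ^ k * b" "\<not> p dvd b"
        using pr less.prems
        by (metis bot_nat_0.not_eq_extremum not_prime_unit  multiplicity_decompose')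
      have "k > 0" using b pr by (cases k) auto
      then have "p ^ k > 1" using prime_gt_1_nat[OF pr(1)] one_less_power[of p k] by blast
      then have "b < m" using b less.prems by auto
      have cop: "coprime (p ^ k) b" using b pr by (simp add: prime_imp_coprime)
      have 1: "x [^] (p ^ k) \<in> generate G ?P"
      proof (rule less.IH[OF \<open>b < m\<close>])
        show "0 < b" using less.prems b by auto
        show "(x [^] (p ^ k)) [^] b = \<one>" using less.prems b by (simp add: nat_pow_pow)
      qed (use less.prems b in auto)
      have "x [^] b \<in> p_part G p"
        using less.prems b by (auto simp: p_part_def nat_pow_pow mult.commute intro!: exI[of _ k])
      then have "x [^] b \<in> generate G ?P"
        using pr less.prems by (intro generate.incl) auto
      with 1 show ?thesis using coprime_pow_mem[OF gen _ cop] less.prems by blast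
    qed
  qed
  show "x \<in> n_part G n" if "x \<in> carrier G \<and> (\<exists>k::nat. x [^] (n ^ k) = \<one>)"
  proof -
    from that obtain k where k: "x \<in> carrier G" "x [^] (n ^ k) = \<one>" by blast
    have "\<forall>p. Factorial_Ring.prime p \<longrightarrow> p dvd n ^ k \<longrightarrow> p dvd n"
      using prime_dvd_power by blast
    then show ?thesis
      unfolding n_part_def using key[of "n ^ k" x] k assms by simp
  qed
qed

lemma subgroup_n_part: "subgroup (n_part G n) G"
  unfolding n_part_def by (rule generate_is_subgroup) (auto simp: p_part_def)

end

section \<open>Reduced quotient-divisible groups\<close>

context comm_group
begin

lemma finprod_int_pow:
  assumes "f \<in> A \<rightarrow> carrier G"
  shows "(\<Otimes>x\<in>A. f x) [^] (k::int) = (\<Otimes>x\<in>A. f x [^] k)"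
  using assms
  by (induction A rule: infinite_finite_induct) (simp_all add: Pi_iff int_pow_distrib)

lemma generate_finite_expand:
  assumes S: "finite S" "S \<subseteq> carrier G" and "f \<in> generate G S"
  shows "\<exists>c::'a \<Rightarrow> int. f = (\<Otimes>s\<in>S. s [^] c s)"
  using assms(3)
proof (induction rule: generate.induct)
  case one
  then show ?case by (intro exI[of _ "\<lambda>_. 0"]) simp
next
  case (incl h)
  have "(\<Otimes>s\<in>S. if h = s then s else \<one>) = h"
    using finprod_singleton[of h S "\<lambda>s. s"] incl S by auto
  moreover have "(\<Otimes>s\<in>S. s [^] (if h = s then 1 else 0 :: int)) = (\<Otimes>s\<in>S. if h = s then s else \<one>)"
    using S by (intro finprod_cong) (auto simp: simp_implies_def)
  ultimately show ?case by (intro exI[of _ "\<lambda>s. if h = s then 1 else 0"]) simp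
next
  case (inv h)
  have "(\<Otimes>s\<in>S. if h = s then inv s else \<one>) = inv h"
    using finprod_singleton[of h S "\<lambda>s. inv s"] inv S by auto
  moreover have "(\<Otimes>s\<in>S. s [^] (if h = s then - 1 else 0 :: int)) = (\<Otimes>s\<in>S. if h = s then inv s else \<one>)"
    using S by (intro finprod_cong) (auto simp: simp_implies_def int_pow_neg)
  ultimately show ?case by (intro exI[of _ "\<lambda>s. if h = s then - 1 else 0"]) simp
next
  case (eng a b)
  then obtain c d :: "'a \<Rightarrow> int" where
    "a = (\<Otimes>s\<in>S. s [^] c s)" "b = (\<Otimes>s\<in>S. s [^] d s)" by blast
  moreover have "(\<Otimes>s\<in>S. s [^] (c s + d s)) = (\<Otimes>s\<in>S. s [^] c s \<otimes> s [^] d s)"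
    using S by (intro finprod_cong) (auto simp: simp_implies_def int_pow_mult)
  moreover have "(\<Otimes>s\<in>S. s [^] c s \<otimes> s [^] d s) = (\<Otimes>s\<in>S. s [^] c s) \<otimes> (\<Otimes>s\<in>S. s [^] d s)"
    using S by (intro finprod_multf) auto
  ultimately show ?case by (intro exI[of _ "\<lambda>s. c s + d s"]) simp
qed

end

text \<open>Everything below rests on a finite subset \<open>S\<close> generating the free subgroup \<open>F\<close> of the
  definition; that \<open>F\<close> is free matters only for the finiteness of \<open>S\<close>.\<close>

locale reduced_qd_group = comm_group G for G (structure) +
  fixes S
  assumes finite_S: "finite S" and S_carrier: "S \<subseteq> carrier G"
    and torsion_mod: "x \<in> carrier G \<Longrightarrow> \<exists>m::nat. m > 0 \<and> x [^] m \<in> generate G S"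
    and divisible_mod: "x \<in> carrier G \<Longrightarrow> n > 0 \<Longrightarrow>
      \<exists>f \<in> generate G S. \<exists>y \<in> carrier G. x = f \<otimes> y [^] (n::nat)"
    and reduced: "reduced_group G"
begin

lemma generate_S_carrier: "f \<in> generate G S \<Longrightarrow> f \<in> carrier G"
  using generate_in_carrier S_carrier by blast

text \<open>Divisibility of the quotient by \<open>generate G S\<close> means that this subgroup
  together with the n-th powers is all of \<open>G\<close>; modulo n-th powers, the exponents of the
  finitely many generators matter only modulo \<open>n\<close>.\<close>

lemma finite_mod_multiples:
  fixes n :: nat
  assumes "n > 0"
  obtains B where "finite B" "B \<subseteq> carrier G"
    "\<And>x. x \<in> carrier G \<Longrightarrow> \<exists>c \<in> B. \<exists>y \<in> carrier G. x = c \<otimes> y [^] n"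
proof
  let ?P = "PiE S (\<lambda>_. {0..<int n})"
  let ?g = "\<lambda>c :: 'a \<Rightarrow> int. \<Otimes>s\<in>S. s [^] c s"
  have gc: "?g c \<in> carrier G" for c using S_carrier by (intro finprod_closed) auto
  show "finite (?g ` ?P)" using finite_S by (intro finite_imageI finite_PiE) auto
  show "?g ` ?P \<subseteq> carrier G" using gc by blast
  fix x assume x: "x \<in> carrier G"
  obtain f z where fz: "f \<in> generate G S" "z \<in> carrier G" "x = f \<otimes> z [^] n"
    using divisible_mod[OF x assms] by blast
  obtain c :: "'a \<Rightarrow> int" where c: "f = ?g c"
    using generate_finite_expand[OF finite_S S_carrier fz(1)] by blast
  define d where "d = (\<lambda>s\<in>S. c s mod int n)"
  define w where "w = ?g (\<lambda>s. c s div int n)"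
  have w: "w \<in> carrier G" unfolding w_def by (rule gc)
  have "d \<in> ?P" using assms by (auto simp: d_def)
  have split: "s [^] c s = s [^] d s \<otimes> (s [^] (c s div int n)) [^] int n" if "s \<in> S" for s
  proof -
    have s: "s \<in> carrier G" using that S_carrier by blast
    have "c s = d s + c s div int n * int n" using that by (simp add: d_def)
    then have "s [^] c s = s [^] (d s + c s div int n * int n)" by (rule arg_cong)
    then show ?thesis unfolding int_pow_pow[OF s] int_pow_mult[OF s, symmetric] .
  qed
  have cl: "(\<lambda>s. s [^] d s) \<in> S \<rightarrow> carrier G" "(\<lambda>s. s [^] (c s div int n)) \<in> S \<rightarrow> carrier G"
    "(\<lambda>s. (s [^] (c s div int n)) [^] int n) \<in> S \<rightarrow> carrier G"
    using S_carrier by auto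
  have "?g c = (\<Otimes>s\<in>S. s [^] d s \<otimes> (s [^] (c s div int n)) [^] int n)"
    by (rule finprod_cong') (use split cl in auto)
  also have "\<dots> = ?g d \<otimes> w [^] int n"
    unfolding w_def finprod_int_pow[OF cl(2)] by (rule finprod_multf[OF cl(1,3)])
  finally have "?g c = ?g d \<otimes> w [^] n" unfolding int_pow_int .
  then have "x = (?g d \<otimes> w [^] n) \<otimes> z [^] n" using fz(3) c by metis
  also have "\<dots> = ?g d \<otimes> (w [^] n \<otimes> z [^] n)"
    by (rule m_assoc[OF gc nat_pow_closed[OF w] nat_pow_closed[OF fz(2)]])
  also have "\<dots> = ?g d \<otimes> (w \<otimes> z) [^] n"
    by (simp only: nat_pow_distrib[OF w fz(2)])
  finally have "x = ?g d \<otimes> (w \<otimes> z) [^] n" .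
  then show "\<exists>c \<in> ?g ` ?P. \<exists>y \<in> carrier G. x = c \<otimes> y [^] n"
    using \<open>d \<in> ?P\<close> m_closed[OF w fz(2)] by blast
qed

text \<open>The n-part T is closed under n-th roots, so finiteness of \<open>G\<close> modulo n-th
  powers passes to T: T is generated by a finite set \<open>B'\<close> together with its own n-th
  powers. If \<open>n ^ e\<close> kills \<open>B'\<close>, then the subgroup of
  \<open>n ^ e\<close>-th powers in T is divisible, hence trivial.\<close>

lemma n_part_bounded:
  assumes "n > 0"
  obtains e :: nat where "\<And>x. x \<in> n_part G n \<Longrightarrow> x [^] (n ^ e) = \<one>"
proof -
  let ?T = "n_part G n"
  note T_iff = n_part_iff[OF assms]
  interpret T: subgroup ?T G by (rule subgroup_n_part)
  obtain B where B: "finite B" "B \<subseteq> carrier G"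
    "\<And>x. x \<in> carrier G \<Longrightarrow> \<exists>c \<in> B. \<exists>y \<in> carrier G. x = c \<otimes> y [^] n"
    using finite_mod_multiples[OF assms] by blast
  \<comment> \<open>The representatives in \<open>B\<close> need not lie in T. Each coset of the
    n-th powers that meets T gets a new representative from T.\<close>
  let ?Q = "\<lambda>c t. t \<in> ?T \<and> (\<exists>y \<in> carrier G. t = c \<otimes> y [^] n)"
  define B' where "B' = (\<lambda>c. SOME t. ?Q c t) ` {c \<in> B. \<exists>t. ?Q c t}"
  have finB': "finite B'" using B by (simp add: B'_def)
  have B'T: "B' \<subseteq> ?T" 
  proof -
    have "(SOME t. ?Q c t) \<in> ?T" if "\<exists>t. ?Q c t" for c using someI_ex[OF that] by blast
    then show ?thesis unfolding B'_def by blast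
  qed
  have dec: "\<exists>t' \<in> B'. \<exists>y \<in> ?T. t = t' \<otimes> y [^] n" if t: "t \<in> ?T" for t
  proof -
    obtain c y where c: "c \<in> B" "y \<in> carrier G" "t = c \<otimes> y [^] n"
      using B(3) t T.mem_carrier by blast
    define t' where "t' = (SOME t. ?Q c t)"
    have Q: "?Q c t" using c t by blast
    then have Q': "?Q c t'" unfolding t'_def by (rule someI)
    then obtain z where z: "z \<in> carrier G" "t' = c \<otimes> z [^] n" "t' \<in> ?T" by blast
    have "t' \<in> B'" using Q c(1) unfolding B'_def t'_def by blast
    have cX: "c \<in> carrier G" using c B by blast
    have tz: "t = t' \<otimes> (y \<otimes> inv z) [^] n"
    proof -
      have "t' \<otimes> (y \<otimes> inv z) [^] n = c \<otimes> y [^] n \<otimes> (z [^] n \<otimes> inv (z [^] n))"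
        using c z cX by (simp add: nat_pow_distrib nat_pow_inv m_ac)
      then show ?thesis using c z cX by simp
    qed
    then have "(y \<otimes> inv z) [^] n = inv t' \<otimes> t"
      using c z t T.mem_carrier by (simp add: inv_solve_left)
    then have "(y \<otimes> inv z) [^] n \<in> ?T" using z t by simp
    then have "y \<otimes> inv z \<in> ?T"
      unfolding T_iff using c z by (auto simp: nat_pow_pow simp flip: power_Suc)
    with \<open>t' \<in> B'\<close> tz show ?thesis by blast
  qed
  have "\<forall>t \<in> B'. \<exists>k. t [^] (n ^ k) = \<one>" using B'T T_iff by blast
  then obtain k where k: "\<And>t. t \<in> B' \<Longrightarrow> t [^] (n ^ k t) = \<one>" by metis
  define e where "e = sum k B'"
  have e: "t [^] (n ^ e) = \<one>" if "t \<in> B'" for t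
  proof -
    have "k t \<le> e" unfolding e_def using finB' that by (simp add: member_le_sum)
    then have "n ^ e = n ^ k t * n ^ (e - k t)" by (simp flip: power_add)
    moreover have "t \<in> carrier G" using B'T that T.mem_carrier by blast
    ultimately show ?thesis using k[OF that] by (metis nat_pow_pow nat_pow_one)
  qed
  \<comment> \<open>Writing \<open>t\<close> as an element of \<open>B'\<close> times
    \<open>y [^] n\<close> and raising to the power \<open>n ^ e\<close> removes the factor from
    \<open>B'\<close>, so each element of \<open>D\<close> is an n-th power of another element of
    \<open>D\<close>.\<close>
  define D where "D = {t [^] (n ^ e) | t. t \<in> ?T}"
  have DT: "d \<in> ?T" if "d \<in> D" for d
    using that subgroup_nat_pow_closed[OF subgroup_n_part] by (auto simp: D_def)
  have sD: "subgroup D G"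
  proof (rule subgroupI)
    show "D \<subseteq> carrier G" using DT by auto
    show "D \<noteq> {}" unfolding D_def using T.one_closed by blast
  next
    fix a assume "a \<in> D"
    then obtain t where "t \<in> ?T" "a = t [^] (n ^ e)" by (auto simp: D_def)
    then show "inv a \<in> D" unfolding D_def
      by (auto simp: nat_pow_inv intro!: exI[of _ "inv t"])
  next
    fix a b assume "a \<in> D" "b \<in> D"
    then obtain t u where "t \<in> ?T" "a = t [^] (n ^ e)" "u \<in> ?T" "b = u [^] (n ^ e)"
      by (auto simp: D_def)
    then show "a \<otimes> b \<in> D" unfolding D_def
      by (auto simp: nat_pow_distrib intro!: exI[of _ "t \<otimes> u"])
  qed
  have nD: "\<exists>d' \<in> D. d' [^] n = d" if d: "d \<in> D" for d
  proof -
    obtain t where t: "t \<in> ?T" "d = t [^] (n ^ e)" using d by (auto simp: D_def)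
    obtain t' y where y: "t' \<in> B'" "y \<in> ?T" "t = t' \<otimes> y [^] n" using dec[OF t(1)] by blast
    have "d = (y [^] (n ^ e)) [^] n"
      using t y e[OF y(1)] B'T by (simp add: nat_pow_distrib nat_pow_pow subset_iff mult.commute)
    with y show ?thesis unfolding D_def by blast
  qed
  have "D = {\<one>}"
  proof (rule reduced_subgroup_trivial[OF reduced sD])
    fix q d assume q: "Factorial_Ring.prime (q::nat)" and d: "d \<in> D"
    show "\<exists>y \<in> D. y [^] q = d"
    proof (cases "q dvd n")
      case True
      then obtain m where m: "n = m * q" by (metis dvdE mult.commute)
      obtain d' where d': "d' \<in> D" "d' [^] n = d" using nD[OF d] by blast
      have "d' [^] m \<in> D" using subgroup_nat_pow_closed[OF sD] d' by blast
      moreover have "(d' [^] m) [^] q = d" using d' m DT by (simp add: nat_pow_pow)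
      ultimately show ?thesis by blast
    next
      case False
      \<comment> \<open>For a prime \<open>q\<close> not dividing \<open>n\<close>, the order of
        \<open>d\<close> is prime to \<open>q\<close>, so roots exist already in the cyclic group of
        \<open>d\<close>.\<close>
      obtain j where j: "d [^] (n ^ j) = \<one>" using DT[OF d] T_iff by blast
      have dc: "d \<in> carrier G" using DT[OF d] by simp
      let ?C = "{x [^] q | x. x \<in> D}"
      have sC: "subgroup ?C G"
      proof (rule subgroupI)
        show "?C \<subseteq> carrier G" using DT by auto
        show "?C \<noteq> {}" using subgroup.one_closed[OF sD] by blast
      next
        fix a assume "a \<in> ?C"
        then obtain t where "t \<in> D" "a = t [^] q" by blast
        then show "inv a \<in> ?C" using DT subgroup.m_inv_closed[OF sD]
          by (auto simp: nat_pow_inv intro!: exI[of _ "inv t"])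
      next
        fix a b assume "a \<in> ?C" "b \<in> ?C"
        then obtain t u where "t \<in> D" "a = t [^] q" "u \<in> D" "b = u [^] q" by blast
        then show "a \<otimes> b \<in> ?C" using DT subgroup.m_closed[OF sD]
          by (auto simp: nat_pow_distrib intro!: exI[of _ "t \<otimes> u"])
      qed
      have "d \<in> ?C"
      proof (rule coprime_pow_mem[OF sC dc])
        show "coprime q (n ^ j)" using False q by (simp add: prime_imp_coprime)
        show "d [^] q \<in> ?C" using d by blast
        show "d [^] (n ^ j) \<in> ?C" using j subgroup.one_closed[OF sC] by simp
      qed
      then show ?thesis by blast
    qed
  qed
  then show thesis using that unfolding D_def by blast
qed

text \<open>If a power of \<open>y\<close> with exponent \<open>n ^ e\<close> lies in the n-part,
  then \<open>y\<close> itself does, and so that power is trivial.\<close>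

lemma n_part_disjoint_multiples:
  assumes "n > 0" "\<And>x. x \<in> n_part G n \<Longrightarrow> x [^] (n ^ e) = \<one>"
  shows "n_part G n \<inter> multiples G (n ^ e) = {\<one>}"
proof -
  have "t = \<one>" if t: "t \<in> n_part G n" "t \<in> multiples G (n ^ e)" for t
  proof -
    obtain y where y: "y \<in> carrier G" "t = y [^] (n ^ e)" using t by (auto simp: multiples_def)
    then have "y \<in> n_part G n" using t(1) unfolding n_part_iff[OF assms(1)]
      by (auto simp: nat_pow_pow simp flip: power_add)
    then show ?thesis using assms(2) y by blast
  qed
  then show ?thesis
    using subgroup.one_closed[OF subgroup_n_part] subgroup.one_closed[OF subgroup_multiples] by blast
qed

text \<open>By \<open>n_part_disjoint_multiples\<close> the n-part embeds into the finite quotient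
  of \<open>G\<close> by its \<open>n ^ e\<close>-th powers; \<open>r\<close> picks the
  representative of a coset.\<close>

lemma finite_n_part:
  assumes "n > 0"
  shows "finite (n_part G n)"
proof -
  let ?T = "n_part G n"
  interpret T: subgroup ?T G by (rule subgroup_n_part)
  obtain e where e: "\<And>x. x \<in> ?T \<Longrightarrow> x [^] (n ^ e) = \<one>" using n_part_bounded[OF assms] by blast
  have "n ^ e > 0" using assms by simp
  then obtain B where B: "finite B" "B \<subseteq> carrier G"
    "\<And>x. x \<in> carrier G \<Longrightarrow> \<exists>c \<in> B. \<exists>y \<in> carrier G. x = c \<otimes> y [^] (n ^ e)"
    using finite_mod_multiples by blast
  then obtain r s where rs: "\<And>x. x \<in> carrier G \<Longrightarrow> r x \<in> B \<and> s x \<in> carrier G \<and> x = r x \<otimes> s x [^] (n ^ e)"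
    by metis
  have "inj_on r ?T"
  proof (rule inj_onI)
    fix x y assume xy: "x \<in> ?T" "y \<in> ?T" "r x = r y"
    have x: "x = r x \<otimes> s x [^] (n ^ e)" "s x \<in> carrier G" "r x \<in> carrier G"
      and y: "y = r x \<otimes> s y [^] (n ^ e)" "s y \<in> carrier G"
      using rs[of x] rs[of y] B(2) xy T.mem_carrier by auto
    have "x \<otimes> inv y = (r x \<otimes> s x [^] (n ^ e)) \<otimes> inv (r x \<otimes> s y [^] (n ^ e))"
      by (rule arg_cong2[of _ _ _ _ "\<lambda>a b. a \<otimes> inv b", OF x(1) y(1)])
    also have "\<dots> = (r x \<otimes> inv (r x)) \<otimes> (s x [^] (n ^ e) \<otimes> inv (s y [^] (n ^ e)))"
      using x(2,3) y(2) by (simp only: inv_mult inv_closed m_ac nat_pow_closed m_closed)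
    also have "\<dots> = (s x \<otimes> inv (s y)) [^] (n ^ e)"
      using x(2,3) y(2) by (simp add: nat_pow_distrib nat_pow_inv)
    finally have "x \<otimes> inv y = (s x \<otimes> inv (s y)) [^] (n ^ e)" .
    then have "x \<otimes> inv y \<in> multiples G (n ^ e)" using x y by (auto simp: multiples_def)
    moreover have "x \<otimes> inv y \<in> ?T" using xy by simp
    ultimately have "x \<otimes> inv y = \<one>" using n_part_disjoint_multiples[OF assms e] by blast
    then show "x = y" using xy by (metis T.mem_carrier inv_closed inv_equality inv_inv)
  qed
  moreover have "r ` ?T \<subseteq> B" using rs T.mem_carrier by blast
  ultimately show ?thesis using B(1) by (meson inj_on_finite)
qed

text \<open>The intersection of all \<open>multiples G n\<close> is divisible. A p-th root of
  \<open>x\<close> must lie in all of them at once, and an arbitrary root need not; the bound on the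
  p-part supplies a root that does.\<close>

lemma mem_all_multiples_imp_one:
  assumes "\<And>n::nat. n > 0 \<Longrightarrow> x \<in> multiples G n"
  shows "x = \<one>"
proof -
  define D where "D = (\<Inter>n\<in>{0<..}. multiples G n)"
  have sD: "subgroup D G" unfolding D_def
    by (rule subgroup_Inter) (auto simp: subgroup_multiples)
  have "D = {\<one>}"
  proof (rule reduced_subgroup_trivial[OF reduced sD])
    fix p x assume p: "Factorial_Ring.prime (p::nat)" and x: "x \<in> D"
    then have p0: "p > 0" by (simp add: prime_gt_0_nat)
    obtain e where e: "\<And>x. x \<in> n_part G p \<Longrightarrow> x [^] (p ^ e) = \<one>" using n_part_bounded[OF p0] by blast
    have "x \<in> multiples G (p ^ Suc e)" using x p0 unfolding D_def by (auto simp del: power_Suc)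
    then obtain z where z: "z \<in> carrier G" "x = z [^] (p ^ Suc e)" by (auto simp: multiples_def)
    \<comment> \<open>The candidate root is fixed before \<open>m\<close>. Any other root
      \<open>w [^] m\<close> of \<open>x\<close> with exponent \<open>p ^ Suc e\<close> differs from
      \<open>z\<close> by an element of the p-part, which the exponent \<open>p ^ e\<close>
      kills.\<close>
    have "z [^] (p ^ e) \<in> multiples G m" if "m > 0" for m
    proof -
      have "x \<in> multiples G (p ^ Suc e * m)" using x p0 that unfolding D_def by auto
      then obtain w where w: "w \<in> carrier G" "x = w [^] (p ^ Suc e * m)" by (auto simp: multiples_def)
      have wm: "w [^] m \<in> carrier G" using w by simp
      have "z [^] (p ^ Suc e) = (w [^] m) [^] (p ^ Suc e)"
        using z w by (simp add: nat_pow_pow mult.commute del: power_Suc)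
      then have "(z \<otimes> inv (w [^] m)) [^] (p ^ Suc e) = \<one>"
        using z wm by (intro pow_inv_eq_one)
      then have "z \<otimes> inv (w [^] m) \<in> n_part G p" using z wm p0 by (auto simp: n_part_iff simp del: power_Suc)
      then have "(z \<otimes> inv (w [^] m)) [^] (p ^ e) = \<one>" by (rule e)
      then have "z [^] (p ^ e) \<otimes> inv ((w [^] m) [^] (p ^ e)) = \<one>"
        using z wm by (simp add: nat_pow_distrib nat_pow_inv)
      then have "z [^] (p ^ e) = (w [^] m) [^] (p ^ e)"
        using z wm by (metis inv_closed inv_equality inv_inv nat_pow_closed)
      also have "\<dots> = (w [^] (p ^ e)) [^] m" using w by (simp add: nat_pow_pow mult.commute)
      finally show ?thesis using w by (auto simp: multiples_def)
    qed
    then have "z [^] (p ^ e) \<in> D" unfolding D_def by auto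
    moreover have "(z [^] (p ^ e)) [^] p = x" using z by (simp add: nat_pow_pow mult.commute)
    ultimately show "\<exists>y \<in> D. y [^] p = x" by blast
  qed
  moreover have "x \<in> D" using assms unfolding D_def by simp
  ultimately show ?thesis by blast
qed

end

section \<open>Splitting off a primary part\<close>

context comm_group
begin

lemma internal_direct_sumD:
  assumes "internal_direct_sum G A B"
  shows "subgroup A G" "subgroup B G" "A \<inter> B = {\<one>}"
    "x \<in> carrier G \<Longrightarrow> \<exists>a \<in> A. \<exists>b \<in> B. x = a \<otimes> b"
  using assms unfolding internal_direct_sum_def set_mult_def by (auto simp: set_eq_iff)

lemma internal_direct_sumI:
  assumes "subgroup A G" "subgroup B G" "\<And>x. x \<in> A \<Longrightarrow> x \<in> B \<Longrightarrow> x = \<one>"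
    "\<And>x. x \<in> carrier G \<Longrightarrow> \<exists>a \<in> A. \<exists>b \<in> B. x = a \<otimes> b"
  shows "internal_direct_sum G A B"
proof -
  have "A \<inter> B = {\<one>}"
    using assms(3) subgroup.one_closed[OF assms(1)] subgroup.one_closed[OF assms(2)] by blast
  moreover have "A <#> B = carrier G"
    using assms(4) subgroup.mem_carrier[OF assms(1)] subgroup.mem_carrier[OF assms(2)]
    unfolding set_mult_def by blast
  ultimately show ?thesis using assms(1,2) unfolding internal_direct_sum_def by blast
qed

lemma mult_inv_cancel:
  assumes "x \<in> carrier G" "y \<in> carrier G"
  shows "x \<otimes> y \<otimes> inv x = y" "x \<otimes> (y \<otimes> inv x) = y"
proof -
  have "x \<otimes> y \<otimes> inv x = y \<otimes> (x \<otimes> inv x)" using assms by (simp only: m_ac inv_closed m_closed)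
  then show "x \<otimes> y \<otimes> inv x = y" using assms by simp
  then show "x \<otimes> (y \<otimes> inv x) = y" using assms by (simp add: m_assoc)
qed

lemma eq_of_mult_inv_eq_one:
  assumes "x \<in> carrier G" "y \<in> carrier G" "x \<otimes> inv y = \<one>"
  shows "x = y"
  using assms by (metis inv_closed inv_equality inv_inv)

lemma direct_sum_projection:
  assumes "internal_direct_sum G A B"
  obtains \<pi> where "\<pi> \<in> hom G G" "\<And>x. x \<in> carrier G \<Longrightarrow> \<pi> x \<in> B"
    "\<And>x. x \<in> carrier G \<Longrightarrow> \<exists>a \<in> A. x = a \<otimes> \<pi> x" "\<And>x. x \<in> A \<Longrightarrow> \<pi> x = \<one>"
    "\<And>x. x \<in> B \<Longrightarrow> \<pi> x = x"
proof -
  note AB = internal_direct_sumD[OF assms]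
  have cA: "x \<in> carrier G" if "x \<in> A" for x using subgroup.mem_carrier[OF AB(1) that] .
  have cB: "x \<in> carrier G" if "x \<in> B" for x using subgroup.mem_carrier[OF AB(2) that] .
  have uniq: "b = b'" if "a \<in> A" "a' \<in> A" "b \<in> B" "b' \<in> B" "a \<otimes> b = a' \<otimes> b'" for a a' b b'
  proof -
    have ca: "a \<in> carrier G" "a' \<in> carrier G" and cb: "b \<in> carrier G" "b' \<in> carrier G"
      using that cA cB by auto
    have "b' \<otimes> inv b = inv a' \<otimes> (a' \<otimes> b') \<otimes> inv b" using ca cb by (simp flip: m_assoc)
    also have "\<dots> = inv a' \<otimes> (a \<otimes> b) \<otimes> inv b" using that(5) by simp
    also have "\<dots> = inv a' \<otimes> a" using ca cb by (simp add: m_assoc)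
    finally have eq: "b' \<otimes> inv b = inv a' \<otimes> a" .
    have "b' \<otimes> inv b \<in> B" using that AB(2) by (simp add: subgroup.m_closed subgroup.m_inv_closed)
    moreover have "inv a' \<otimes> a \<in> A" using that AB(1) by (simp add: subgroup.m_closed subgroup.m_inv_closed)
    ultimately have "b' \<otimes> inv b = \<one>" using eq AB(3) by auto
    then show ?thesis using eq_of_mult_inv_eq_one[OF cb(2,1)] by simp
  qed
  have "\<forall>x \<in> carrier G. \<exists>b. b \<in> B \<and> (\<exists>a \<in> A. x = a \<otimes> b)" using AB(4) by blast
  then obtain \<pi> where \<pi>: "\<And>x. x \<in> carrier G \<Longrightarrow> \<pi> x \<in> B \<and> (\<exists>a \<in> A. x = a \<otimes> \<pi> x)" by metis
  have "\<pi> (x \<otimes> y) = \<pi> x \<otimes> \<pi> y" if x: "x \<in> carrier G" and y: "y \<in> carrier G" for x y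
  proof -
    obtain a b c where a: "a \<in> A" "x = a \<otimes> \<pi> x" and b: "b \<in> A" "y = b \<otimes> \<pi> y"
      and c: "c \<in> A" "x \<otimes> y = c \<otimes> \<pi> (x \<otimes> y)" using \<pi> x y m_closed by metis
    have "x \<otimes> y = (a \<otimes> \<pi> x) \<otimes> (b \<otimes> \<pi> y)" using a(2) b(2) by metis
    also have "\<dots> = (a \<otimes> b) \<otimes> (\<pi> x \<otimes> \<pi> y)"
      using cA[OF a(1)] cA[OF b(1)] cB[of "\<pi> x"] cB[of "\<pi> y"] \<pi>[OF x] \<pi>[OF y] by (simp only: m_ac m_closed)
    finally have eq: "c \<otimes> \<pi> (x \<otimes> y) = (a \<otimes> b) \<otimes> (\<pi> x \<otimes> \<pi> y)" using c(2) by metis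
    show ?thesis
    proof (rule uniq[OF c(1) _ _ _ eq])
      show "a \<otimes> b \<in> A" using a b AB(1) by (simp add: subgroup.m_closed)
      show "\<pi> (x \<otimes> y) \<in> B" "\<pi> x \<otimes> \<pi> y \<in> B" using \<pi> x y AB(2) by (simp_all add: subgroup.m_closed)
    qed
  qed
  then have "\<pi> \<in> hom G G" using \<pi> cB by (intro homI) auto
  moreover have "\<pi> x = \<one>" if x: "x \<in> A" for x
  proof -
    obtain a where "a \<in> A" "x = a \<otimes> \<pi> x" using \<pi> cA[OF x] by blast
    then show ?thesis using uniq[of x a \<one> "\<pi> x"] x \<pi> cA subgroup.one_closed[OF AB(2)] by simp
  qed
  moreover have "\<pi> x = x" if x: "x \<in> B" for x
  proof -
    obtain a where "a \<in> A" "x = a \<otimes> \<pi> x" using \<pi> cB[OF x] by blast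
    then show ?thesis using uniq[of \<one> a x "\<pi> x"] x \<pi> cB subgroup.one_closed[OF AB(1)] by simp
  qed
  ultimately show thesis using \<pi> that by blast
qed

text \<open>A nontrivial subgroup of a cyclic p-group contains its socle. Up to sign
  \<open>j\<close> is \<open>p ^ i * u\<close> with \<open>u\<close> prime to \<open>p\<close> and
  \<open>i \<le> e\<close>, so a further power of \<open>t [^] j\<close> is
  \<open>(t [^] (p ^ e)) [^] u\<close>, and \<open>u\<close> can be inverted modulo
  \<open>p\<close>.\<close>

lemma prime_power_order_mult_mem:
  assumes C: "subgroup C G" and p: "Factorial_Ring.prime (p::nat)" and t: "t \<in> carrier G"
    and top: "t [^] (p ^ Suc e) = \<one>" and j: "t [^] (j::int) \<in> C" "t [^] j \<noteq> \<one>"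
  shows "t [^] (p ^ e) \<in> C"
proof -
  have "j \<noteq> 0" using j by auto
  define J where "J = nat \<bar>j\<bar>"
  have "J > 0" using \<open>j \<noteq> 0\<close> by (simp add: J_def)
  have "t [^] J \<in> C"
  proof (cases "j \<ge> 0")
    case True
    then show ?thesis using j by (simp add: J_def flip: int_pow_int)
  next
    case False
    then have "t [^] J = inv (t [^] j)" using t
      by (simp add: J_def flip: int_pow_int int_pow_neg)
    then show ?thesis using j subgroup.m_inv_closed[OF C] by simp
  qed
  obtain i u where u: "J = p ^ i * u" "\<not> p dvd u"
    using p \<open>J > 0\<close> by (metis bot_nat_0.not_eq_extremum not_prime_unit multiplicity_decompose')
  have "i \<le> e"
  proof (rule ccontr)
    assume "\<not> i \<le> e"
    then have "p ^ Suc e dvd J" using u by (simp add: le_imp_power_dvd del: power_Suc)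
    then obtain m where "J = p ^ Suc e * m" by auto
    then have "t [^] J = \<one>" using top t by (simp flip: nat_pow_pow del: power_Suc)
    then have "t [^] j = \<one>" using t unfolding J_def
      by (cases "j \<ge> 0") (simp_all add: int_pow_neg inv_eq_1_iff flip: int_pow_int)
    then show False using j by simp
  qed
  show ?thesis
  proof (rule coprime_pow_mem[OF C])
    show "t [^] p ^ e \<in> carrier G" using t by simp
    show "coprime u p" using u p by (simp add: prime_imp_coprime coprime_commute)
    have "(t [^] (p ^ e)) [^] u = (t [^] J) [^] (p ^ (e - i))"
      using t u \<open>i \<le> e\<close> by (simp add: nat_pow_pow mult_ac flip: power_add)
    also have "\<dots> \<in> C" using subgroup_nat_pow_closed[OF C] \<open>t [^] J \<in> C\<close> by blast
    finally show "(t [^] (p ^ e)) [^] u \<in> C" .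
    show "(t [^] (p ^ e)) [^] p \<in> C"
      using t top subgroup.one_closed[OF C] by (simp add: nat_pow_pow mult.commute)
  qed
qed

text \<open>A cyclic subgroup whose socle avoids \<open>p\<^sup>e\<^sup>+\<^sup>1 G\<close> splits off: a complement is a subgroup maximal
  among those that contain \<open>p\<^sup>e\<^sup>+\<^sup>1 G\<close> and avoid the socle.\<close>

lemma cyclic_direct_summand:
  assumes p: "Factorial_Ring.prime (p::nat)" and t: "t \<in> carrier G"
    and top: "t [^] (p ^ Suc e) = \<one>" and ht: "t [^] (p ^ e) \<notin> multiples G (p ^ Suc e)"
  shows "\<exists>C. internal_direct_sum G (generate G {t}) C"
proof -
  define \<F> where "\<F> = {C. subgroup C G \<and> multiples G (p ^ Suc e) \<subseteq> C \<and> t [^] (p ^ e) \<notin> C}"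
  have "\<exists>M\<in>\<F>. \<forall>K\<in>\<F>. M \<subseteq> K \<longrightarrow> K = M"
  proof (rule subset_Zorn_nonempty)
    show "\<F> \<noteq> {}" using ht subgroup_multiples unfolding \<F>_def by blast
  next
    fix Ch assume Ch: "Ch \<noteq> {}" "subset.chain \<F> Ch"
    then have ChF: "Ch \<subseteq> \<F>" and lin: "\<And>K Y. K \<in> Ch \<Longrightarrow> Y \<in> Ch \<Longrightarrow> K \<subseteq> Y \<or> Y \<subseteq> K"
      by (auto simp: subset.chain_def)
    have "subgroup (\<Union>Ch) G"
    proof (rule subgroupI)
      show "\<Union>Ch \<subseteq> carrier G" using ChF subgroup.subset unfolding \<F>_def by blast
      show "\<Union>Ch \<noteq> {}" using Ch ChF subgroup.one_closed unfolding \<F>_def by blast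
    next
      fix a assume "a \<in> \<Union>Ch"
      then obtain K where K: "a \<in> K" "K \<in> Ch" by blast
      then have "subgroup K G" using ChF unfolding \<F>_def by blast
      then have "inv a \<in> K" using K(1) by (rule subgroup.m_inv_closed)
      then show "inv a \<in> \<Union>Ch" using K(2) by blast
    next
      fix a b assume "a \<in> \<Union>Ch" "b \<in> \<Union>Ch"
      then obtain K Y where "a \<in> K" "b \<in> Y" "K \<in> Ch" "Y \<in> Ch" by blast
      then obtain Z where "a \<in> Z" "b \<in> Z" "Z \<in> Ch" using lin by blast
      moreover have "subgroup Z G" using ChF \<open>Z \<in> Ch\<close> unfolding \<F>_def by blast
      ultimately have "a \<otimes> b \<in> Z" using \<open>a \<in> Z\<close> \<open>b \<in> Z\<close> by (simp add: subgroup.m_closed)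
      then show "a \<otimes> b \<in> \<Union>Ch" using \<open>Z \<in> Ch\<close> by blast
    qed
    then show "\<Union>Ch \<in> \<F>" using ChF Ch unfolding \<F>_def by blast
  qed
  then obtain C where CF: "C \<in> \<F>" and max: "\<And>K. K \<in> \<F> \<Longrightarrow> C \<subseteq> K \<Longrightarrow> K = C"
    by blast
  from CF have C: "subgroup C G" and mC: "multiples G (p ^ Suc e) \<subseteq> C" and tC: "t [^] (p ^ e) \<notin> C"
    unfolding \<F>_def by blast+
  let ?A = "generate G {t}"
  have A: "subgroup ?A G" using t by (intro generate_is_subgroup) auto
  have A_eq: "?A = {t [^] (k::int) | k. k \<in> UNIV}" using generate_pow[OF t] .
  have W: "subgroup (?A <#> C) G" using A C by (rule mult_subgroups)
  have AW: "?A \<subseteq> ?A <#> C"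
  proof
    fix a assume "a \<in> ?A"
    then show "a \<in> ?A <#> C" unfolding set_mult_def
      using subgroup.one_closed[OF C] subgroup.mem_carrier[OF A, of a] by force
  qed
  have CW: "C \<subseteq> ?A <#> C"
  proof
    fix a assume "a \<in> C"
    then show "a \<in> ?A <#> C" unfolding set_mult_def
      using subgroup.one_closed[OF A] subgroup.mem_carrier[OF C, of a] by force
  qed
  note Cc = subgroup.mem_carrier[OF C]
  have socle: "t [^] (p ^ e) \<in> K" if "subgroup K G" "C \<subseteq> K" "K \<noteq> C" for K
    using max[of K] that mC unfolding \<F>_def by blast
  \<comment> \<open>The sum of the cyclic group and \<open>C\<close> is closed under p-th roots. As
    it contains all \<open>p ^ Suc e\<close>-th powers, it then has to be all of
    \<open>G\<close>.\<close>
  have in_W: "x \<in> ?A <#> C" if x: "x \<in> carrier G" and px: "x [^] p \<in> ?A <#> C" for x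
  proof -
    obtain j c where jc: "c \<in> C" "x [^] p = t [^] (j::int) \<otimes> c"
      using px unfolding set_mult_def A_eq by blast
    have cc: "c \<in> carrier G" using jc Cc by blast
    have "(t [^] (p ^ e)) [^] j \<otimes> c [^] (p ^ e) = x [^] (p ^ Suc e)"
    proof -
      have "x [^] (p ^ Suc e) = (t [^] j \<otimes> c) [^] (p ^ e)"
        unfolding jc(2)[symmetric] using x by (simp add: nat_pow_pow)
      also have "\<dots> = (t [^] j) [^] (p ^ e) \<otimes> c [^] (p ^ e)"
        using t cc by (simp add: nat_pow_distrib)
      also have "(t [^] j) [^] (p ^ e) = (t [^] (p ^ e)) [^] j"
        using t by (simp add: int_pow_pow mult.commute flip: int_pow_int)
      finally show ?thesis by simp
    qed
    also have "\<dots> \<in> C" using mC x by (auto simp: multiples_def)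
    finally have "(t [^] (p ^ e)) [^] j \<otimes> c [^] (p ^ e) \<in> C" .
    moreover have "c [^] (p ^ e) \<in> C" using subgroup_nat_pow_closed[OF C jc(1)] .
    ultimately have jC: "(t [^] (p ^ e)) [^] j \<in> C"
      using subgroup_mult_cancel_right[OF C] t by (metis int_pow_closed nat_pow_closed)
    have t0p: "(t [^] (p ^ e)) [^] p = \<one>" using top t by (simp add: nat_pow_pow mult.commute)
    \<comment> \<open>Otherwise the socle element, which has order dividing \<open>p\<close>, would
      be a power of its j-th power and lie in \<open>C\<close>. Divisibility allows the correction
      of \<open>x\<close> by a power of \<open>t\<close> to an element \<open>x'\<close> whose p-th
      power lies in \<open>C\<close>.\<close>
    have "int p dvd j"
    proof (rule ccontr)
      assume "\<not> int p dvd j"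
      then have "coprime (int p) j" using p by (simp add: prime_imp_coprime)
      then obtain u v where uv: "u * int p + v * j = 1"
        by (metis bezout_int coprime_iff_gcd_eq_1)
      let ?s = "t [^] (p ^ e)"
      have s: "?s \<in> carrier G" using t by simp
      have "?s = ?s [^] (int p * u + j * v)" using uv s by (simp add: mult.commute)
      also have "\<dots> = (?s [^] p) [^] u \<otimes> (?s [^] j) [^] v"
        using s by (simp add: int_pow_mult int_pow_pow flip: int_pow_int)
      also have "\<dots> = (?s [^] j) [^] v" using s t0p by simp
      also have "\<dots> \<in> C" using subgroup_int_pow_closed[OF C jC] .
      finally show False using tC by blast
    qed
    then obtain j' where j': "j = j' * int p" by (metis dvdE mult.commute)
    define x' where "x' = x \<otimes> inv (t [^] j')"
    have x': "x' \<in> carrier G" using x t by (simp add: x'_def)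
    have xx': "x = t [^] j' \<otimes> x'" using x t by (simp add: x'_def m_lcomm)
    have tj': "t [^] j' \<in> ?A" unfolding A_eq by blast
    have "x' [^] p = c"
    proof -
      have "x' [^] p = x [^] p \<otimes> inv ((t [^] j') [^] p)"
        using x t by (simp add: x'_def nat_pow_distrib nat_pow_inv)
      also have "(t [^] j') [^] p = t [^] j"
        using t j' by (simp add: int_pow_pow flip: int_pow_int)
      also have "x [^] p \<otimes> inv (t [^] j) = c"
        unfolding jc(2) using cc t by (simp add: m_assoc m_comm[of _ c])
      finally show ?thesis .
    qed
    show ?thesis
    proof (rule ccontr)
      assume "x \<notin> ?A <#> C"
      then have x'W: "x' \<notin> ?A <#> C"
        using xx' tj' AW subgroup.m_closed[OF W] by blast
      \<comment> \<open>By maximality of \<open>C\<close>, adjoining \<open>x'\<close> brings in the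
        socle element, as \<open>x' [^] i\<close> times an element of \<open>C\<close>. Here
        \<open>p\<close> cannot divide \<open>i\<close>, so \<open>x'\<close> is a combination of
        \<open>x' [^] i\<close> and \<open>x' [^] p\<close>, both in the sum already.\<close>
      let ?K = "generate G {x'} <#> C"
      have gx: "subgroup (generate G {x'}) G" using x' by (intro generate_is_subgroup) auto
      have K: "subgroup ?K G" using gx C by (rule mult_subgroups)
      have "C \<subseteq> ?K"
      proof
        fix a assume "a \<in> C"
        then show "a \<in> ?K" unfolding set_mult_def
          using subgroup.one_closed[OF gx] Cc[of a] by force
      qed
      moreover have "x' \<in> ?K" unfolding set_mult_def
        using subgroup.one_closed[OF C] x' generate.incl[of x' "{x'}" G] by force
      then have "?K \<noteq> C" using x'W CW by blast
      ultimately have "t [^] (p ^ e) \<in> ?K" using socle[OF K] by blast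
      then obtain i c' where ic: "c' \<in> C" "t [^] (p ^ e) = x' [^] (i::int) \<otimes> c'"
        unfolding set_mult_def generate_pow[OF x'] by blast
      have xpC: "x' [^] int p \<in> C" using \<open>x' [^] p = c\<close> jc by (simp add: int_pow_int)
      have "t [^] (p ^ e) \<in> ?A <#> C"
      proof -
        have "t [^] int (p ^ e) \<in> ?A" unfolding A_eq by blast
        then show ?thesis using AW unfolding int_pow_int by blast
      qed
      then have "x' [^] i \<in> ?A <#> C"
        using subgroup_mult_cancel_right[OF W _ _ \<open>t [^] (p ^ e) \<in> ?A <#> C\<close>[unfolded ic(2)]]
          ic(1) CW x' by blast
      moreover have "\<not> int p dvd i"
      proof
        assume "int p dvd i"
        then obtain m where "i = int p * m" by auto
        then have "x' [^] i = (x' [^] int p) [^] m" using x' by (simp add: int_pow_pow)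
        then have "x' [^] i \<in> C" using subgroup_int_pow_closed[OF C xpC] by simp
        then show False using ic subgroup.m_closed[OF C] tC by metis
      qed
      then have "coprime (int p) i" using p by (simp add: prime_imp_coprime)
      then obtain u v where uv: "u * int p + v * i = 1"
        by (metis bezout_int coprime_iff_gcd_eq_1)
      have x'_eq: "x' = (x' [^] int p) [^] u \<otimes> (x' [^] i) [^] v"
      proof -
        have "x' = x' [^] (int p * u + i * v)" using uv x' by (simp add: mult.commute)
        then show ?thesis using x' by (simp add: int_pow_mult int_pow_pow)
      qed
      have "x' [^] int p \<in> ?A <#> C" using xpC CW by blast
      then have "(x' [^] int p) [^] u \<otimes> (x' [^] i) [^] v \<in> ?A <#> C"
        using \<open>x' [^] i \<in> ?A <#> C\<close>
        using subgroup.m_closed[OF W] subgroup_int_pow_closed[OF W] by blast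
      then show False using x'W x'_eq by metis
    qed
  qed
  \<comment> \<open>Roots of exponent \<open>p ^ i\<close> are taken one factor \<open>p\<close> at
    a time with \<open>in_W\<close>.\<close>
  have "x \<in> ?A <#> C" if x: "x \<in> carrier G" for x
  proof -
    have "x [^] (p ^ i) \<in> ?A <#> C \<Longrightarrow> x \<in> ?A <#> C" for i
    proof (induction i)
      case 0
      then show ?case using x by simp
    next
      case (Suc i)
      then have "(x [^] (p ^ i)) [^] p \<in> ?A <#> C" using x by (simp add: nat_pow_pow mult.commute)
      then show ?case using in_W[of "x [^] (p ^ i)"] x Suc.IH by simp
    qed
    moreover have "x [^] (p ^ Suc e) \<in> ?A <#> C"
      using mC CW x by (auto simp: multiples_def)
    ultimately show ?thesis by blast
  qed
  moreover have "a = \<one>" if aA: "a \<in> ?A" and aC: "a \<in> C" for a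
  proof (rule ccontr)
    assume "a \<noteq> \<one>"
    moreover obtain k :: int where "a = t [^] k" using aA unfolding A_eq by blast
    ultimately show False using aC prime_power_order_mult_mem[OF C p t top] tC by blast
  qed
  ultimately have "internal_direct_sum G ?A C"
    by (intro internal_direct_sumI[OF A C]) (auto simp: set_mult_def)
  then show ?thesis by blast
qed

text \<open>A cyclic p-subgroup of maximal order splits off for some prime \<open>p\<close> dividing
  \<open>n\<close>. Its complement has a smaller n-part, and a complement of that smaller n-part
  inside it is a complement of the whole n-part in \<open>G\<close>.\<close>

lemma n_part_direct_summand_step:
  assumes fin: "finite (n_part G n)" and n: "n > 0"
    and IH: "\<And>C. subgroup C G \<Longrightarrow> card (n_part (G\<lparr>carrier := C\<rparr>) n) < card (n_part G n) \<Longrightarrow>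
      finite (n_part (G\<lparr>carrier := C\<rparr>) n) \<Longrightarrow>
      \<exists>B. internal_direct_sum (G\<lparr>carrier := C\<rparr>) (n_part (G\<lparr>carrier := C\<rparr>) n) B"
  shows "\<exists>C. internal_direct_sum G (n_part G n) C"
proof -
  let ?T = "n_part G n"
  interpret T: subgroup ?T G by (rule subgroup_n_part)
  show ?thesis
  proof (cases "?T = {\<one>}")
    case True
    have "internal_direct_sum G {\<one>} (carrier G)"
      by (rule internal_direct_sumI[OF triv_subgroup subgroup_self]) auto
    then show ?thesis using True by auto
  next
    case False
    then obtain x0 where x0: "x0 \<in> ?T" "x0 \<noteq> \<one>" using T.one_closed by blast
    then have "?T \<noteq> generate G {}" using generate_empty by auto
    then obtain p x where p: "Factorial_Ring.prime p" "p dvd n" "x \<in> p_part G p" "x \<noteq> \<one>"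
    proof -
      have "\<exists>p x. Factorial_Ring.prime p \<and> p dvd n \<and> x \<in> p_part G p \<and> x \<noteq> \<one>"
      proof (rule ccontr)
        assume "\<not> ?thesis"
        then have "(\<Union>p \<in> {p. Factorial_Ring.prime p \<and> p dvd n}. p_part G p) \<subseteq> {\<one>}" by blast
        then have "?T \<subseteq> {\<one>}" unfolding n_part_def
          by (rule generate_subgroup_incl[OF _ triv_subgroup])
        then show False using x0 by blast
      qed
      then show thesis using that by blast
    qed
    have p1: "p > 1" using p prime_gt_1_nat by blast
    have pT: "p_part G p \<subseteq> ?T" unfolding n_part_def using p by (auto intro: generate.incl)
    then have finP: "finite (p_part G p)" using fin finite_subset by blast
    \<comment> \<open>\<open>?Q e\<close> says that some element has order exactly
      \<open>p ^ Suc e\<close>; the largest such \<open>e\<close> is wanted.\<close>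
    let ?Q = "\<lambda>e. \<exists>t \<in> carrier G. t [^] (p ^ Suc e) = \<one> \<and> t [^] (p ^ e) \<noteq> \<one>"
    have "\<exists>e. ?Q e"
    proof -
      obtain k where k: "x \<in> carrier G" "x [^] (p ^ k) = \<one>" using p by (auto simp: p_part_def)
      define m where "m = (LEAST k. x [^] (p ^ k) = \<one>)"
      have m: "x [^] (p ^ m) = \<one>" unfolding m_def using k by (rule_tac LeastI)
      then have "m \<noteq> 0" using p k by (cases m) auto
      then obtain e where "m = Suc e" by (cases m) auto
      moreover have "x [^] (p ^ e) \<noteq> \<one>"
        using not_less_Least[of e "\<lambda>k. x [^] (p ^ k) = \<one>"] \<open>m = Suc e\<close> m_def by auto
      ultimately show ?thesis using m k by blast
    qed
    \<comment> \<open>The iterated p-th powers of such an element are pairwise distinct down to the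
      unit, so the finite p-part bounds \<open>e\<close>.\<close>
    moreover have "e < card (p_part G p)" if "?Q e" for e
    proof -
      from that obtain t where t: "t \<in> carrier G" "t [^] (p ^ Suc e) = \<one>" "t [^] (p ^ e) \<noteq> \<one>"
        by blast
      have mono: "t [^] (p ^ i) = \<one>" if "t [^] (p ^ j) = \<one>" "j \<le> i" for i j
      proof -
        have "p ^ i = p ^ j * p ^ (i - j)" using that by (simp flip: power_add)
        then show ?thesis using that t by (simp flip: nat_pow_pow)
      qed
      have sub: "(\<lambda>i. t [^] (p ^ i)) ` {..Suc e} \<subseteq> p_part G p"
      proof (clarsimp simp: p_part_def t)
        fix i assume "i \<le> Suc e"
        have "(t [^] (p ^ i)) [^] (p ^ Suc e) = \<one>"
          using t(1,2) by (metis mult.commute nat_pow_one nat_pow_pow)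
        then show "\<exists>k. (t [^] p ^ i) [^] p ^ k = \<one>" by blast
      qed
      have "inj_on (\<lambda>i. t [^] (p ^ i)) {..Suc e}"
      proof (rule linorder_inj_onI)
        fix i j assume ij: "i < j" "i \<in> {..Suc e}" "j \<in> {..Suc e}"
        show "t [^] (p ^ i) \<noteq> t [^] (p ^ j)"
        proof
          assume eq: "t [^] (p ^ i) = t [^] (p ^ j)"
          have "(t [^] (p ^ i)) [^] (p ^ (Suc e - j)) = \<one>"
            unfolding eq using t ij by (simp add: nat_pow_pow flip: power_add)
          then have "t [^] (p ^ (i + (Suc e - j))) = \<one>" using t by (simp add: nat_pow_pow power_add)
          then have "t [^] (p ^ e) = \<one>" using mono ij by simp
          then show False using t by simp
        qed
      qed auto
      then have "card {..Suc e} \<le> card (p_part G p)"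
        using sub finP by (metis card_image card_mono)
      then show ?thesis by simp
    qed
    ultimately obtain e where e: "?Q e" and emax: "\<And>e'. ?Q e' \<Longrightarrow> e' \<le> e"
      using ex_has_greatest_nat[of ?Q _ id "card (p_part G p)"] by (metis id_apply less_imp_le)
    then obtain t where t: "t \<in> carrier G" "t [^] (p ^ Suc e) = \<one>" "t [^] (p ^ e) \<noteq> \<one>" by blast
    \<comment> \<open>A root \<open>y\<close> of the socle element with exponent
      \<open>p ^ Suc e\<close> would have order \<open>p ^ Suc (Suc e)\<close>, against the
      maximality of \<open>e\<close>.\<close>
    have "t [^] (p ^ e) \<notin> multiples G (p ^ Suc e)"
    proof
      assume "t [^] (p ^ e) \<in> multiples G (p ^ Suc e)"
      then obtain y where y: "y \<in> carrier G" "t [^] (p ^ e) = y [^] (p ^ Suc e)"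
        by (auto simp: multiples_def)
      have "y [^] (p ^ Suc (Suc e)) = (t [^] (p ^ e)) [^] p"
        unfolding y(2) using y(1) by (simp add: nat_pow_pow mult_ac)
      also have "\<dots> = \<one>" using t by (simp add: nat_pow_pow mult.commute)
      finally have "?Q (Suc e)" using y t by metis
      then show False using emax by fastforce
    qed
    then obtain C where C: "internal_direct_sum G (generate G {t}) C"
      using cyclic_direct_summand[OF p(1) t(1,2)] by blast
    note Cd = internal_direct_sumD[OF C]
    let ?C = "G\<lparr>carrier := C\<rparr>"
    interpret C: comm_group ?C using Cd(2) by (rule subgroup_comm_group)
    have nC: "n_part ?C n = ?T \<inter> C"
      using subgroup.mem_carrier[OF Cd(2)]
      by (auto simp: n_part_iff[OF n] C.n_part_iff[OF n] simp flip: nat_pow_consistent)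
    have tT: "t \<in> ?T" using t(1,2) pT by (auto simp: p_part_def simp del: power_Suc)
    have "t \<notin> C"
    proof
      assume "t \<in> C"
      moreover have "t \<in> generate G {t}" by (rule generate.incl) simp
      ultimately have "t = \<one>" using Cd(3) by blast
      then show False using t by simp
    qed
    then have "card (n_part ?C n) < card ?T"
      using tT fin nC by (intro psubset_card_mono) auto
    then obtain B where B: "internal_direct_sum ?C (?T \<inter> C) B"
      using IH[OF Cd(2)] fin nC by (metis finite_Int)
    note Bd = C.internal_direct_sumD[OF B]
    have sB: "subgroup B G" using incl_subgroup[OF Cd(2) Bd(2)] .
    have BC: "B \<subseteq> C" using subgroup.subset[OF Bd(2)] by simp
    have "internal_direct_sum G ?T B"
    proof (rule internal_direct_sumI[OF subgroup_n_part sB])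
      fix x assume "x \<in> ?T" "x \<in> B"
      then show "x = \<one>" using Bd(3) BC by auto
    next
      fix x assume "x \<in> carrier G"
      then obtain a c where ac: "a \<in> generate G {t}" "c \<in> C" "x = a \<otimes> c" using Cd(4) by blast
      obtain d b where db: "d \<in> ?T \<inter> C" "b \<in> B" "c = d \<otimes> b" using Bd(4)[of c] ac by auto
      have aT: "a \<in> ?T" using ac(1) generate_subgroup_incl[OF _ subgroup_n_part] tT by blast
      then have "x = (a \<otimes> d) \<otimes> b" "a \<otimes> d \<in> ?T"
        using ac db sB by (auto simp: m_assoc subgroup.mem_carrier)
      then show "\<exists>a \<in> ?T. \<exists>b \<in> B. x = a \<otimes> b" using db by blast
    qed
    then show ?thesis by blast
  qed
qed

end

text \<open>The induction on the size of the n-part passes from \<open>G\<close> to a subgroup, so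
  the group itself has to vary.\<close>

lemma n_part_direct_summand:
  assumes "comm_group G" "finite (n_part G n)" "n > 0"
  shows "\<exists>C. internal_direct_sum G (n_part G n) C"
  using assms
proof (induction "card (n_part G n)" arbitrary: G rule: less_induct)
  case less
  show ?case
    by (rule comm_group.n_part_direct_summand_step)
      (use less comm_group.subgroup_comm_group in blast)+
qed

section \<open>Finite quotients and free summands\<close>

lemma frag_cmul_frag_of_carrier:
  "u \<in> B \<Longrightarrow> frag_cmul k (frag_of u) \<in> carrier (free_Abelian_group B)"
  using keys_cmul[of k "frag_of u"] by auto

context comm_group
begin

lemma rcos_nat_pow:
  assumes F: "subgroup F G" and x: "x \<in> carrier G"
  shows "(F #> x) [^]\<^bsub>G Mod F\<^esub> (m::nat) = F #> (x [^] m)"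
proof -
  have N: "F \<lhd> G" using F by (rule subgroup_imp_normal)
  then have "group_hom G (G Mod F) (\<lambda>a. F #> a)"
    by (intro group_homI normal.r_coset_hom_Mod normal.factorgroup_is_group is_group)
  from group_hom.hom_nat_pow[OF this x] show ?thesis by simp
qed

lemma hom_free_Abelian_group_sum:
  assumes h: "h \<in> hom (free_Abelian_group B) G" and U: "finite U" "U \<subseteq> B"
  shows "h (\<Sum>u\<in>U. frag_cmul (d u) (frag_of u)) = (\<Otimes>u\<in>U. h (frag_of u) [^] (d u :: int))"
  using U
proof (induction U rule: finite_induct)
  interpret h: group_hom "free_Abelian_group B" G h
    by (intro group_homI h is_group group_free_Abelian_group)
  {
    case empty
    show ?case using h.hom_one by simp
  next
    case (insert u U)
    have cl: "h (frag_of v) \<in> carrier G" if "v \<in> B" for v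
      using that by (intro h.hom_closed) simp
    have sub: "(\<Sum>u\<in>U. frag_cmul (d u) (frag_of u)) \<in> carrier (free_Abelian_group B)"
      using insert.prems
      by (intro sum_closed_free_Abelian_group frag_cmul_frag_of_carrier) auto
    have "h (frag_cmul (d u) (frag_of u)) = h (frag_of u) [^] d u"
      using h.hom_int_pow[of "frag_of u" "d u"] insert.prems by simp
    moreover have "h (frag_cmul (d u) (frag_of u) + (\<Sum>u\<in>U. frag_cmul (d u) (frag_of u)))
      = h (frag_cmul (d u) (frag_of u)) \<otimes> h (\<Sum>u\<in>U. frag_cmul (d u) (frag_of u))"
      using h.hom_mult[OF frag_cmul_frag_of_carrier sub, of u "d u"] insert.prems by simp
    ultimately show ?case using insert cl by (simp add: Pi_iff subset_iff)
  }
qed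

lemma inj_hom_free_Abelian_group_independent:
  assumes h: "h \<in> hom (free_Abelian_group B) G" and inj: "inj_on h (carrier (free_Abelian_group B))"
    and U: "finite U" "U \<subseteq> B"
  shows "Z_independent G ((\<lambda>u. h (frag_of u)) ` U)" "card ((\<lambda>u. h (frag_of u)) ` U) = card U"
proof -
  let ?b = "\<lambda>u. h (frag_of u)"
  have cl: "?b u \<in> carrier G" if "u \<in> B" for u using hom_in_carrier[OF h] that by simp
  have injb: "inj_on ?b U"
  proof (rule inj_onI)
    fix u v assume "u \<in> U" "v \<in> U" "?b u = ?b v"
    moreover from this U have "frag_of u \<in> carrier (free_Abelian_group B)"
      "frag_of v \<in> carrier (free_Abelian_group B)" by auto
    ultimately have "frag_of u = frag_of v" using inj by (meson inj_onD)
    then show "u = v" by (simp add: frag_of_eq)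
  qed
  then show "card (?b ` U) = card U" by (rule card_image)
  have "c y = 0" if c: "finprod G (\<lambda>x. x [^] c x) (?b ` U) = \<one>" and y: "y \<in> ?b ` U"
    for c :: "'a \<Rightarrow> int" and y
  proof -
    obtain v where v: "v \<in> U" "y = ?b v" using y by blast
    let ?s = "\<Sum>u\<in>U. frag_cmul (c (?b u)) (frag_of u)"
    have "finprod G (\<lambda>x. x [^] c x) (?b ` U) = (\<Otimes>u\<in>U. ?b u [^] c (?b u))"
      using injb cl U by (intro finprod_reindex) auto
    also have "\<dots> = h ?s"
      using hom_free_Abelian_group_sum[OF h U, of "\<lambda>u. c (?b u)"] by simp
    finally have "h ?s = h 0"
      using c hom_one[OF h] is_group by simp
    moreover have "?s \<in> carrier (free_Abelian_group B)"
      using U by (intro sum_closed_free_Abelian_group frag_cmul_frag_of_carrier) auto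
    ultimately have "?s = 0" using inj_onD[OF inj] by simp
    then have "Poly_Mapping.lookup ?s v = 0" by simp
    moreover have "Poly_Mapping.lookup ?s v = (\<Sum>u\<in>U. c (?b u) * (if v = u then 1 else 0))"
      by (simp add: Poly_Mapping.lookup_sum)
    ultimately show ?thesis using v U by (simp add: if_distrib cong: if_cong)
  qed
  then show "Z_independent G (?b ` U)"
    using U cl unfolding Z_independent_def by blast
qed

text \<open>If \<open>m\<close> is the torsion-free rank, an infinite basis of \<open>F\<close>
  would contain \<open>m + 1\<close> elements, and these are independent in \<open>G\<close>. So the
  basis is finite, and its image in \<open>G\<close> is the set \<open>S\<close>.\<close>

lemma reduced_qd_groupI:
  assumes red: "reduced_group G" and qd: "quotient_divisible G"
  shows "\<exists>S. reduced_qd_group G S"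
proof -
  obtain F where F: "subgroup F G" "free_abelian (G\<lparr>carrier := F\<rparr>)"
    "torsion_group (G Mod F)" "divisible_group (G Mod F)"
    using qd unfolding quotient_divisible_def by blast
  obtain B :: "'a set" where "G\<lparr>carrier := F\<rparr> \<cong> free_Abelian_group B"
    using F(2) unfolding free_abelian_def by blast
  moreover have "group (G\<lparr>carrier := F\<rparr>)" using F(1) by (rule subgroup_imp_group)
  ultimately have "free_Abelian_group B \<cong> G\<lparr>carrier := F\<rparr>" by (simp add: group.iso_sym)
  then obtain h where h: "h \<in> iso (free_Abelian_group B) (G\<lparr>carrier := F\<rparr>)"
    unfolding is_iso_def by blast
  have hF: "h ` carrier (free_Abelian_group B) = F" and inj: "inj_on h (carrier (free_Abelian_group B))"
    using h by (auto simp: iso_def bij_betw_def)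
  have hG: "h \<in> hom (free_Abelian_group B) G"
    using h subgroup.mem_carrier[OF F(1)] by (auto simp: iso_def hom_def Pi_iff)
  interpret h: group_hom "free_Abelian_group B" G h
    by (intro group_homI hG is_group group_free_Abelian_group)
  let ?b = "\<lambda>u. h (frag_of u)"
  obtain m where m: "torsion_free_rank G = enat m"
    using qd unfolding quotient_divisible_def by auto
  have "finite B"
  proof (rule ccontr)
    assume "infinite B"
    then obtain U where U: "finite U" "card U = Suc m" "U \<subseteq> B" using infinite_arbitrarily_large by blast
    have "enat (card (?b ` U)) \<le> torsion_free_rank G"
      unfolding torsion_free_rank_def
      using inj_hom_free_Abelian_group_independent(1)[OF hG inj U(1,3)] by (intro SUP_upper) simp
    then show False
      using inj_hom_free_Abelian_group_independent(2)[OF hG inj U(1,3)] U m by simp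
  qed
  define S where "S = ?b ` B"
  have SG: "S \<subseteq> carrier G" unfolding S_def by (auto intro!: h.hom_closed)
  have gen: "subgroup (generate G S) G" using SG by (rule generate_is_subgroup)
  have FS: "F \<subseteq> generate G S"
  proof
    fix x assume "x \<in> F"
    then obtain y where y: "Poly_Mapping.keys y \<subseteq> B" "x = h y" using hF by auto
    have "h y \<in> generate G S"
    proof (rule free_Abelian_group_induct[OF y(1)])
      show "h 0 \<in> generate G S" using h.hom_one generate.one[of G S] by simp
    next
      fix x y assume xy: "Poly_Mapping.keys x \<subseteq> B" "Poly_Mapping.keys y \<subseteq> B"
        "h x \<in> generate G S" "h y \<in> generate G S"
      then have "h (x - y) = h x \<otimes> inv (h y)"
        using h.hom_mult[of x "- y"] h.hom_inv[of y] by simp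
      then show "h (x - y) \<in> generate G S"
        using xy subgroup.m_closed[OF gen] subgroup.m_inv_closed[OF gen] by simp
    next
      fix a assume "a \<in> B"
      then show "h (frag_of a) \<in> generate G S" unfolding S_def by (intro generate.incl) blast
    qed
    then show "x \<in> generate G S" using y by simp
  qed
  have cos: "\<exists>f \<in> F. x = f \<otimes> y" if "F #> x = F #> y" "x \<in> carrier G" "y \<in> carrier G" for x y
  proof -
    have "x \<in> F #> y" using rcos_self[OF that(2) F(1)] that(1) by simp
    then show ?thesis unfolding r_coset_def by blast
  qed
  have "reduced_qd_group G S"
  proof
    show "finite S" using \<open>finite B\<close> by (simp add: S_def)
    show "S \<subseteq> carrier G" "reduced_group G" by fact+
  next
    fix x assume x: "x \<in> carrier G"
    then have "F #> x \<in> torsion_part (G Mod F)"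
      using F(3) unfolding torsion_group_def by (auto simp: carrier_FactGroup)
    then obtain n :: nat where "n > 0" "F #> (x [^] n) = F"
      using rcos_nat_pow[OF F(1) x] by (auto simp: torsion_part_def)
    then have "x [^] n \<in> F" using rcos_self[OF _ F(1), of "x [^] n"] x by simp
    then show "\<exists>m::nat. m > 0 \<and> x [^] m \<in> generate G S" using \<open>n > 0\<close> FS by blast
  next
    fix x and n :: nat assume x: "x \<in> carrier G" and n: "n > 0"
    have "F #> x \<in> carrier (G Mod F)" using x by (auto simp: carrier_FactGroup)
    then obtain Y where Y: "Y \<in> carrier (G Mod F)" "Y [^]\<^bsub>G Mod F\<^esub> n = F #> x"
      using F(4) n unfolding divisible_group_def by blast
    then obtain y where y: "y \<in> carrier G" "Y = F #> y" by (auto simp: carrier_FactGroup)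
    then have "F #> x = F #> (y [^] n)" using Y rcos_nat_pow[OF F(1)] by simp
    then obtain f where "f \<in> F" "x = f \<otimes> y [^] n" using cos x y by blast
    then show "\<exists>f \<in> generate G S. \<exists>y \<in> carrier G. x = f \<otimes> y [^] n" using FS y by blast
  qed
  then show ?thesis by blast
qed

text \<open>The image of a nonzero \<open>f\<close> is generated by its least positive value
  \<open>d\<close>. An element \<open>g\<close> with value \<open>d\<close> generates an infinite
  cyclic group that is complementary to the kernel of \<open>f\<close>. The absence of free summands
  enters the development only through this lemma.\<close>

lemma additive_int_trivial:
  fixes f :: "'a \<Rightarrow> int"
  assumes nf: "no_nonzero_free_summand G"
    and add: "\<And>x y. x \<in> carrier G \<Longrightarrow> y \<in> carrier G \<Longrightarrow> f (x \<otimes> y) = f x + f y"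
    and x: "x \<in> carrier G"
  shows "f x = 0"
proof (rule ccontr)
  assume "f x \<noteq> 0"
  interpret f: group_hom G integer_group f
    by (intro group_hom.intro group_hom_axioms.intro) (auto simp: is_group hom_def add)
  have finv: "f (inv y) = - f y" if "y \<in> carrier G" for y using f.hom_inv[OF that] by simp
  have fpow: "f (y [^] (k::int)) = k * f y" if "y \<in> carrier G" for y k
    using f.hom_int_pow[OF that, of k] by simp
  let ?P = "\<lambda>n. \<exists>y \<in> carrier G. f y = int n \<and> n > 0"
  have "?P (nat \<bar>f x\<bar>)"
    using x \<open>f x \<noteq> 0\<close> finv[OF x] by (cases "f x > 0") (auto intro: bexI[of _ x] bexI[of _ "inv x"])
  define d where "d = (LEAST n. ?P n)"
  have "?P d" unfolding d_def using \<open>?P (nat \<bar>f x\<bar>)\<close> by (rule LeastI)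
  then obtain g where g: "g \<in> carrier G" "f g = int d" "d > 0" by blast
  have dvd: "int d dvd f y" if y: "y \<in> carrier G" for y
  proof (rule ccontr)
    assume "\<not> int d dvd f y"
    then have "f y mod int d \<noteq> 0" by (simp add: dvd_eq_mod_eq_0)
    moreover have "f y mod int d \<ge> 0" using g by simp
    ultimately have pos: "f y mod int d > 0" by linarith
    define z where "z = y \<otimes> g [^] (- (f y div int d))"
    have "z \<in> carrier G" using y g by (simp add: z_def)
    moreover have "f z = f y mod int d"
      using y g by (simp add: z_def add fpow minus_div_mult_eq_mod)
    ultimately have "?P (nat (f y mod int d))" using pos by auto
    then have "d \<le> nat (f y mod int d)" unfolding d_def by (rule Least_le)
    moreover have "f y mod int d < int d" using g by simp
    ultimately show False using pos by linarith
  qed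
  let ?A = "generate G {g}" and ?K = "{y \<in> carrier G. f y = 0}"
  have A_eq: "?A = {g [^] (k::int) | k. k \<in> UNIV}" using generate_pow[OF g(1)] .
  have A: "subgroup ?A G" using g by (intro generate_is_subgroup) auto
  have K: "subgroup ?K G"
    by (rule subgroupI) (auto simp: add finv intro!: exI[of _ \<one>] f.hom_one[simplified])
  have "internal_direct_sum G ?A ?K"
  proof (rule internal_direct_sumI[OF A K])
    fix a assume "a \<in> ?A" "a \<in> ?K"
    then obtain k :: int where "a = g [^] k" "f a = 0" unfolding A_eq by blast
    then show "a = \<one>" using fpow[OF g(1), of k] g by simp
  next
    fix y assume y: "y \<in> carrier G"
    obtain k where k: "f y = int d * k" using dvd[OF y] by blast
    have "y = g [^] k \<otimes> (inv (g [^] k) \<otimes> y)" using y g by (simp flip: m_assoc)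
    moreover have "inv (g [^] k) \<otimes> y \<in> ?K" using y g k by (simp add: add finv fpow)
    moreover have "g [^] k \<in> ?A" unfolding A_eq by blast
    ultimately show "\<exists>a \<in> ?A. \<exists>b \<in> ?K. y = a \<otimes> b" by blast
  qed
  moreover have "free_abelian (G\<lparr>carrier := ?A\<rparr>)"
  proof -
    define e where "e = (\<lambda>k::int. g [^] k)"
    have e_range: "range e = ?A" unfolding e_def A_eq by blast
    have "e \<in> iso integer_group (G\<lparr>carrier := ?A\<rparr>)"
    proof (rule isoI)
      show "e \<in> hom integer_group (G\<lparr>carrier := ?A\<rparr>)"
        using e_range g by (auto simp: hom_def e_def int_pow_mult)
      have "inj e"
      proof (rule injI)
        fix k l assume "e k = e l"
        then have "f (e k) = f (e l)" by simp
        then show "k = l" using fpow[OF g(1)] g by (simp add: e_def)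
      qed
      then show "bij_betw e (carrier integer_group) (carrier (G\<lparr>carrier := ?A\<rparr>))"
        using e_range by (simp add: bij_betw_def)
    qed
    then have "integer_group \<cong> G\<lparr>carrier := ?A\<rparr>" unfolding is_iso_def by blast
    then have "G\<lparr>carrier := ?A\<rparr> \<cong> integer_group" by (simp add: group.iso_sym)
    then have "G\<lparr>carrier := ?A\<rparr> \<cong> free_Abelian_group {g}"
      using isomorphic_group_integer_free_Abelian_group_singleton[of g] iso_trans
      by metis
    then show ?thesis using A subgroup_comm_group unfolding free_abelian_def by blast
  qed
  ultimately have "?A = {\<one>}" using nf unfolding no_nonzero_free_summand_def by blast
  then have "g = \<one>" using generate.incl[of g "{g}" G] by simp
  then show False using g f.hom_one by simp
qed

end

section \<open>Groups of homomorphisms and self-smallness\<close>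

lemma hom_group_simps [simp]:
  "carrier (hom_group G H) = hom G H \<inter> extensional (carrier G)"
  "f \<otimes>\<^bsub>hom_group G H\<^esub> g = (\<lambda>x \<in> carrier G. f x \<otimes>\<^bsub>H\<^esub> g x)"
  "\<one>\<^bsub>hom_group G H\<^esub> = (\<lambda>x \<in> carrier G. \<one>\<^bsub>H\<^esub>)"
  by (auto simp: hom_group_def)

lemma comm_group_hom_group:
  assumes "group G" "comm_group H"
  shows "comm_group (hom_group G H)"
proof -
  interpret G: group G by fact
  interpret H: comm_group H by fact
  show ?thesis
  proof (rule comm_groupI)
    fix f g assume fg: "f \<in> carrier (hom_group G H)" "g \<in> carrier (hom_group G H)"
    then show "f \<otimes>\<^bsub>hom_group G H\<^esub> g \<in> carrier (hom_group G H)"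
      by (auto simp: hom_def Pi_iff H.m_ac)
    show "f \<otimes>\<^bsub>hom_group G H\<^esub> g = g \<otimes>\<^bsub>hom_group G H\<^esub> f"
      using fg by (auto simp: hom_def Pi_iff H.m_comm intro!: restrict_ext)
    fix h assume "h \<in> carrier (hom_group G H)"
    then show "f \<otimes>\<^bsub>hom_group G H\<^esub> g \<otimes>\<^bsub>hom_group G H\<^esub> h = f \<otimes>\<^bsub>hom_group G H\<^esub> (g \<otimes>\<^bsub>hom_group G H\<^esub> h)"
      using fg by (auto simp: hom_def Pi_iff H.m_assoc intro!: restrict_ext)
  next
    show "\<one>\<^bsub>hom_group G H\<^esub> \<in> carrier (hom_group G H)"
      by (auto simp: hom_def)
  next
    fix f assume f: "f \<in> carrier (hom_group G H)"
    then show "\<one>\<^bsub>hom_group G H\<^esub> \<otimes>\<^bsub>hom_group G H\<^esub> f = f"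
      by (auto simp: hom_def Pi_iff extensional_def restrict_def intro!: ext)
    have "(\<lambda>x\<in>carrier G. inv\<^bsub>H\<^esub> f x) \<in> carrier (hom_group G H)"
      using f by (auto simp: hom_def Pi_iff H.inv_mult)
    moreover have "(\<lambda>x\<in>carrier G. inv\<^bsub>H\<^esub> f x) \<otimes>\<^bsub>hom_group G H\<^esub> f = \<one>\<^bsub>hom_group G H\<^esub>"
      using f by (auto simp: hom_def Pi_iff intro!: restrict_ext)
    ultimately show "\<exists>g \<in> carrier (hom_group G H). g \<otimes>\<^bsub>hom_group G H\<^esub> f = \<one>\<^bsub>hom_group G H\<^esub>"
      by blast
  qed
qed

lemma hom_group_nat_pow:
  assumes "x \<in> carrier G"
  shows "(f [^]\<^bsub>hom_group G H\<^esub> (n::nat)) x = f x [^]\<^bsub>H\<^esub> n"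
  using assms by (induction n) auto

context reduced_qd_group
begin

text \<open>Modulo the subgroup generated by \<open>S\<close> every element is a p-th power, so the
  image of a homomorphism that kills \<open>S\<close> is divisible, and hence trivial in a reduced
  group.\<close>

lemma hom_eq_one_of_generators:
  assumes h: "h \<in> hom G G" and S: "\<And>s. s \<in> S \<Longrightarrow> h s = \<one>" and x: "x \<in> carrier G"
  shows "h x = \<one>"
proof -
  interpret h: group_hom G G h
    by (intro group_homI h is_group)
  have gen: "h y = \<one>" if "y \<in> generate G S" for y
    using that
  proof (induction rule: generate.induct)
    case (inv h)
    then show ?case using S S_carrier by auto
  next
    case (eng a b)
    then show ?case using generate_S_carrier by simp
  qed (use S in auto)
  have "h ` carrier G = {\<one>}"
  proof (rule reduced_subgroup_trivial[OF reduced h.img_is_subgroup])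
    fix p d assume p: "Factorial_Ring.prime (p::nat)" and "d \<in> h ` carrier G"
    then obtain y where y: "y \<in> carrier G" "d = h y" by blast
    obtain f z where "f \<in> generate G S" "z \<in> carrier G" "y = f \<otimes> z [^] p"
      using divisible_mod[OF y(1) prime_gt_0_nat[OF p]] by blast
    then have "h z [^] p = d"
      using y gen generate_S_carrier by (simp add: h.hom_nat_pow)
    then show "\<exists>e \<in> h ` carrier G. e [^] p = d" using \<open>z \<in> carrier G\<close> by blast
  qed
  then show ?thesis using x by blast
qed

lemma self_small: "self_small TYPE('i) G"
proof -
  have "(\<lambda>f. \<lambda>x \<in> carrier G. \<lambda>i \<in> I. f i x)
          \<in> iso (sum_group I (\<lambda>i. hom_group G G)) (hom_group G (sum_group I (\<lambda>i. G)))"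
    (is "?\<Phi> \<in> iso ?A ?B") for I :: "'i set"
  proof (rule isoI)
    have grp: "group (hom_group G G)"
      using comm_group_hom_group[OF is_group comm_group_axioms] by (rule comm_group.axioms)
    have A: "f \<in> carrier ?A \<longleftrightarrow> f \<in> (\<Pi>\<^sub>E i\<in>I. carrier (hom_group G G)) \<and>
        finite {i \<in> I. f i \<noteq> (\<lambda>x \<in> carrier G. \<one>)}" for f
      by (simp add: carrier_sum_group grp)
    have s: "y \<in> carrier (sum_group I (\<lambda>i. G)) \<longleftrightarrow> y \<in> (\<Pi>\<^sub>E i\<in>I. carrier G) \<and> finite {i \<in> I. y i \<noteq> \<one>}" for y
      by (simp add: carrier_sum_group is_group)
    show "?\<Phi> \<in> hom ?A ?B"
    proof (rule homI)
      fix f assume f: "f \<in> carrier ?A"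
      then have fi: "f i \<in> hom G G" if "i \<in> I" for i using that A by auto
      have "(\<lambda>i \<in> I. f i x) \<in> carrier (sum_group I (\<lambda>i. G))" if x: "x \<in> carrier G" for x
      proof -
        have "{i \<in> I. f i x \<noteq> \<one>} \<subseteq> {i \<in> I. f i \<noteq> (\<lambda>x \<in> carrier G. \<one>)}" using x by auto
        then have "finite {i \<in> I. f i x \<noteq> \<one>}" using f A finite_subset by blast
        then show ?thesis using hom_in_carrier[OF fi x] unfolding s by (auto cong: conj_cong)
      qed
      then show "?\<Phi> f \<in> carrier ?B"
        using fi by (auto simp: hom_def[of G "sum_group I (\<lambda>i. G)"] hom_mult intro!: restrict_ext)
    next
      fix f g assume "f \<in> carrier ?A" "g \<in> carrier ?A"
      show "?\<Phi> (f \<otimes>\<^bsub>?A\<^esub> g) = ?\<Phi> f \<otimes>\<^bsub>?B\<^esub> ?\<Phi> g"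
        by (auto intro!: restrict_ext)
    qed
    have inj: "inj_on ?\<Phi> (carrier ?A)"
    proof (rule inj_onI)
      fix f g assume f: "f \<in> carrier ?A" and g: "g \<in> carrier ?A" and eq: "?\<Phi> f = ?\<Phi> g"
      have "f i x = g i x" if "i \<in> I" "x \<in> carrier G" for i x
        using fun_cong[OF fun_cong[OF eq, of x], of i] that by simp
      then have "f i = g i" if "i \<in> I" for i
        using f g that unfolding A by (intro extensionalityI[of _ "carrier G"]) auto
      moreover have "f \<in> extensional I" "g \<in> extensional I" using f g unfolding A by (auto simp: PiE_def)
      ultimately show "f = g" by (auto intro: extensionalityI[of f I g])
    qed
    have surj: "k \<in> ?\<Phi> ` carrier ?A" if k: "k \<in> carrier ?B" for k
    proof -
      have kx: "k x \<in> (\<Pi>\<^sub>E i\<in>I. carrier G)" "finite {i \<in> I. k x i \<noteq> \<one>}" if "x \<in> carrier G" for x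
        using k that s[of "k x"] by (auto simp: hom_in_carrier)
      define f where "f = (\<lambda>i \<in> I. \<lambda>x \<in> carrier G. k x i)"
      have fh: "f i \<in> hom G G" if "i \<in> I" for i
        using that kx(1) k by (auto simp: f_def hom_def[of G G] hom_mult PiE_iff)
      \<comment> \<open>A component of \<open>k\<close> that is trivial on \<open>S\<close> is
        trivial. So the nontrivial components are among those seen by the finitely many generators,
        each of which has finite support.\<close>
      let ?J = "\<Union>s\<in>S. {i \<in> I. k s i \<noteq> \<one>}"
      have "finite ?J" using finite_S S_carrier kx(2) by auto
      moreover have "{i \<in> I. f i \<noteq> (\<lambda>x \<in> carrier G. \<one>)} \<subseteq> ?J"
      proof (rule subsetI, rule ccontr)
        fix i assume i: "i \<in> {i \<in> I. f i \<noteq> (\<lambda>x \<in> carrier G. \<one>)}" and "i \<notin> ?J"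
        then have "f i s = \<one>" if "s \<in> S" for s using that S_carrier by (auto simp: f_def)
        then have "f i x = \<one>" if "x \<in> carrier G" for x
          using hom_eq_one_of_generators[OF fh] i that by blast
        then have "f i = (\<lambda>x \<in> carrier G. \<one>)" using i by (auto simp: f_def intro!: restrict_ext)
        then show False using i by blast
      qed
      ultimately have "finite {i \<in> I. f i \<noteq> (\<lambda>x \<in> carrier G. \<one>)}" by (rule rev_finite_subset)
      moreover have "f \<in> (\<Pi>\<^sub>E i\<in>I. carrier (hom_group G G))"
        using fh by (auto simp: f_def)
      ultimately have "f \<in> carrier ?A" unfolding A by blast
      moreover have "?\<Phi> f = k"
      proof (rule extensionalityI[of _ "carrier G"])
        fix x assume x: "x \<in> carrier G"
        then have "(\<lambda>i \<in> I. f i x) = k x"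
          using kx(1)[OF x] by (intro extensionalityI[of _ I]) (auto simp: f_def PiE_def)
        then show "?\<Phi> f x = k x" using x by simp
      qed (use k in auto)
      ultimately show ?thesis by blast
    qed
    have "?\<Phi> ` carrier ?A \<subseteq> carrier ?B"
      using \<open>?\<Phi> \<in> hom ?A ?B\<close> by (rule hom_carrier)
    then show "bij_betw ?\<Phi> (carrier ?A) (carrier ?B)"
      using inj surj unfolding bij_betw_def by blast
  qed
  then show ?thesis unfolding self_small_def using comm_group_axioms by blast
qed

section \<open>Countability of the data that the generic sequence has to deal with\<close>

lemma countable_generate_S: "countable (generate G S)"
proof -
  let ?g = "\<lambda>c :: 'a \<Rightarrow> int. \<Otimes>s\<in>S. s [^] c s"
  have "generate G S \<subseteq> ?g ` (S \<rightarrow>\<^sub>E UNIV)"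
  proof
    fix f assume "f \<in> generate G S"
    then obtain c :: "'a \<Rightarrow> int" where c: "f = ?g c"
      using generate_finite_expand[OF finite_S S_carrier] by blast
    have "?g c = ?g (restrict c S)"
      using S_carrier by (intro finprod_cong') auto
    then show "f \<in> ?g ` (S \<rightarrow>\<^sub>E UNIV)" using c by (intro image_eqI[of _ _ "restrict c S"]) auto
  qed
  moreover have "countable (S \<rightarrow>\<^sub>E (UNIV :: int set))"
    using finite_S by (intro countable_PiE) auto
  ultimately show ?thesis by (blast intro: countable_subset)
qed

text \<open>Each element has a positive power in the countable group generated by \<open>S\<close>,
  and an m-th root is unique up to the finite m-part.\<close>

lemma countable_carrier: "countable (carrier G)"
proof -
  have fin: "finite {x \<in> carrier G. x [^] m = f}" if "m > 0" for m :: nat and f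
  proof (cases "\<exists>y \<in> carrier G. y [^] m = f")
    case True
    then obtain y where y: "y \<in> carrier G" "y [^] m = f" by blast
    have "{x \<in> carrier G. x [^] m = f} \<subseteq> (\<lambda>t. t \<otimes> y) ` n_part G m"
    proof
      fix x assume x: "x \<in> {x \<in> carrier G. x [^] m = f}"
      then have "(x \<otimes> inv y) [^] (m ^ 1) = \<one>"
        using pow_inv_eq_one[of x y m] y by simp
      then have "x \<otimes> inv y \<in> n_part G m"
        using x y unfolding n_part_iff[OF that] by blast
      moreover have "x = (x \<otimes> inv y) \<otimes> y" using x y by (simp add: m_assoc)
      ultimately show "x \<in> (\<lambda>t. t \<otimes> y) ` n_part G m" by blast
    qed
    then show ?thesis using finite_n_part[OF that] finite_subset by blast
  next
    case False
    then have "{x \<in> carrier G. x [^] m = f} = {}" by blast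
    then show ?thesis by (metis finite.emptyI)
  qed
  have "carrier G \<subseteq> (\<Union>m\<in>{0<..}. \<Union>f\<in>generate G S. {x \<in> carrier G. x [^] (m::nat) = f})"
  proof
    fix x assume x: "x \<in> carrier G"
    then obtain m :: nat where "m > 0" "x [^] m \<in> generate G S" using torsion_mod by blast
    then show "x \<in> (\<Union>m\<in>{0<..}. \<Union>f\<in>generate G S. {x \<in> carrier G. x [^] (m::nat) = f})"
      using x by (intro UN_I[of m] UN_I[of "x [^] m"]) auto
  qed
  moreover have "countable (\<Union>m\<in>{0<..}. \<Union>f\<in>generate G S. {x \<in> carrier G. x [^] (m::nat) = f})"
    using countable_generate_S fin by (intro countable_UN) (auto intro: countable_finite)
  ultimately show ?thesis by (rule countable_subset)
qed

text \<open>Rational values on \<open>S\<close> determine the map, because every element has a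
  positive power in the group generated by \<open>S\<close>. Extensionality prevents arbitrary
  values off the carrier from spoiling the count.\<close>

lemma countable_additive_rat:
  "countable {f :: 'a \<Rightarrow> rat. f \<in> extensional (carrier G) \<and>
     (\<forall>x \<in> carrier G. \<forall>y \<in> carrier G. f (x \<otimes> y) = f x + f y)}" (is "countable ?A")
proof -
  have pow: "f (x [^] m) = of_nat m * f x" if "f \<in> ?A" "x \<in> carrier G" for f x and m :: nat
  proof (induction m)
    case 0
    have "f (\<one> \<otimes> \<one>) = f \<one> + f \<one>" using that by blast
    then show ?case by simp
  next
    case (Suc m)
    then show ?case using that by (simp add: algebra_simps)
  qed
  have "inj_on (\<lambda>f. restrict f S) ?A"
  proof (rule inj_onI)
    fix f g assume f: "f \<in> ?A" and g: "g \<in> ?A" and eq: "restrict f S = restrict g S"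
    have fg0: "f \<one> = 0" "g \<one> = 0" using pow[OF f, of \<one> 0] pow[OF g, of \<one> 0] by auto
    have gen: "f y = g y" if "y \<in> generate G S" for y
      using that
    proof (induction rule: generate.induct)
      case one
      then show ?case using fg0 by simp
    next
      case (incl h)
      then show ?case using fun_cong[OF eq, of h] by simp
    next
      case (inv h)
      then have h: "h \<in> carrier G" "f h = g h" using fun_cong[OF eq, of h] S_carrier by auto
      have "f (inv h \<otimes> h) = f (inv h) + f h" "g (inv h \<otimes> h) = g (inv h) + g h"
        using f g h by blast+
      then show ?case using h fg0 by simp
    next
      case (eng a b)
      then show ?case using f g generate_S_carrier by simp
    qed
    show "f = g"
    proof (rule extensionalityI[of _ "carrier G"])
      fix x assume x: "x \<in> carrier G"
      obtain m :: nat where m: "m > 0" "x [^] m \<in> generate G S" using torsion_mod[OF x] by blast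
      then have "of_nat m * f x = of_nat m * g x"
        using gen pow[OF f x, of m] pow[OF g x, of m] by simp
      then show "f x = g x" using m by simp
    qed (use f g in auto)
  qed
  moreover have "countable ((\<lambda>f. restrict f S) ` ?A)"
  proof (rule countable_subset)
    show "(\<lambda>f. restrict f S) ` ?A \<subseteq> (S \<rightarrow>\<^sub>E UNIV)" by auto
    show "countable (S \<rightarrow>\<^sub>E (UNIV :: rat set))" using finite_S by (intro countable_PiE) auto
  qed
  ultimately show ?thesis by (simp add: countable_image_inj_eq)
qed

text \<open>The projection onto \<open>C\<close> carries representatives of \<open>G\<close> modulo
  n-th powers to representatives of \<open>C\<close> modulo its own n-th powers.\<close>

lemma finite_complement_mod_multiples:
  assumes C: "internal_direct_sum G A C" and n: "n > 0"
  shows "finite (carrier ((G\<lparr>carrier := C\<rparr>) Mod multiples (G\<lparr>carrier := C\<rparr>) n))"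
proof -
  let ?C = "G\<lparr>carrier := C\<rparr>"
  let ?M = "multiples ?C n"
  have sC: "subgroup C G" by (rule internal_direct_sumD(2)[OF C])
  then interpret C: comm_group ?C by (rule subgroup_comm_group)
  obtain \<pi> where \<pi>: "\<pi> \<in> hom G G" "\<And>x. x \<in> carrier G \<Longrightarrow> \<pi> x \<in> C"
    "\<And>x. x \<in> carrier G \<Longrightarrow> \<exists>a \<in> A. x = a \<otimes> \<pi> x" "\<And>x. x \<in> A \<Longrightarrow> \<pi> x = \<one>"
    "\<And>x. x \<in> C \<Longrightarrow> \<pi> x = x"
    using direct_sum_projection[OF C] by blast
  obtain B where B: "finite B" "B \<subseteq> carrier G"
    "\<And>x. x \<in> carrier G \<Longrightarrow> \<exists>c \<in> B. \<exists>y \<in> carrier G. x = c \<otimes> y [^] n"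
    using finite_mod_multiples[OF n] by blast
  have "carrier (?C Mod ?M) \<subseteq> (\<lambda>b. ?M #>\<^bsub>?C\<^esub> \<pi> b) ` B"
  proof
    fix k assume "k \<in> carrier (?C Mod ?M)"
    then obtain x where x: "x \<in> C" "k = ?M #>\<^bsub>?C\<^esub> x" by (auto simp: carrier_FactGroup)
    obtain b y where b: "b \<in> B" "y \<in> carrier G" "x = b \<otimes> y [^] n"
      using B(3)[OF subgroup.mem_carrier[OF sC x(1)]] by blast
    have bc: "b \<in> carrier G" using b B(2) by blast
    have "\<pi> x = \<pi> b \<otimes> \<pi> y [^] n"
      unfolding b(3) using hom_mult[OF \<pi>(1) bc nat_pow_closed[OF b(2)]]
        hom_nat_pow[OF \<pi>(1) b(2) is_group is_group] by simp
    then have "x = \<pi> y [^] n \<otimes> \<pi> b"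
      using \<pi>(5)[OF x(1)] hom_in_carrier[OF \<pi>(1)] bc b(2) by (simp add: m_comm)
    moreover have "\<pi> y [^] n \<in> ?M"
      using \<pi>(2)[OF b(2)] by (auto simp: multiples_def simp flip: nat_pow_consistent)
    ultimately have "x \<in> ?M #>\<^bsub>?C\<^esub> \<pi> b" by (auto simp: r_coset_def)
    then have "k = ?M #>\<^bsub>?C\<^esub> \<pi> b"
      using C.repr_independence[OF _ _ C.subgroup_multiples] \<pi>(2)[OF bc] x(2) by simp
    then show "k \<in> (\<lambda>b. ?M #>\<^bsub>?C\<^esub> \<pi> b) ` B" using b(1) by blast
  qed
  then show ?thesis using B(1) finite_surj by blast
qed

end

section \<open>Generic adic sequences\<close>

text \<open>A pair \<open>(a, N)\<close> stands for the set of all tuples of profinite integers congruent to \<open>a\<close>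
  modulo \<open>N\<close>. A predicate on pairs is dense if every such set contains a smaller one that
  satisfies it; countably many dense predicates are met by one sequence of shrinking sets, as in
  the Baire category theorem.\<close>

definition dense_pred :: "(('i \<Rightarrow> int) \<Rightarrow> nat \<Rightarrow> bool) \<Rightarrow> bool" where
  "dense_pred P \<longleftrightarrow> (\<forall>a N. N > 0 \<longrightarrow>
     (\<exists>a' N'. N' > 0 \<and> N dvd N' \<and> (\<forall>i. int N dvd a' i - a i) \<and> P a' N'))"

lemma generic_sequence:
  assumes "countable Q" and dense: "\<And>P. P \<in> Q \<Longrightarrow> dense_pred P"
  shows "\<exists>(a :: nat \<Rightarrow> 'i \<Rightarrow> int) N. (\<forall>k. N k > 0 \<and> N k dvd N (Suc k) \<and> Suc k dvd N (Suc k) \<and>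
    (\<forall>i. int (N k) dvd a (Suc k) i - a k i)) \<and> (\<forall>P\<in>Q. \<exists>k. P (a k) (N k))"
proof -
  \<comment> \<open>The k-th step meets the k-th predicate of an enumeration of \<open>Q\<close>;
    the guard is there because \<open>from_nat_into\<close> enumerates nothing if \<open>Q\<close>
    is empty.\<close>
  define R where "R k x y \<longleftrightarrow> snd x dvd snd y \<and> Suc k dvd snd y \<and>
     (\<forall>i. int (snd x) dvd fst y i - fst x i) \<and>
     (Q \<noteq> {} \<longrightarrow> (from_nat_into Q k) (fst y) (snd y))" for k and x y :: "('i \<Rightarrow> int) \<times> nat"
  have "\<exists>s. \<forall>k. snd (s k) > 0 \<and> R k (s k) (s (Suc k))"
  proof (rule dependent_nat_choice)
    show "\<exists>x :: ('i \<Rightarrow> int) \<times> nat. snd x > 0" by (intro exI[of _ "(\<lambda>_. 0, 1)"]) simp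
  next
    fix x :: "('i \<Rightarrow> int) \<times> nat" and k assume x: "snd x > 0"
    \<comment> \<open>The factor \<open>Suc k\<close> makes every positive integer divide all late
      moduli, so that in the limit residues modulo all integers are determined.\<close>
    let ?N = "snd x * Suc k"
    have "\<exists>a' N'. N' > 0 \<and> ?N dvd N' \<and> (\<forall>i. int ?N dvd a' i - fst x i) \<and>
      (Q \<noteq> {} \<longrightarrow> (from_nat_into Q k) a' N')"
    proof (cases "Q = {}")
      case True
      then show ?thesis using x by (intro exI[of _ "fst x"] exI[of _ ?N]) simp
    next
      case False
      then have "from_nat_into Q k \<in> Q" by (rule from_nat_into)
      then have "dense_pred (from_nat_into Q k)" by (rule dense)
      moreover have "?N > 0" using x by simp
      ultimately show ?thesis unfolding dense_pred_def by blast
    qed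
    then obtain a' N' where a': "N' > 0" "?N dvd N'" "\<And>i. int ?N dvd a' i - fst x i"
      "Q \<noteq> {} \<longrightarrow> (from_nat_into Q k) a' N'" by blast
    have "R k x (a', N')"
      unfolding R_def using a'(4) dvd_mult_left[OF a'(2)] dvd_mult_right[OF a'(2)]
        dvd_mult_left[OF a'(3)[unfolded of_nat_mult]] by simp
    then show "\<exists>y. snd y > 0 \<and> R k x y" using a'(1) by (intro exI[of _ "(a', N')"]) simp
  qed
  then obtain s where s: "\<And>k. snd (s k) > 0" "\<And>k. R k (s k) (s (Suc k))" by blast
  have "\<exists>k. P (fst (s k)) (snd (s k))" if P: "P \<in> Q" for P
  proof -
    obtain k where "from_nat_into Q k = P"
      using from_nat_into_surj[OF assms(1) P] by blast
    then show ?thesis using s(2)[of k] P unfolding R_def by blast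
  qed
  then show ?thesis
    using s by (intro exI[of _ "\<lambda>k. fst (s k)"] exI[of _ "\<lambda>k. snd (s k)"]) (auto simp: R_def)
qed

lemma rat_multiple_Ints: "\<exists>m::nat. m > 0 \<and> of_nat m * (r::rat) \<in> \<int>"
proof (cases r)
  case (Fract p q)
  then have "of_nat (nat q) * r = of_int p"
    by (simp add: Fract_of_int_quotient)
  then show ?thesis using Fract by (intro exI[of _ "nat q"]) auto
qed

section \<open>Density of the conditions on homomorphisms from \<open>G\<close>, into
  \<open>G\<close>, and on endomorphisms\<close>

context comm_group
begin

text \<open>\<open>f\<close> and \<open>\<phi>\<close> stand for the first and the i-th coordinate
  of a homomorphism to the group \<open>H\<close>; the predicate says that some value violates the
  integrality condition at \<open>i\<close>. If it held throughout for both \<open>a i\<close> and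
  \<open>a i + N\<close>, then \<open>N f\<close> and \<open>N \<phi>\<close> would be
  integer-valued, hence zero by \<open>additive_int_trivial\<close>.\<close>

lemma dense_hom_to:
  fixes f \<phi> :: "'a \<Rightarrow> rat" and i :: 'i
  assumes nf: "no_nonzero_free_summand G"
    and f: "\<And>x y. x \<in> carrier G \<Longrightarrow> y \<in> carrier G \<Longrightarrow> f (x \<otimes> y) = f x + f y"
    and \<phi>: "\<And>x y. x \<in> carrier G \<Longrightarrow> y \<in> carrier G \<Longrightarrow> \<phi> (x \<otimes> y) = \<phi> x + \<phi> y"
    and nz: "\<exists>x \<in> carrier G. f x \<noteq> 0 \<or> \<phi> x \<noteq> 0"
  shows "dense_pred (\<lambda>a N. \<exists>g \<in> carrier G. of_nat N * f g \<in> \<int> \<and> \<phi> g - f g * of_int (a i) \<notin> \<int>)"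
  unfolding dense_pred_def
proof (intro allI impI)
  fix a :: "'i \<Rightarrow> int" and N :: nat assume N: "N > 0"
  let ?b = "a(i := a i + int N)"
  have int0: "h x = 0" if add: "\<And>x y. x \<in> carrier G \<Longrightarrow> y \<in> carrier G \<Longrightarrow> h (x \<otimes> y) = h x + h y"
    and hN: "\<And>x. x \<in> carrier G \<Longrightarrow> of_nat N * h x \<in> \<int>" and x: "x \<in> carrier G" for h :: "'a \<Rightarrow> rat" and x
  proof -
    have eq: "of_int \<lfloor>of_nat N * h y\<rfloor> = of_nat N * h y" if "y \<in> carrier G" for y
      using hN[OF that] by (simp add: of_int_floor)
    have "\<lfloor>of_nat N * h (y \<otimes> z)\<rfloor> = \<lfloor>of_nat N * h y\<rfloor> + \<lfloor>of_nat N * h z\<rfloor>"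
      if "y \<in> carrier G" "z \<in> carrier G" for y z
    proof -
      have "of_nat N * h (y \<otimes> z) = of_int \<lfloor>of_nat N * h y\<rfloor> + of_int \<lfloor>of_nat N * h z\<rfloor>"
        by (simp only: add[OF that] distrib_left eq[OF that(1)] eq[OF that(2)])
      then show ?thesis by (metis floor_of_int of_int_add)
    qed
    from additive_int_trivial[OF nf this x] have "of_nat N * h x = 0" using eq[OF x] by simp
    then show ?thesis using N by simp
  qed
  have "\<exists>b \<in> {a, ?b}. \<exists>g \<in> carrier G. \<phi> g - f g * of_int (b i) \<notin> \<int>"
  proof (rule ccontr)
    assume "\<not> ?thesis"
    then have 1: "\<phi> g - f g * of_int (a i) \<in> \<int>" "\<phi> g - f g * of_int (a i + int N) \<in> \<int>"
      if "g \<in> carrier G" for g using that by auto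
    have fN: "of_nat N * f g \<in> \<int>" if "g \<in> carrier G" for g
      using Ints_diff[OF 1[OF that]] by (simp add: algebra_simps)
    have "of_nat N * \<phi> g \<in> \<int>" if "g \<in> carrier G" for g
    proof -
      have "of_nat N * \<phi> g = of_nat N * (\<phi> g - f g * of_int (a i)) + of_int (a i) * (of_nat N * f g)"
        by (simp add: algebra_simps)
      also have "\<dots> \<in> \<int>" by (rule Ints_add[OF Ints_mult[OF Ints_of_nat 1(1)[OF that]] Ints_mult[OF Ints_of_int fN[OF that]]])
      finally show ?thesis .
    qed
    then show False using int0[OF f fN] int0[OF \<phi>] nz by blast
  qed
  then obtain b g where b: "b \<in> {a, ?b}" "g \<in> carrier G" "\<phi> g - f g * of_int (b i) \<notin> \<int>" by blast
  \<comment> \<open>With \<open>N * m\<close> as the new modulus, \<open>f g * a i\<close> modulo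
    the integers is the same for all tuples congruent to \<open>b\<close>, so the violation persists
    in the limit.\<close>
  obtain m :: nat where m: "m > 0" "of_nat m * f g \<in> \<int>" using rat_multiple_Ints by blast
  have "of_nat (N * m) * f g \<in> \<int>" using Ints_mult[OF Ints_of_nat m(2), of N] by (simp add: mult.assoc)
  then show "\<exists>a' N'. N' > 0 \<and> N dvd N' \<and> (\<forall>i. int N dvd a' i - a i) \<and>
      (\<exists>g \<in> carrier G. of_nat N' * f g \<in> \<int> \<and> \<phi> g - f g * of_int (a' i) \<notin> \<int>)"
    using b m N by (intro exI[of _ b] exI[of _ "N * m"]) auto
qed

lemma finprod_int_pow_update:
  assumes I: "finite I" "j \<in> I" and g: "g \<in> I \<rightarrow> carrier G"
  shows "(\<Otimes>i\<in>I. g i [^] ((a(j := a j + c)) i :: int)) = (\<Otimes>i\<in>I. g i [^] a i) \<otimes> g j [^] c"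
proof -
  have gm: "g i \<in> carrier G" if "i \<in> I" for i using g that by auto
  have "(\<Otimes>i\<in>I. g i [^] ((a(j := a j + c)) i)) = (\<Otimes>i\<in>I. g i [^] a i \<otimes> (if j = i then g i [^] c else \<one>))"
    using gm by (intro finprod_cong') (auto simp: int_pow_mult)
  also have "\<dots> = (\<Otimes>i\<in>I. g i [^] a i) \<otimes> (\<Otimes>i\<in>I. if j = i then g i [^] c else \<one>)"
    using gm by (intro finprod_multf) auto
  also have "(\<Otimes>i\<in>I. if j = i then g i [^] c else \<one>) = g j [^] c"
    using finprod_singleton[OF I(2,1), of "\<lambda>i. g i [^] c"] gm by auto
  finally show ?thesis .
qed

lemma torsion_part_int_pow:
  assumes "x \<in> torsion_part G"
  shows "x [^] (k::int) \<in> torsion_part G"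
  using subgroup_int_pow_closed[OF subgroup_torsion_part assms] .

text \<open>\<open>g0\<close> and \<open>g i\<close> stand for the images of the unit vectors under
  a homomorphism to \<open>G\<close>; the product is the image of (1, a), which would have to lie in
  every \<open>multiples G N\<close>. If it were trivial on a whole residue class, changing one
  \<open>a j\<close> by \<open>N\<close> would show that \<open>g j\<close> has finite order, and
  then so has \<open>g0\<close>. Once it is nontrivial for some \<open>b\<close>, residual
  finiteness of \<open>G\<close> gives a modulus that detects this.\<close>

lemma dense_hom_from:
  assumes res: "\<And>x. (\<And>n::nat. n > 0 \<Longrightarrow> x \<in> multiples G n) \<Longrightarrow> x = \<one>"
    and I: "finite I" and g0: "g0 \<in> carrier G" and g: "g \<in> I \<rightarrow> carrier G"
    and nt: "g0 \<notin> torsion_part G \<or> (\<exists>i \<in> I. g i \<notin> torsion_part G)"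
  shows "dense_pred (\<lambda>a N. g0 \<otimes> (\<Otimes>i\<in>I. g i [^] (a i :: int)) \<notin> multiples G N)"
  unfolding dense_pred_def
proof (intro allI impI)
  fix a :: "'c \<Rightarrow> int" and N :: nat assume N: "N > 0"
  let ?u = "\<lambda>a. g0 \<otimes> (\<Otimes>i\<in>I. g i [^] (a i :: int))"
  have cl: "(\<Otimes>i\<in>I. g i [^] (b i :: int)) \<in> carrier G" for b using g by (intro finprod_closed) auto
  have ucl: "?u b \<in> carrier G" for b using g0 cl by simp
  have "\<exists>b. (\<forall>i. int N dvd b i - a i) \<and> ?u b \<noteq> \<one>"
  proof (rule ccontr)
    assume neg: "\<not> ?thesis"
    have tors: "g j \<in> torsion_part G" if j: "j \<in> I" for j
    proof -
      have gj: "g j \<in> carrier G" using g j by auto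
      have "?u (a(j := a j + int N)) = ?u a \<otimes> g j [^] int N"
        using finprod_int_pow_update[OF I j g] gj g0 cl by (simp add: m_assoc)
      moreover have "?u b = \<one>" if "\<forall>i. int N dvd b i - a i" for b using neg that by blast
      then have "?u a = \<one>" "?u (a(j := a j + int N)) = \<one>" by auto
      ultimately have "g j [^] N = \<one>" using gj by (simp add: int_pow_int)
      then show ?thesis using gj N by (auto simp: torsion_part_def)
    qed
    interpret T: subgroup "torsion_part G" G by (rule subgroup_torsion_part)
    have "(\<Otimes>i\<in>J. g i [^] a i) \<in> torsion_part G" if "finite J" "J \<subseteq> I" for J
      using that
    proof (induction J rule: finite_induct)
      case (insert j J)
      then have "(\<Otimes>i\<in>insert j J. g i [^] a i) = g j [^] a j \<otimes> (\<Otimes>i\<in>J. g i [^] a i)"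
        using g by (intro finprod_insert) auto
      then show ?case using insert tors torsion_part_int_pow by auto
    qed auto
    then have "(\<Otimes>i\<in>I. g i [^] a i) \<in> torsion_part G" using I by blast
    moreover have "?u a = \<one>" using neg by (metis diff_self dvd_0_right)
    then have "?u a \<in> torsion_part G" by simp
    ultimately have "g0 \<in> torsion_part G"
      using subgroup_mult_cancel_right[OF subgroup_torsion_part g0] by blast
    then show False using nt tors by blast
  qed
  then obtain b where b: "\<And>i. int N dvd b i - a i" "?u b \<noteq> \<one>" by blast
  then obtain m :: nat where m: "m > 0" "?u b \<notin> multiples G m" using res by blast
  have "multiples G (N * m) \<subseteq> multiples G m"
    by (auto simp: multiples_def simp flip: nat_pow_pow)
  then show "\<exists>a' N'. N' > 0 \<and> N dvd N' \<and> (\<forall>i. int N dvd a' i - a i) \<and> ?u a' \<notin> multiples G N'"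
    using b m N by (intro exI[of _ b] exI[of _ "N * m"]) auto
qed

end

text \<open>\<open>p0\<close>, \<open>p\<close> and \<open>q0\<close>, \<open>q\<close> stand for
  the first and the i-th coordinates of the images of the unit vectors under an endomorphism; the
  excluded case is multiplication by \<open>p0\<close>. The image of (1, a) divided by
  \<open>d\<close> violates integrality at \<open>i\<close> as soon as the quadratic expression in
  \<open>a\<close> behind it is nonzero and \<open>d\<close> is large. So it is enough that this
  expression does not vanish on a whole residue class.\<close>

lemma dense_endomorphism:
  fixes p q :: "'i \<Rightarrow> rat" and p0 q0 :: rat
  assumes I: "finite I" "i \<in> I"
    and ns: "\<not> ((\<forall>j\<in>I. p j = 0) \<and> (\<forall>j\<in>I - {i}. q j = 0) \<and> q i = p0 \<and> q0 = 0)"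
  shows "dense_pred (\<lambda>a N. \<exists>d>0. d dvd N \<and>
    of_nat N * ((p0 + (\<Sum>j\<in>I. of_int (a j) * p j)) / of_nat d) \<in> \<int> \<and>
    (q0 + (\<Sum>j\<in>I. of_int (a j) * q j)) / of_nat d
      - (p0 + (\<Sum>j\<in>I. of_int (a j) * p j)) / of_nat d * of_int (a i) \<notin> \<int>)"
  unfolding dense_pred_def
proof (intro allI impI)
  fix a :: "'i \<Rightarrow> int" and N :: nat assume N: "N > 0"
  let ?p = "\<lambda>a. p0 + (\<Sum>j\<in>I. of_int (a j :: int) * p j)"
  let ?q = "\<lambda>a. q0 + (\<Sum>j\<in>I. of_int (a j :: int) * q j)"
  let ?n = "of_nat N :: rat"
  have sum_upd: "(\<Sum>j\<in>I. of_int ((b(j0 := b j0 + c)) j) * r j)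
    = (\<Sum>j\<in>I. of_int (b j) * r j) + of_int c * r j0" if "j0 \<in> I" for b j0 c and r :: "'i \<Rightarrow> rat"
  proof -
    have "(\<Sum>j\<in>I. of_int ((b(j0 := b j0 + c)) j) * r j)
      = (\<Sum>j\<in>I. of_int (b j) * r j + (if j = j0 then of_int c * r j else 0))"
      by (intro sum.cong) (auto simp: algebra_simps)
    also have "\<dots> = (\<Sum>j\<in>I. of_int (b j) * r j) + of_int c * r j0"
      using I that by (simp add: sum.distrib)
    finally show ?thesis .
  qed
  have "\<exists>b. (\<forall>j. int N dvd b j - a j) \<and> ?q b - ?p b * of_int (b i) \<noteq> 0"
  proof (rule ccontr)
    assume "\<not> ?thesis"
    then have E: "?q b = ?p b * of_int (b i)" if "\<forall>j. int N dvd b j - a j" for b using that by auto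
    \<comment> \<open>First difference of \<open>E\<close> in a direction \<open>j0\<close> other
      than \<open>i\<close>, where the expression is affine.\<close>
    have Eupd: "r = s"
      if "\<forall>j. int N dvd b j - a j" "j0 \<in> I" "j0 \<noteq> i" "r = q j0" "s = p j0 * of_int (b i)" for b j0 r s
    proof -
      have "?q (b(j0 := b j0 + int N)) = ?p (b(j0 := b j0 + int N)) * of_int (b i)"
        using E[of "b(j0 := b j0 + int N)"] that(1,3)
        by (simp del: fun_upd_apply add: fun_upd_other) (metis (no_types, lifting) add_diff_eq
          diff_add_eq dvd_add dvd_refl fun_upd_other fun_upd_same)
      then have "?q b + ?n * q j0 = (?p b + ?n * p j0) * of_int (b i)"
        by (simp only: sum_upd[OF that(2)] add.assoc of_int_of_nat_eq)
      then have "?q b + ?n * q j0 = ?p b * of_int (b i) + ?n * (p j0 * of_int (b i))"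
        by (simp only: distrib_right mult.assoc)
      then have "?n * q j0 = ?n * (p j0 * of_int (b i))"
        using E[OF that(1)] by (metis add_left_cancel)
      then show ?thesis using N that by simp
    qed
    have a0: "\<forall>j. int N dvd a j - a j" by simp
    have ai: "\<forall>j. int N dvd (a(i := a i + int N)) j - a j" by simp
    \<comment> \<open>The relation from \<open>Eupd\<close> is compared at \<open>a i\<close> and at
      \<open>a i + N\<close>, which separates \<open>p j\<close> from \<open>q j\<close>.\<close>
    have off: "p j = 0 \<and> q j = 0" if j: "j \<in> I" "j \<noteq> i" for j
    proof -
      have "q j = p j * of_int (a i)" using Eupd[OF a0 j] by simp
      moreover have "q j = p j * of_int (a i + int N)" using Eupd[OF ai j] by simp
      ultimately have "p j * ?n = 0" by (simp add: algebra_simps)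
      then show ?thesis using N \<open>q j = p j * of_int (a i)\<close> by simp
    qed
    \<comment> \<open>In the direction \<open>i\<close> the relation is quadratic in
      \<open>t\<close>. Twice the case \<open>t = 1\<close> subtracted from the case
      \<open>t = 2\<close> leaves only the quadratic coefficient, and so
      \<open>p i = 0\<close>.\<close>
    have step: "?q a + of_nat t * ?n * q i = (?p a + of_nat t * ?n * p i) * (of_int (a i) + of_nat t * ?n)"
      for t :: nat
      using E[of "a(i := a i + int t * int N)"] sum_upd[OF I(2), of a "int t * int N"] by (simp add: add.assoc)
    have e0: "?q a = ?p a * of_int (a i)" using E[OF a0] .
    have e1: "?n * q i = ?n * (p i * of_int (a i) + ?p a + p i * ?n)"
      using step[of 1] e0 by (simp add: algebra_simps)
    have e2: "?n * (2 * q i) = ?n * (2 * p i * of_int (a i) + 2 * ?p a + 4 * p i * ?n)"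
      using step[of 2] e0 by (simp add: algebra_simps)
    have e1': "q i = p i * of_int (a i) + ?p a + p i * ?n" using e1 N by simp
    have e2': "2 * q i = 2 * p i * of_int (a i) + 2 * ?p a + 4 * p i * ?n" using e2 N by simp
    have "p i * ?n = 0" using e1' e2' by simp
    then have pi: "p i = 0" using N by simp
    then have p0: "p j = 0" if "j \<in> I" for j using off that by blast
    then have pa: "?p a = p0" by simp
    then have qi: "q i = p0" using e1' pi by simp
    have "(\<Sum>j\<in>I. of_int (a j) * q j) = (\<Sum>j\<in>I. if j = i then of_int (a j) * q j else 0)"
      using off by (intro sum.cong) auto
    also have "\<dots> = of_int (a i) * q i" using I by simp
    finally have "q0 = 0" using e0 pa qi by simp
    then show False using ns p0 off qi by blast
  qed
  then obtain b where b: "\<And>j. int N dvd b j - a j" "?q b - ?p b * of_int (b i) \<noteq> 0" by blast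
  define \<delta> where "\<delta> = ?q b - ?p b * of_int (b i)"
  \<comment> \<open>A multiple of \<open>N\<close> larger than the absolute value of
    \<open>\<delta>\<close>: then \<open>\<delta> / d\<close> lies strictly between -1 and 1 and is
    not zero, so it is no integer.\<close>
  define d where "d = N * Suc (nat \<lceil>\<bar>\<delta>\<bar>\<rceil>)"
  have d: "d > 0" using N by (simp add: d_def)
  have "\<lceil>\<bar>\<delta>\<bar>\<rceil> \<ge> 0" by simp
  then have "of_nat (Suc (nat \<lceil>\<bar>\<delta>\<bar>\<rceil>)) = of_int \<lceil>\<bar>\<delta>\<bar>\<rceil> + (1 :: rat)" by (simp add: of_nat_nat)
  then have "\<bar>\<delta>\<bar> < of_nat (Suc (nat \<lceil>\<bar>\<delta>\<bar>\<rceil>))"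
    using le_of_int_ceiling[of "\<bar>\<delta>\<bar>"] by linarith
  also have "Suc (nat \<lceil>\<bar>\<delta>\<bar>\<rceil>) \<le> d" unfolding d_def using N by (cases N) simp_all
  then have "of_nat (Suc (nat \<lceil>\<bar>\<delta>\<bar>\<rceil>)) \<le> (of_nat d :: rat)" by (rule of_nat_mono)
  finally have lt: "\<bar>\<delta> / of_nat d\<bar> < 1" using d by (simp add: abs_divide)
  have "\<delta> / of_nat d \<notin> \<int>"
  proof
    assume "\<delta> / of_nat d \<in> \<int>"
    then obtain z where z: "\<delta> / of_nat d = of_int z" by (auto elim: Ints_cases)
    then have "\<bar>of_int z :: rat\<bar> < 1" using lt by simp
    then have "of_int \<bar>z\<bar> < (1 :: rat)" by simp
    then have "z = 0" by (simp only: of_int_less_1_iff zabs_less_one_iff)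
    then show False using z d b(2) by (simp add: \<delta>_def)
  qed
  moreover have "\<delta> / of_nat d = ?q b / of_nat d - ?p b / of_nat d * of_int (b i)"
    by (simp add: \<delta>_def diff_divide_distrib)
  ultimately have nz: "?q b / of_nat d - ?p b / of_nat d * of_int (b i) \<notin> \<int>" by simp
  obtain m :: nat where m: "m > 0" "of_nat m * (?p b / of_nat d) \<in> \<int>" using rat_multiple_Ints by blast
  have pI: "of_nat (d * m) * (?p b / of_nat d) \<in> \<int>"
    using Ints_mult[OF Ints_of_nat m(2), of d] by (simp only: of_nat_mult mult.assoc)
  have "\<exists>e>0. e dvd d * m \<and> of_nat (d * m) * (?p b / of_nat e) \<in> \<int> \<and>
      ?q b / of_nat e - ?p b / of_nat e * of_int (b i) \<notin> \<int>"
    by (intro exI[of _ d] conjI d dvd_triv_left pI nz)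
  moreover have "d * m > 0" "N dvd d * m" using d m(1) by (simp_all add: d_def)
  ultimately show "\<exists>a' N'. N' > 0 \<and> N dvd N' \<and> (\<forall>j. int N dvd a' j - a j) \<and> (\<exists>d>0. d dvd N' \<and>
      of_nat N' * (?p a' / of_nat d) \<in> \<int> \<and> ?q a' / of_nat d - ?p a' / of_nat d * of_int (a' i) \<notin> \<int>)"
    using b(1) by blast
qed

section \<open>The group attached to an adic sequence\<close>

lemma hom_finprod:
  assumes "comm_group G" "comm_group Y" "f \<in> hom G Y" "g \<in> J \<rightarrow> carrier G"
  shows "f (finprod G g J) = finprod Y (\<lambda>j. f (g j)) J"
proof -
  interpret G: comm_group G by fact
  interpret Y: comm_group Y by fact
  interpret f: group_hom G Y f
    by (intro group_homI assms G.is_group Y.is_group)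
  show ?thesis
    using assms(4)
  proof (induction J rule: infinite_finite_induct)
    case (insert j J)
    then show ?case by (simp add: Pi_iff)
  qed auto
qed

definition adic_group :: "'i set \<Rightarrow> (nat \<Rightarrow> 'i \<Rightarrow> int) \<Rightarrow> (rat \<times> ('i \<Rightarrow> rat)) monoid" where
  "adic_group I a =
     \<lparr>carrier = {(r, x). (\<forall>i. i \<notin> I \<longrightarrow> x i = 0) \<and>
        (\<exists>K. \<forall>k\<ge>K. \<forall>i\<in>I. x i - r * of_int (a k i) \<in> \<int>)},
      monoid.mult = (\<lambda>(r, x) (s, y). (r + s, \<lambda>i. x i + y i)),
      one = (0, \<lambda>_. 0)\<rparr>"

text \<open>In the limit \<open>a\<close> is a tuple of profinite integers, and the group consists of the rational
  vectors \<open>(r, x)\<close> for which \<open>x - r a\<close> is integral.\<close>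

locale adic_sequence =
  fixes I :: "'i set" and a :: "nat \<Rightarrow> 'i \<Rightarrow> int" and N :: "nat \<Rightarrow> nat"
  assumes finite_I: "finite I" and nonempty_I: "I \<noteq> {}"
    and N_pos: "N k > 0" and N_dvd: "N k dvd N (Suc k)" and N_div: "Suc k dvd N (Suc k)"
    and a_cong: "int (N k) dvd a (Suc k) i - a k i"
begin

abbreviation "H \<equiv> adic_group I a"

lemma N_mono: "k \<le> l \<Longrightarrow> N k dvd N l"
proof (induction l rule: dec_induct)
  case (step m)
  then show ?case using N_dvd dvd_trans by blast
qed simp

lemma a_mono: "k \<le> l \<Longrightarrow> int (N k) dvd a l i - a k i"
proof (induction l rule: dec_induct)
  case (step m)
  have "int (N k) dvd int (N m)" using N_mono[OF step.hyps(1)] by simp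
  then have "int (N k) dvd (a (Suc m) i - a m i) + (a m i - a k i)"
    using a_cong[of m i] step.IH dvd_trans by (intro dvd_add) blast+
  then show ?case by simp
qed simp

lemma N_Ints_mono:
  assumes "of_nat (N k) * (r::rat) \<in> \<int>" "k \<le> l"
  shows "of_nat (N l) * r \<in> \<int>"
proof -
  obtain m where "N l = m * N k" using N_mono[OF assms(2)] by (metis dvdE mult.commute)
  then show ?thesis using Ints_mult[OF Ints_of_nat assms(1), of m] by (simp add: mult.assoc)
qed

lemma N_Ints: "\<exists>K. \<forall>k\<ge>K. of_nat (N k) * (r::rat) \<in> \<int>"
proof -
  obtain m where m: "m > 0" "of_nat m * r \<in> \<int>" using rat_multiple_Ints by blast
  have "m dvd N m" using N_div[of "m - 1"] m by simp
  then obtain c where "N m = c * m" by (metis dvdE mult.commute)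
  then have "of_nat (N m) * r \<in> \<int>"
    using Ints_mult[OF Ints_of_nat m(2), of c] by (simp add: mult.assoc)
  then show ?thesis using N_Ints_mono by blast
qed

lemma a_diff_Ints:
  assumes "of_nat (N k) * (r::rat) \<in> \<int>" "k \<le> l"
  shows "r * of_int (a l i) - r * of_int (a k i) \<in> \<int>"
proof -
  obtain z where "a l i - a k i = int (N k) * z" using a_mono[OF assms(2)] by (metis dvdE)
  then have "of_int (a l i) = (of_int (a k i) + of_nat (N k) * of_int z :: rat)"
    by (metis add.commute diff_add_cancel of_int_add of_int_mult of_int_of_nat_eq)
  then have "r * of_int (a l i) - r * of_int (a k i) = (of_nat (N k) * r) * of_int z"
    by (simp add: algebra_simps)
  then show ?thesis using assms(1) by (simp add: Ints_mult)
qed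

text \<open>From a level \<open>k\<close> on at which \<open>N k\<close> clears the denominator of
  \<open>r\<close>, the products \<open>r * a k i\<close> change only by integers. So the condition
  on all large levels in the definition of the carrier can be tested at any one such level.\<close>

lemma H_iff:
  assumes r: "of_nat (N k) * (r::rat) \<in> \<int>"
  shows "(r, x) \<in> carrier H \<longleftrightarrow> (\<forall>i. i \<notin> I \<longrightarrow> x i = 0) \<and> (\<forall>i\<in>I. x i - r * of_int (a k i) \<in> \<int>)"
proof -
  have "x i - r * of_int (a l i) \<in> \<int> \<longleftrightarrow> x i - r * of_int (a k i) \<in> \<int>" if "l \<ge> k" for l i
  proof
    have d: "r * of_int (a l i) - r * of_int (a k i) \<in> \<int>" using a_diff_Ints[OF r that] .
    show "x i - r * of_int (a k i) \<in> \<int>" if "x i - r * of_int (a l i) \<in> \<int>"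
      using Ints_add[OF that d] by simp
    show "x i - r * of_int (a l i) \<in> \<int>" if "x i - r * of_int (a k i) \<in> \<int>"
      using Ints_diff[OF that d] by simp
  qed
  then have "(\<exists>K. \<forall>l\<ge>K. \<forall>i\<in>I. x i - r * of_int (a l i) \<in> \<int>) \<longleftrightarrow> (\<forall>i\<in>I. x i - r * of_int (a k i) \<in> \<int>)"
    by (meson max.cobounded1 max.cobounded2)
  then show ?thesis
    by (simp add: adic_group_def)
qed

lemma H_Int_iff: "r \<in> \<int> \<Longrightarrow> (r, x) \<in> carrier H \<longleftrightarrow> (\<forall>i. i \<notin> I \<longrightarrow> x i = 0) \<and> (\<forall>i\<in>I. x i \<in> \<int>)"
proof -
  assume r: "r \<in> \<int>"
  have "x i - r * of_int (a 0 i) \<in> \<int> \<longleftrightarrow> x i \<in> \<int>" for i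
    using r Ints_add[of "x i - r * of_int (a 0 i)" "r * of_int (a 0 i)"]
      Ints_diff[of "x i" "r * of_int (a 0 i)"] by (auto simp: Ints_mult)
  then show ?thesis using H_iff[of 0 r x] r by (simp add: Ints_mult)
qed

lemma mult_H: "(r, x) \<otimes>\<^bsub>H\<^esub> (s, y) = (r + s, \<lambda>i. x i + y i)"
  and one_H: "\<one>\<^bsub>H\<^esub> = (0, \<lambda>_. 0)"
  by (simp_all add: adic_group_def)

lemma snd_H_outside: "h \<in> carrier H \<Longrightarrow> i \<notin> I \<Longrightarrow> snd h i = 0"
  by (cases h) (simp add: adic_group_def)

lemma comm_group_H: "comm_group H"
proof (rule comm_groupI)
  fix g h assume g: "g \<in> carrier H" and h: "h \<in> carrier H"
  obtain r x where gx: "g = (r, x)" by fastforce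
  obtain s y where hy: "h = (s, y)" by fastforce
  obtain K where K: "\<forall>k\<ge>K. of_nat (N k) * r \<in> \<int>" using N_Ints[of r] by blast
  obtain K' where K': "\<forall>k\<ge>K'. of_nat (N k) * s \<in> \<int>" using N_Ints[of s] by blast
  define k where "k = max K K'"
  have kr: "of_nat (N k) * r \<in> \<int>" and ks: "of_nat (N k) * s \<in> \<int>"
    using K K' by (simp_all add: k_def)
  have krs: "of_nat (N k) * (r + s) \<in> \<int>" using Ints_add[OF kr ks] by (simp add: algebra_simps)
  have "x i + y i - (r + s) * of_int (a k i) \<in> \<int>" if "i \<in> I" for i
  proof -
    have "x i - r * of_int (a k i) \<in> \<int>" "y i - s * of_int (a k i) \<in> \<int>"
      using g h that unfolding gx hy H_iff[OF kr] H_iff[OF ks] by auto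
    from Ints_add[OF this] show ?thesis by (simp add: algebra_simps)
  qed
  then show "g \<otimes>\<^bsub>H\<^esub> h \<in> carrier H"
    using g h unfolding gx hy mult_H H_iff[OF kr] H_iff[OF ks] H_iff[OF krs] by simp
  show "g \<otimes>\<^bsub>H\<^esub> h = h \<otimes>\<^bsub>H\<^esub> g" unfolding gx hy mult_H by (simp add: add.commute)
  fix u show "g \<otimes>\<^bsub>H\<^esub> h \<otimes>\<^bsub>H\<^esub> u = g \<otimes>\<^bsub>H\<^esub> (h \<otimes>\<^bsub>H\<^esub> u)"
    unfolding gx hy by (cases u) (simp add: mult_H add.assoc)
next
  show "\<one>\<^bsub>H\<^esub> \<in> carrier H" unfolding one_H by (simp add: H_Int_iff)
next
  fix g assume g: "g \<in> carrier H"
  obtain r x where gx: "g = (r, x)" by fastforce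
  show "\<one>\<^bsub>H\<^esub> \<otimes>\<^bsub>H\<^esub> g = g" unfolding gx one_H mult_H by simp
  obtain k where kr: "of_nat (N k) * r \<in> \<int>" using N_Ints by blast
  then have kr': "of_nat (N k) * - r \<in> \<int>" by (simp add: Ints_minus)
  have "- x i - - r * of_int (a k i) \<in> \<int>" if "i \<in> I" for i
  proof -
    have "x i - r * of_int (a k i) \<in> \<int>" using g that unfolding gx H_iff[OF kr] by auto
    from Ints_minus[OF this] show ?thesis by simp
  qed
  then have "(- r, \<lambda>i. - x i) \<in> carrier H"
    using g unfolding gx H_iff[OF kr] H_iff[OF kr'] by simp
  moreover have "(- r, \<lambda>i. - x i) \<otimes>\<^bsub>H\<^esub> g = \<one>\<^bsub>H\<^esub>" unfolding gx mult_H one_H by simp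
  ultimately show "\<exists>h\<in>carrier H. h \<otimes>\<^bsub>H\<^esub> g = \<one>\<^bsub>H\<^esub>" by blast
qed

sublocale H: comm_group H by (rule comm_group_H)

lemma nat_pow_H: "g [^]\<^bsub>H\<^esub> (n::nat) = (of_nat n * fst g, \<lambda>i. of_nat n * snd g i)"
proof (induction n)
  case 0
  then show ?case by (simp add: one_H)
next
  case (Suc n)
  then show ?case by (cases g) (simp add: mult_H algebra_simps)
qed

lemma inv_H: "g \<in> carrier H \<Longrightarrow> inv\<^bsub>H\<^esub> g = (- fst g, \<lambda>i. - snd g i)"
proof -
  assume g: "g \<in> carrier H"
  obtain r x where rx: "inv\<^bsub>H\<^esub> g = (r, x)" by fastforce
  have "(r, x) \<otimes>\<^bsub>H\<^esub> g = \<one>\<^bsub>H\<^esub>" using H.l_inv[OF g] rx by simp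
  then show ?thesis unfolding rx by (cases g) (auto simp: mult_H one_H fun_eq_iff eq_neg_iff_add_eq_0)
qed

lemma int_pow_H:
  assumes "g \<in> carrier H"
  shows "g [^]\<^bsub>H\<^esub> (n::int) = (of_int n * fst g, \<lambda>i. of_int n * snd g i)"
proof (cases n rule: int_cases2)
  case (nonneg m)
  then show ?thesis by (simp add: int_pow_int nat_pow_H)
next
  case (nonpos m)
  have "g [^]\<^bsub>H\<^esub> n = (- fst (g [^]\<^bsub>H\<^esub> m), \<lambda>i. - snd (g [^]\<^bsub>H\<^esub> m) i)"
    unfolding nonpos H.int_pow_neg_int[OF assms] by (rule inv_H[OF H.nat_pow_closed[OF assms]])
  then show ?thesis by (simp add: nat_pow_H nonpos)
qed

lemma finprod_H:
  assumes "g \<in> J \<rightarrow> carrier H" "finite J"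
  shows "finprod H g J = (\<Sum>j\<in>J. fst (g j), \<lambda>i. \<Sum>j\<in>J. snd (g j) i)"
  using assms(2,1)
proof (induction J rule: finite_induct)
  case empty
  then show ?case by (simp add: one_H)
next
  case (insert j J)
  then have "finprod H g (insert j J) = g j \<otimes>\<^bsub>H\<^esub> finprod H g J" by (intro H.finprod_insert) auto
  then show ?case using insert by (cases "g j") (simp add: mult_H Pi_iff)
qed

lemma torsion_free_H: "torsion_free_group H"
proof -
  have "g = \<one>\<^bsub>H\<^esub>" if "g [^]\<^bsub>H\<^esub> (n::nat) = \<one>\<^bsub>H\<^esub>" "n > 0" for g n
    using that unfolding nat_pow_H one_H by (cases g) (auto simp: fun_eq_iff)
  then have "torsion_part H = {\<one>\<^bsub>H\<^esub>}"
    by (auto simp: torsion_part_def intro!: exI[of _ "1::nat"])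
  then show ?thesis unfolding torsion_free_group_def using comm_group_H by blast
qed

lemma countable_H: "countable (carrier H)"
proof -
  have "carrier H \<subseteq> (\<lambda>(r, x). (r, \<lambda>i. if i \<in> I then x i else 0)) ` (UNIV \<times> (I \<rightarrow>\<^sub>E UNIV))"
  proof
    fix h assume h: "h \<in> carrier H"
    obtain r x where rx: "h = (r, x)" by fastforce
    have "\<forall>i. i \<notin> I \<longrightarrow> x i = 0" using h rx by (simp add: adic_group_def)
    then have "h = (\<lambda>(r, x). (r, \<lambda>i. if i \<in> I then x i else 0)) (r, restrict x I)"
      unfolding rx by auto
    then show "h \<in> (\<lambda>(r, x). (r, \<lambda>i. if i \<in> I then x i else 0)) ` (UNIV \<times> (I \<rightarrow>\<^sub>E UNIV))"
      by (rule image_eqI) simp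
  qed
  moreover have "countable ((UNIV :: rat set) \<times> (I \<rightarrow>\<^sub>E (UNIV :: rat set)))"
    using finite_I by (intro countable_SIGMA countable_PiE) auto
  ultimately show ?thesis by (rule countable_subset[OF _ countable_image])
qed

section \<open>Unit vectors, fractions of (1, a), and homomorphisms evaluated on them\<close>

definition e0 :: "rat \<times> ('i \<Rightarrow> rat)" where "e0 = (1, \<lambda>_. 0)"

definition e :: "'i \<Rightarrow> rat \<times> ('i \<Rightarrow> rat)" where "e i = (0, \<lambda>j. if j = i then 1 else 0)"

lemma e0_carrier: "e0 \<in> carrier H" and e_carrier: "i \<in> I \<Longrightarrow> e i \<in> carrier H"
  by (auto simp: e0_def e_def H_Int_iff)

lemma integral_vector_eq:
  "e0 [^]\<^bsub>H\<^esub> (c0::int) \<otimes>\<^bsub>H\<^esub> finprod H (\<lambda>i. e i [^]\<^bsub>H\<^esub> (c i :: int)) I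
     = (of_int c0, \<lambda>i. if i \<in> I then of_int (c i) else 0)"
proof -
  have "finprod H (\<lambda>i. e i [^]\<^bsub>H\<^esub> c i) I
      = (\<Sum>j\<in>I. fst (e j [^]\<^bsub>H\<^esub> c j), \<lambda>i. \<Sum>j\<in>I. snd (e j [^]\<^bsub>H\<^esub> c j) i)"
    using e_carrier finite_I by (intro finprod_H) auto
  also have "\<dots> = (0, \<lambda>i. if i \<in> I then of_int (c i) else 0)"
  proof -
    have "(\<Sum>j\<in>I. snd (e j [^]\<^bsub>H\<^esub> c j) i) = (if i \<in> I then of_int (c i) else 0)" for i
    proof -
      have "(\<Sum>j\<in>I. snd (e j [^]\<^bsub>H\<^esub> c j) i) = (\<Sum>j\<in>I. if i = j then of_int (c j) else 0)"
        using e_carrier by (intro sum.cong) (auto simp: int_pow_H e_def)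
      then show ?thesis using finite_I by simp
    qed
    moreover have "(\<Sum>j\<in>I. fst (e j [^]\<^bsub>H\<^esub> c j)) = 0"
      using e_carrier by (intro sum.neutral) (simp add: int_pow_H e_def)
    ultimately show ?thesis by simp
  qed
  finally show ?thesis using e0_carrier by (simp add: int_pow_H mult_H e0_def)
qed

lemma hom_integral_vector:
  assumes Y: "comm_group Y" and f: "f \<in> hom H Y"
    and h: "h = (of_int c0, \<lambda>i. if i \<in> I then of_int (c i) else 0)"
  shows "f h = f e0 [^]\<^bsub>Y\<^esub> (c0::int) \<otimes>\<^bsub>Y\<^esub> finprod Y (\<lambda>i. f (e i) [^]\<^bsub>Y\<^esub> (c i :: int)) I"
proof -
  interpret Y: comm_group Y by fact
  interpret f: group_hom H Y f
    by (intro group_homI f H.is_group Y.is_group)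
  have cl: "(\<lambda>i. e i [^]\<^bsub>H\<^esub> c i) \<in> I \<rightarrow> carrier H" using e_carrier by auto
  have "f h = f (e0 [^]\<^bsub>H\<^esub> c0) \<otimes>\<^bsub>Y\<^esub> f (finprod H (\<lambda>i. e i [^]\<^bsub>H\<^esub> c i) I)"
    unfolding h integral_vector_eq[symmetric] using e0_carrier cl by simp
  also have "f (finprod H (\<lambda>i. e i [^]\<^bsub>H\<^esub> c i) I) = finprod Y (\<lambda>i. f (e i [^]\<^bsub>H\<^esub> c i)) I"
    by (rule hom_finprod[OF comm_group_H Y f cl])
  also have "\<dots> = finprod Y (\<lambda>i. f (e i) [^]\<^bsub>Y\<^esub> c i) I"
    using e_carrier by (intro Y.finprod_cong') (auto simp: f.hom_int_pow)
  finally show ?thesis using e0_carrier by (simp add: f.hom_int_pow)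
qed

text \<open>The d-th part of the integral vector (1, a k). It belongs to \<open>H\<close> when
  \<open>d\<close> divides \<open>N k\<close>, since \<open>a k\<close> then agrees with the limit
  modulo \<open>d\<close>. Homomorphisms out of \<open>H\<close> are tested on these
  elements.\<close>

definition w :: "nat \<Rightarrow> nat \<Rightarrow> rat \<times> ('i \<Rightarrow> rat)" where
  "w k d = (1 / of_nat d, \<lambda>i. if i \<in> I then of_int (a k i) / of_nat d else 0)"

lemma w_carrier:
  assumes "d dvd N k" "d > 0"
  shows "w k d \<in> carrier H"
proof -
  obtain m where "N k = d * m" using assms by auto
  then have "of_nat (N k) * (1 / of_nat d :: rat) \<in> \<int>" using assms by simp
  then show ?thesis unfolding w_def by (simp add: H_iff)
qed

text \<open>Source of the expressions in \<open>dense_hom_from\<close> and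
  \<open>dense_endomorphism\<close>: the right-hand side involves only the values on unit vectors,
  and it must have a d-th root in \<open>Y\<close>.\<close>

lemma hom_w:
  assumes Y: "comm_group Y" and f: "f \<in> hom H Y" and d: "d dvd N k" "d > 0"
  shows "f (w k d) [^]\<^bsub>Y\<^esub> d = f e0 \<otimes>\<^bsub>Y\<^esub> finprod Y (\<lambda>i. f (e i) [^]\<^bsub>Y\<^esub> a k i) I"
proof -
  interpret Y: comm_group Y by fact
  interpret f: group_hom H Y f
    by (intro group_homI f H.is_group Y.is_group)
  have "w k d [^]\<^bsub>H\<^esub> d = (of_int 1, \<lambda>i. if i \<in> I then of_int (a k i) else 0)"
    using d by (auto simp: nat_pow_H w_def)
  from hom_integral_vector[OF Y f this] show ?thesis
    using w_carrier[OF d] e0_carrier by (simp add: f.hom_nat_pow)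
qed

text \<open>The vectors with first coordinate 0 form Z^I, and the quotient of \<open>H\<close> by
  them is the group of rationals, which is divisible. So \<open>g\<close> only has to carry the
  first coordinate divided by \<open>d\<close>, and the rest is integral.\<close>

lemma divisible_mod_integral:
  assumes h: "h \<in> carrier H" and d: "d > 0"
  obtains g c where "g \<in> carrier H"
    "h = g [^]\<^bsub>H\<^esub> (d::nat) \<otimes>\<^bsub>H\<^esub> (0, \<lambda>i. if i \<in> I then of_int (c i :: int) else 0)"
proof -
  obtain r x where rx: "h = (r, x)" by fastforce
  obtain k where k: "of_nat (N k) * (r / of_nat d) \<in> \<int>" using N_Ints by blast
  have kr: "of_nat (N k) * r \<in> \<int>" using Ints_mult[OF Ints_of_nat k, of d] d by simp
  define g where "g = (r / of_nat d, \<lambda>i. if i \<in> I then r / of_nat d * of_int (a k i) else 0)"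
  have "g \<in> carrier H" unfolding g_def H_iff[OF k] by simp
  have x: "x i = 0" if "i \<notin> I" for i using h that unfolding rx H_iff[OF kr] by blast
  have "x i - r * of_int (a k i) \<in> \<int>" if "i \<in> I" for i
    using h that unfolding rx H_iff[OF kr] by blast
  then have "\<exists>z. x i - r * of_int (a k i) = of_int z" if "i \<in> I" for i
    using that Ints_cases by metis
  then obtain c where c: "\<And>i. i \<in> I \<Longrightarrow> x i - r * of_int (a k i) = of_int (c i)" by metis
  have "h = g [^]\<^bsub>H\<^esub> d \<otimes>\<^bsub>H\<^esub> (0, \<lambda>i. if i \<in> I then of_int (c i) else 0)"
    unfolding rx nat_pow_H mult_H g_def using d x c by (auto simp: fun_eq_iff simp flip: c)
  then show thesis using that \<open>g \<in> carrier H\<close> by blast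
qed

text \<open>Genericity makes the images of all unit vectors torsion, and some \<open>M\<close> kills
  the image of Z^I. As \<open>H\<close> modulo Z^I is divisible, the M-th power of every value then
  lies in all \<open>multiples G d\<close>, so it is trivial. One exponent for the whole of
  \<open>H\<close> is required for torsion in the group of homomorphisms.\<close>

lemma hom_from_H_torsion:
  assumes G: "comm_group G"
    and res: "\<And>x. (\<And>n::nat. n > 0 \<Longrightarrow> x \<in> multiples G n) \<Longrightarrow> x = \<one>\<^bsub>G\<^esub>"
    and gen: "\<And>g0 g. g0 \<in> carrier G \<Longrightarrow> g \<in> I \<rightarrow>\<^sub>E carrier G \<Longrightarrow>
      g0 \<notin> torsion_part G \<or> (\<exists>i\<in>I. g i \<notin> torsion_part G) \<Longrightarrow>
      \<exists>k. g0 \<otimes>\<^bsub>G\<^esub> finprod G (\<lambda>i. g i [^]\<^bsub>G\<^esub> a k i) I \<notin> multiples G (N k)"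
    and f: "f \<in> hom H G"
  shows "\<exists>M::nat. M > 0 \<and> (\<forall>h \<in> carrier H. f h [^]\<^bsub>G\<^esub> M = \<one>\<^bsub>G\<^esub>)"
proof -
  interpret G: comm_group G by fact
  interpret f: group_hom H G f
    by (intro group_homI f H.is_group G.is_group)
  have tors: "f e0 \<in> torsion_part G \<and> (\<forall>i\<in>I. f (e i) \<in> torsion_part G)"
  proof (rule ccontr)
    assume "\<not> ?thesis"
    then have "f e0 \<notin> torsion_part G \<or> (\<exists>i\<in>I. (\<lambda>i\<in>I. f (e i)) i \<notin> torsion_part G)" by auto
    moreover have fe: "(\<lambda>i\<in>I. f (e i)) \<in> I \<rightarrow>\<^sub>E carrier G" using e_carrier by auto
    ultimately obtain k where k:
      "f e0 \<otimes>\<^bsub>G\<^esub> finprod G (\<lambda>i. (\<lambda>i\<in>I. f (e i)) i [^]\<^bsub>G\<^esub> a k i) I \<notin> multiples G (N k)"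
      using gen[OF f.hom_closed[OF e0_carrier] fe] by blast
    have "finprod G (\<lambda>i. (\<lambda>i\<in>I. f (e i)) i [^]\<^bsub>G\<^esub> a k i) I = finprod G (\<lambda>i. f (e i) [^]\<^bsub>G\<^esub> a k i) I"
      using e_carrier by (intro G.finprod_cong') auto
    then have "f (w k (N k)) [^]\<^bsub>G\<^esub> N k \<notin> multiples G (N k)"
      using k hom_w[OF G f, of "N k" k] N_pos by simp
    then show False using w_carrier[of "N k" k] N_pos by (auto simp: multiples_def)
  qed
  then obtain m0 where m0: "m0 > 0" "f e0 [^]\<^bsub>G\<^esub> (m0::nat) = \<one>\<^bsub>G\<^esub>" by (auto simp: torsion_part_def)
  have "\<forall>i\<in>I. \<exists>m::nat. m > 0 \<and> f (e i) [^]\<^bsub>G\<^esub> m = \<one>\<^bsub>G\<^esub>" using tors by (auto simp: torsion_part_def)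
  then obtain m where m: "\<And>i. i \<in> I \<Longrightarrow> m i > 0 \<and> f (e i) [^]\<^bsub>G\<^esub> (m i :: nat) = \<one>\<^bsub>G\<^esub>" by metis
  define M where "M = (\<Prod>i\<in>I. m i)"
  have M: "M > 0" unfolding M_def using m by (simp add: prod_pos)
  have eM: "f (e i) [^]\<^bsub>G\<^esub> M = \<one>\<^bsub>G\<^esub>" if i: "i \<in> I" for i
  proof -
    have "m i dvd M" unfolding M_def using finite_I i by (simp add: dvd_prodI)
    then obtain c where "M = m i * c" by auto
    then show ?thesis using m[OF i] e_carrier[OF i] by (simp flip: G.nat_pow_pow)
  qed
  have "f h [^]\<^bsub>G\<^esub> M = \<one>\<^bsub>G\<^esub>" if h: "h \<in> carrier H" for h
  proof (rule res)
    fix d :: nat assume d: "d > 0"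
    obtain g c where g: "g \<in> carrier H"
      and h_eq: "h = g [^]\<^bsub>H\<^esub> d \<otimes>\<^bsub>H\<^esub> (0, \<lambda>i. if i \<in> I then of_int (c i :: int) else 0)"
      using divisible_mod_integral[OF h d] by blast
    let ?v = "(0, \<lambda>i. if i \<in> I then of_int (c i) else 0) :: rat \<times> ('i \<Rightarrow> rat)"
    have v: "?v \<in> carrier H" by (simp add: H_Int_iff)
    have "f ?v = f e0 [^]\<^bsub>G\<^esub> (0::int) \<otimes>\<^bsub>G\<^esub> finprod G (\<lambda>i. f (e i) [^]\<^bsub>G\<^esub> c i) I"
      by (rule hom_integral_vector[OF G f]) simp
    also have "\<dots> = finprod G (\<lambda>i. f (e i) [^]\<^bsub>G\<^esub> c i) I" using e_carrier by simp
    finally have "f ?v [^]\<^bsub>G\<^esub> M = finprod G (\<lambda>i. f (e i) [^]\<^bsub>G\<^esub> c i) I [^]\<^bsub>G\<^esub> int M"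
      by (simp add: int_pow_int)
    also have "\<dots> = finprod G (\<lambda>i. (f (e i) [^]\<^bsub>G\<^esub> c i) [^]\<^bsub>G\<^esub> int M) I"
      using e_carrier by (intro G.finprod_int_pow) auto
    also have "\<dots> = \<one>\<^bsub>G\<^esub>"
    proof (rule G.finprod_one_eqI)
      fix i assume i: "i \<in> I"
      have "(f (e i) [^]\<^bsub>G\<^esub> c i) [^]\<^bsub>G\<^esub> int M = (f (e i) [^]\<^bsub>G\<^esub> int M) [^]\<^bsub>G\<^esub> c i"
        using e_carrier[OF i] by (simp add: G.int_pow_pow mult.commute)
      then show "(f (e i) [^]\<^bsub>G\<^esub> c i) [^]\<^bsub>G\<^esub> int M = \<one>\<^bsub>G\<^esub>" using eM[OF i] by (simp add: int_pow_int)
    qed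
    finally have vM: "f ?v [^]\<^bsub>G\<^esub> M = \<one>\<^bsub>G\<^esub>" .
    have "f h = f g [^]\<^bsub>G\<^esub> d \<otimes>\<^bsub>G\<^esub> f ?v" using h_eq g v by (simp add: f.hom_nat_pow)
    then have "f h [^]\<^bsub>G\<^esub> M = (f g [^]\<^bsub>G\<^esub> d) [^]\<^bsub>G\<^esub> M" using g v vM by (simp add: G.nat_pow_distrib)
    also have "\<dots> = (f g [^]\<^bsub>G\<^esub> M) [^]\<^bsub>G\<^esub> d" using g by (simp add: G.nat_pow_pow mult.commute)
    finally show "f h [^]\<^bsub>G\<^esub> M \<in> multiples G d" using g by (auto simp: multiples_def)
  qed
  then show ?thesis using M by blast
qed

text \<open>For each \<open>i\<close> the first and the i-th coordinate of \<open>f\<close> are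
  additive maps whose values satisfy the integrality condition of \<open>H\<close>;
  \<open>gen\<close> refutes this unless both vanish. An index exists by \<open>nonempty_I\<close>,
  which settles the first coordinate.\<close>

lemma hom_to_H_trivial:
  fixes G :: "('g, 'm) monoid_scheme"
  assumes G: "comm_group G"
    and gen: "\<And>(f :: 'g \<Rightarrow> rat) (\<phi> :: 'g \<Rightarrow> rat) i. i \<in> I \<Longrightarrow>
      (\<And>x y. x \<in> carrier G \<Longrightarrow> y \<in> carrier G \<Longrightarrow> f (x \<otimes>\<^bsub>G\<^esub> y) = f x + f y) \<Longrightarrow>
      (\<And>x y. x \<in> carrier G \<Longrightarrow> y \<in> carrier G \<Longrightarrow> \<phi> (x \<otimes>\<^bsub>G\<^esub> y) = \<phi> x + \<phi> y) \<Longrightarrow>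
      \<exists>x \<in> carrier G. f x \<noteq> 0 \<or> \<phi> x \<noteq> 0 \<Longrightarrow>
      \<exists>k. \<exists>g \<in> carrier G. of_nat (N k) * f g \<in> \<int> \<and> \<phi> g - f g * of_int (a k i) \<notin> \<int>"
    and f: "f \<in> hom G H" and x: "x \<in> carrier G"
  shows "f x = \<one>\<^bsub>H\<^esub>"
proof -
  have add: "fst (f (x \<otimes>\<^bsub>G\<^esub> y)) = fst (f x) + fst (f y)" "snd (f (x \<otimes>\<^bsub>G\<^esub> y)) i = snd (f x) i + snd (f y) i"
    if "x \<in> carrier G" "y \<in> carrier G" for x y i
    using hom_mult[OF f that] mult_H[of "fst (f x)" "snd (f x)" "fst (f y)" "snd (f y)"] by simp_all
  have 0: "fst (f x) = 0 \<and> snd (f x) i = 0" if i: "i \<in> I" for i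
  proof (rule ccontr)
    assume "\<not> ?thesis"
    then have "\<exists>x \<in> carrier G. fst (f x) \<noteq> 0 \<or> snd (f x) i \<noteq> 0" using x by blast
    from gen[of i "\<lambda>x. fst (f x)" "\<lambda>x. snd (f x) i", OF i add this]
    obtain k g where kg: "g \<in> carrier G" "of_nat (N k) * fst (f g) \<in> \<int>"
      "snd (f g) i - fst (f g) * of_int (a k i) \<notin> \<int>" by blast
    have "(fst (f g), snd (f g)) \<in> carrier H" using hom_in_carrier[OF f kg(1)] by simp
    then show False using H_iff[OF kg(2)] kg(3) i by blast
  qed
  have "snd (f x) i = 0" if "i \<notin> I" for i using snd_H_outside[OF hom_in_carrier[OF f x] that] .
  then have "snd (f x) = (\<lambda>_. 0)" using 0 by blast
  moreover have "fst (f x) = 0" using 0 nonempty_I by blast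
  ultimately show ?thesis unfolding one_H by (metis prod.collapse)
qed

text \<open>Each coordinate \<open>i\<close> is treated separately: the images of the elements
  \<open>w k d\<close> lie in \<open>H\<close>, so \<open>gen\<close> leaves only the case in which
  that coordinate of the images of unit vectors is multiplication by \<open>p0\<close>.\<close>

lemma endomorphism_H_scalar:
  assumes gen: "\<And>(p :: 'i \<Rightarrow> rat) q p0 q0 i. i \<in> I \<Longrightarrow> p \<in> I \<rightarrow>\<^sub>E UNIV \<Longrightarrow> q \<in> I \<rightarrow>\<^sub>E UNIV \<Longrightarrow>
      \<not> ((\<forall>j\<in>I. p j = 0) \<and> (\<forall>j\<in>I - {i}. q j = 0) \<and> q i = p0 \<and> q0 = 0) \<Longrightarrow>
      \<exists>k. \<exists>d>0. d dvd N k \<and>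
        of_nat (N k) * ((p0 + (\<Sum>j\<in>I. of_int (a k j) * p j)) / of_nat d) \<in> \<int> \<and>
        (q0 + (\<Sum>j\<in>I. of_int (a k j) * q j)) / of_nat d
          - (p0 + (\<Sum>j\<in>I. of_int (a k j) * p j)) / of_nat d * of_int (a k i) \<notin> \<int>"
    and \<psi>: "\<psi> \<in> hom H H"
  shows "\<exists>c. \<forall>h \<in> carrier H. \<psi> h = (c * fst h, \<lambda>i. c * snd h i)"
proof -
  interpret \<psi>: group_hom H H \<psi>
    by (intro group_homI \<psi> H.is_group)
  define p0 where "p0 = fst (\<psi> e0)"
  define p where "p = (\<lambda>j\<in>I. fst (\<psi> (e j)))"
  have \<psi>e: "\<psi> (e j) \<in> carrier H" if "j \<in> I" for j using that e_carrier by simp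
  have \<psi>e0: "\<psi> e0 \<in> carrier H" using e0_carrier by simp
  have pw: "(\<lambda>j. \<psi> (e j) [^]\<^bsub>H\<^esub> (c j :: int)) \<in> I \<rightarrow> carrier H" for c using \<psi>e by auto
  have fin: "finprod H (\<lambda>j. \<psi> (e j) [^]\<^bsub>H\<^esub> (c j :: int)) I
      = (\<Sum>j\<in>I. of_int (c j) * p j, \<lambda>i. \<Sum>j\<in>I. of_int (c j) * snd (\<psi> (e j)) i)" for c
    unfolding finprod_H[OF pw finite_I] by (auto simp: int_pow_H \<psi>e p_def intro!: sum.cong)
  have scalar: "(\<forall>j\<in>I. p j = 0) \<and> (\<forall>j\<in>I - {i}. snd (\<psi> (e j)) i = 0) \<and> snd (\<psi> (e i)) i = p0 \<and> snd (\<psi> e0) i = 0"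
    if i: "i \<in> I" for i
  proof (rule ccontr)
    assume neg: "\<not> ?thesis"
    define q where "q = (\<lambda>j\<in>I. snd (\<psi> (e j)) i)"
    have "\<not> ((\<forall>j\<in>I. p j = 0) \<and> (\<forall>j\<in>I - {i}. q j = 0) \<and> q i = p0 \<and> snd (\<psi> e0) i = 0)"
      using neg i by (auto simp: q_def)
    moreover have "p \<in> I \<rightarrow>\<^sub>E UNIV" "q \<in> I \<rightarrow>\<^sub>E UNIV" by (auto simp: p_def q_def)
    ultimately obtain k d where d: "d > 0" "d dvd N k"
      and P: "of_nat (N k) * ((p0 + (\<Sum>j\<in>I. of_int (a k j) * p j)) / of_nat d) \<in> \<int>"
      and Q: "(snd (\<psi> e0) i + (\<Sum>j\<in>I. of_int (a k j) * q j)) / of_nat d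
          - (p0 + (\<Sum>j\<in>I. of_int (a k j) * p j)) / of_nat d * of_int (a k i) \<notin> \<int>"
      using gen[OF i] by blast
    have "\<psi> (w k d) [^]\<^bsub>H\<^esub> d = \<psi> e0 \<otimes>\<^bsub>H\<^esub> finprod H (\<lambda>j. \<psi> (e j) [^]\<^bsub>H\<^esub> a k j) I"
      by (rule hom_w[OF comm_group_H \<psi> d(2,1)])
    then have eq: "(of_nat d * fst (\<psi> (w k d)), \<lambda>i. of_nat d * snd (\<psi> (w k d)) i)
       = (p0 + (\<Sum>j\<in>I. of_int (a k j) * p j), \<lambda>i. snd (\<psi> e0) i + (\<Sum>j\<in>I. of_int (a k j) * snd (\<psi> (e j)) i))"
      unfolding fin nat_pow_H by (cases "\<psi> e0") (simp add: mult_H p0_def)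
    have "(\<Sum>j\<in>I. of_int (a k j) * snd (\<psi> (e j)) i) = (\<Sum>j\<in>I. of_int (a k j) * q j)"
      by (intro sum.cong) (auto simp: q_def)
    then have F: "fst (\<psi> (w k d)) = (p0 + (\<Sum>j\<in>I. of_int (a k j) * p j)) / of_nat d"
      and S: "snd (\<psi> (w k d)) i = (snd (\<psi> e0) i + (\<Sum>j\<in>I. of_int (a k j) * q j)) / of_nat d"
      using eq d by (auto simp: fun_eq_iff field_simps)
    have "(fst (\<psi> (w k d)), snd (\<psi> (w k d))) \<in> carrier H" using w_carrier[OF d(2,1)] by simp
    then have "snd (\<psi> (w k d)) i - fst (\<psi> (w k d)) * of_int (a k i) \<in> \<int>"
      using P i H_iff[of k "fst (\<psi> (w k d))"] unfolding F by blast
    then show False using Q unfolding F S by blast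
  qed
  note off = snd_H_outside
  have "\<psi> h = (p0 * fst h, \<lambda>i. p0 * snd h i)" if h: "h \<in> carrier H" for h
  proof -
    \<comment> \<open>A multiple of \<open>h\<close> is an integral vector, on which the images of
      the unit vectors determine \<open>\<psi>\<close>; division by \<open>D\<close> in the rational
      coordinates brings this back to \<open>h\<close>.\<close>
    obtain D where D: "D > 0" "of_nat D * fst h \<in> \<int>" using rat_multiple_Ints by blast
    have hD: "h [^]\<^bsub>H\<^esub> D \<in> carrier H" using h by simp
    then have "\<forall>i\<in>I. of_nat D * snd h i \<in> \<int>" unfolding nat_pow_H H_Int_iff[OF D(2)] by blast
    then have "\<forall>i\<in>I. \<exists>z. of_nat D * snd h i = of_int z" by (metis Ints_cases)
    then obtain c where c: "\<And>i. i \<in> I \<Longrightarrow> of_nat D * snd h i = of_int (c i)" by metis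
    obtain c0 where c0: "of_nat D * fst h = of_int c0" using D(2) by (metis Ints_cases)
    have "h [^]\<^bsub>H\<^esub> D = (of_int c0, \<lambda>i. if i \<in> I then of_int (c i) else 0)"
      unfolding nat_pow_H using c c0 off[OF h] by auto
    from hom_integral_vector[OF comm_group_H \<psi> this]
    have "\<psi> h [^]\<^bsub>H\<^esub> D = \<psi> e0 [^]\<^bsub>H\<^esub> c0 \<otimes>\<^bsub>H\<^esub> finprod H (\<lambda>j. \<psi> (e j) [^]\<^bsub>H\<^esub> c j) I"
      using h by (simp add: \<psi>.hom_nat_pow)
    then have eq: "of_nat D * fst (\<psi> h) = of_int c0 * p0 + (\<Sum>j\<in>I. of_int (c j) * p j)"
      "of_nat D * snd (\<psi> h) i = of_int c0 * snd (\<psi> e0) i + (\<Sum>j\<in>I. of_int (c j) * snd (\<psi> (e j)) i)" for i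
      unfolding fin nat_pow_H int_pow_H[OF \<psi>e0] mult_H by (auto simp: p0_def fun_eq_iff)
    have "(\<Sum>j\<in>I. of_int (c j) * p j) = 0"
      using scalar nonempty_I by (intro sum.neutral) auto
    then have "of_nat D * fst (\<psi> h) = of_nat D * (p0 * fst h)" using eq(1) c0 by (simp add: mult_ac)
    then have 1: "fst (\<psi> h) = p0 * fst h" using D by simp
    have "snd (\<psi> h) i = p0 * snd h i" for i
    proof (cases "i \<in> I")
      case True
      have "(\<Sum>j\<in>I. of_int (c j) * snd (\<psi> (e j)) i) = (\<Sum>j\<in>I. if j = i then of_int (c j) * p0 else 0)"
        using scalar[OF True] by (intro sum.cong) auto
      then have "of_nat D * snd (\<psi> h) i = of_int (c i) * p0"
        using eq(2)[of i] scalar[OF True] True finite_I by simp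
      also have "\<dots> = of_nat D * (p0 * snd h i)" using c[OF True] by (simp add: mult_ac)
      finally show ?thesis using D by simp
    next
      case False
      then show ?thesis using off h by simp
    qed
    then show ?thesis using 1 by (metis prod.collapse ext)
  qed
  then show ?thesis by blast
qed

end

context adic_sequence
begin

text \<open>The epimorphism is \<open>(r, x) \<mapsto> \<Prod>\<^sub>l l^(x\<^sub>l - r a\<^sub>l)\<close>, a profinite power of each element \<open>l\<close> of the
  finite group. It is rigid because all automorphisms of \<open>H\<close> are scalars, hence \<open>1\<close> or \<open>- 1\<close>.\<close>

lemma rigid_epi_exists:
  assumes L: "comm_group L" and LI: "carrier L = I"
    and scalar: "\<And>\<psi>. \<psi> \<in> hom H H \<Longrightarrow> \<exists>c. \<forall>h \<in> carrier H. \<psi> h = (c * fst h, \<lambda>i. c * snd h i)"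
  shows "\<exists>\<alpha>. rigid_epi H L \<alpha>"
proof -
  interpret L: comm_group L by fact
  \<comment> \<open>The order of \<open>L\<close> kills every element, so exponents matter only
    modulo \<open>M\<close>.\<close>
  define M where "M = card (carrier L)"
  have M: "M > 0" using finite_I nonempty_I by (simp add: M_def LI card_gt_0_iff)
  have lM: "l [^]\<^bsub>L\<^esub> M = \<one>\<^bsub>L\<^esub>" if "l \<in> I" for l
    unfolding M_def using finite_I that LI by (intro L.power_order_eq_one) auto
  \<comment> \<open>Approximation of the profinite power at level \<open>k\<close>. For elements of
    \<open>H\<close> and large \<open>k\<close> the exponents are integers; the floor only makes the
    expression total.\<close>
  define E where "E k h = finprod L (\<lambda>l. l [^]\<^bsub>L\<^esub> \<lfloor>snd h l - fst h * of_int (a k l)\<rfloor>) I" for k and h :: "rat \<times> ('i \<Rightarrow> rat)"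
  \<comment> \<open>The extra division by \<open>M\<close> ensures that beyond level
    \<open>k\<close> the exponents change by multiples of \<open>M\<close>, not merely by integers,
    so that the value of \<open>E\<close> is stable.\<close>
  define good where "good k h \<longleftrightarrow> of_nat (N k) * (fst h / of_nat M) \<in> \<int>" for k and h :: "rat \<times> ('i \<Rightarrow> rat)"
  have cl: "(\<lambda>l. l [^]\<^bsub>L\<^esub> (c l :: int)) \<in> I \<rightarrow> carrier L" for c using LI by auto
  have Ecl: "E k h \<in> carrier L" for k h unfolding E_def by (rule L.finprod_closed[OF cl])
  have E_mono: "E k' h = E k h" if g: "good k h" and kk: "k \<le> k'" for h k k'
    unfolding E_def
  proof (rule L.finprod_cong'[OF refl cl])
    fix l assume l: "l \<in> I"
    have lc: "l \<in> carrier L" using l LI by simp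
    obtain z where z: "fst h / of_nat M * of_int (a k' l) - fst h / of_nat M * of_int (a k l) = of_int z"
      using a_diff_Ints[OF g[unfolded good_def] kk, of l] by (metis Ints_cases)
    then have "of_nat M * (fst h / of_nat M * of_int (a k' l) - fst h / of_nat M * of_int (a k l)) = of_int (int M * z)"
      by simp
    then have "fst h * of_int (a k' l) = fst h * of_int (a k l) + of_int (int M * z)"
      using M by (simp add: right_diff_distrib)
    then have "snd h l - fst h * of_int (a k' l) = snd h l - fst h * of_int (a k l) - of_int (int M * z)"
      by simp
    then have "\<lfloor>snd h l - fst h * of_int (a k' l)\<rfloor> = \<lfloor>snd h l - fst h * of_int (a k l)\<rfloor> - int M * z"
      by (simp only: floor_diff_of_int)
    moreover have "l [^]\<^bsub>L\<^esub> (int M * z) = \<one>\<^bsub>L\<^esub>"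
      using lM[OF l] lc by (simp add: int_pow_int flip: L.int_pow_pow)
    ultimately show "l [^]\<^bsub>L\<^esub> \<lfloor>snd h l - fst h * of_int (a k' l)\<rfloor> = l [^]\<^bsub>L\<^esub> \<lfloor>snd h l - fst h * of_int (a k l)\<rfloor>"
      using lc by (simp add: L.int_pow_diff)
  qed
  \<comment> \<open>Any good level yields the same value by \<open>E_mono\<close>; the choice only
    fixes one.\<close>
  define \<alpha> where "\<alpha> h = E (SOME k. good k h) h" for h
  have ex_good: "\<exists>K. \<forall>k\<ge>K. good k h" for h unfolding good_def by (rule N_Ints)
  have \<alpha>: "\<exists>K. \<forall>k\<ge>K. \<alpha> h = E k h \<and> good k h" for h
  proof -
    obtain K where K: "\<forall>k\<ge>K. good k h" using ex_good by blast
    define k0 where "k0 = (SOME k. good k h)"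
    have "\<exists>k. good k h" using K by blast
    then have k0: "good k0 h" unfolding k0_def by (rule someI_ex)
    have "\<alpha> h = E k h \<and> good k h" if "k \<ge> max K k0" for k
      using E_mono[OF k0, of k] K that unfolding \<alpha>_def k0_def by simp
    then show ?thesis by blast
  qed
  have hom: "\<alpha> \<in> hom H L"
  proof (rule homI)
    fix h assume "h \<in> carrier H"
    show "\<alpha> h \<in> carrier L" unfolding \<alpha>_def by (rule Ecl)
  next
    fix g h assume g: "g \<in> carrier H" and h: "h \<in> carrier H"
    obtain K1 where K1: "\<forall>k\<ge>K1. \<alpha> g = E k g \<and> good k g" using \<alpha> by blast
    obtain K2 where K2: "\<forall>k\<ge>K2. \<alpha> h = E k h \<and> good k h" using \<alpha> by blast
    obtain K3 where K3: "\<forall>k\<ge>K3. \<alpha> (g \<otimes>\<^bsub>H\<^esub> h) = E k (g \<otimes>\<^bsub>H\<^esub> h) \<and> good k (g \<otimes>\<^bsub>H\<^esub> h)" using \<alpha> by blast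
    define k where "k = max K1 (max K2 K3)"
    have k: "\<alpha> g = E k g" "\<alpha> h = E k h" "\<alpha> (g \<otimes>\<^bsub>H\<^esub> h) = E k (g \<otimes>\<^bsub>H\<^esub> h)" "good k g"
      using K1 K2 K3 by (simp_all add: k_def)
    have "of_nat (N k) * fst g \<in> \<int>"
      using Ints_mult[OF Ints_of_nat k(4)[unfolded good_def], of M] M by simp
    then have gI: "snd g l - fst g * of_int (a k l) \<in> \<int>" if "l \<in> I" for l
      using H_iff[of k "fst g" "snd g"] g that by simp
    have "E k (g \<otimes>\<^bsub>H\<^esub> h) = finprod L (\<lambda>l. l [^]\<^bsub>L\<^esub> \<lfloor>snd g l - fst g * of_int (a k l)\<rfloor>
        \<otimes>\<^bsub>L\<^esub> l [^]\<^bsub>L\<^esub> \<lfloor>snd h l - fst h * of_int (a k l)\<rfloor>) I"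
      unfolding E_def
    proof (rule L.finprod_cong'[OF refl])
      fix l assume l: "l \<in> I"
      obtain z where z: "snd g l - fst g * of_int (a k l) = of_int z" using gI[OF l] by (metis Ints_cases)
      have "snd (g \<otimes>\<^bsub>H\<^esub> h) l - fst (g \<otimes>\<^bsub>H\<^esub> h) * of_int (a k l)
          = of_int z + (snd h l - fst h * of_int (a k l))"
        unfolding z[symmetric] by (cases g; cases h) (simp add: mult_H algebra_simps)
      then have "\<lfloor>snd (g \<otimes>\<^bsub>H\<^esub> h) l - fst (g \<otimes>\<^bsub>H\<^esub> h) * of_int (a k l)\<rfloor>
          = z + \<lfloor>snd h l - fst h * of_int (a k l)\<rfloor>" by (simp only: int_add_floor)
      then show "l [^]\<^bsub>L\<^esub> \<lfloor>snd (g \<otimes>\<^bsub>H\<^esub> h) l - fst (g \<otimes>\<^bsub>H\<^esub> h) * of_int (a k l)\<rfloor>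
        = l [^]\<^bsub>L\<^esub> \<lfloor>snd g l - fst g * of_int (a k l)\<rfloor> \<otimes>\<^bsub>L\<^esub> l [^]\<^bsub>L\<^esub> \<lfloor>snd h l - fst h * of_int (a k l)\<rfloor>"
        unfolding z using l LI by (simp add: L.int_pow_mult)
    qed (use LI in auto)
    also have "\<dots> = E k g \<otimes>\<^bsub>L\<^esub> E k h" unfolding E_def by (rule L.finprod_multf[OF cl cl])
    finally show "\<alpha> (g \<otimes>\<^bsub>H\<^esub> h) = \<alpha> g \<otimes>\<^bsub>L\<^esub> \<alpha> h" unfolding k .
  qed
  have \<alpha>e: "\<alpha> (e l) = l" if l: "l \<in> I" for l
  proof -
    have "E k (e l) = finprod L (\<lambda>j. if l = j then j else \<one>\<^bsub>L\<^esub>) I" for k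
      unfolding E_def using LI by (intro L.finprod_cong') (auto simp: e_def)
    also have "\<dots> = l" using L.finprod_singleton[OF l finite_I, of "\<lambda>j. j"] LI by auto
    finally show ?thesis unfolding \<alpha>_def .
  qed
  have epi: "\<alpha> \<in> epi H L"
    unfolding epi_def using hom hom_carrier[OF hom] \<alpha>e e_carrier LI by force
  interpret \<alpha>: group_hom H L \<alpha>
    by (intro group_homI hom H.is_group L.is_group)
  have "(\<forall>y \<in> carrier L. \<phi> y = y) \<or> (\<forall>y \<in> carrier L. \<phi> y = inv\<^bsub>L\<^esub> y)"
    if \<psi>: "\<psi> \<in> iso H H" and comm: "\<And>x. x \<in> carrier H \<Longrightarrow> \<alpha> (\<psi> x) = \<phi> (\<alpha> x)" for \<psi> \<phi>
  proof -
    obtain c where c: "\<And>h. h \<in> carrier H \<Longrightarrow> \<psi> h = (c * fst h, \<lambda>i. c * snd h i)"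
      using scalar[OF iso_imp_homomorphism[OF \<psi>]] by blast
    obtain i where i: "i \<in> I" using nonempty_I by blast
    \<comment> \<open>The image of \<open>e i\<close> is \<open>c\<close> times it, so
      \<open>c\<close> is an integer; a preimage of \<open>e i\<close> is an integral multiple of
      the same kind and shows that \<open>c\<close> is invertible over the integers.\<close>
    have "\<psi> (e i) \<in> carrier H" using \<psi> e_carrier[OF i] by (auto simp: iso_def hom_def)
    then have "(0, \<lambda>j. c * snd (e i) j) \<in> carrier H" using c[OF e_carrier[OF i]] by (simp add: e_def)
    then have "c * snd (e i) i \<in> \<int>" using i by (simp add: H_Int_iff)
    then have cI: "c \<in> \<int>" by (simp add: e_def)
    have "e i \<in> \<psi> ` carrier H" using \<psi> e_carrier[OF i] by (simp add: iso_def bij_betw_def)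
    then obtain h where h: "h \<in> carrier H" "\<psi> h = e i" by (metis imageE)
    then have ch: "c * fst h = 0" "c * snd h i = 1" using c[OF h(1)] by (auto simp: e_def fun_eq_iff)
    then have "fst h = 0" by auto
    then have "(0, snd h) \<in> carrier H" using h(1) by (metis prod.collapse)
    then have "snd h i \<in> \<int>" using i by (simp add: H_Int_iff)
    then obtain m where m: "snd h i = of_int m" by (metis Ints_cases)
    obtain c' where c': "c = of_int c'" using cI by (metis Ints_cases)
    have "of_int (c' * m) = (1::rat)" using ch(2) m c' by simp
    then have "c' * m = 1" by (simp only: of_int_eq_1_iff)
    then have "c' = 1 \<or> c' = - 1" by (simp add: zmult_eq_1_iff) blast
    then show ?thesis
    proof
      assume "c' = 1"
      then have "\<phi> l = l" if "l \<in> I" for l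
        using comm[OF e_carrier[OF that]] c[OF e_carrier[OF that]] c' \<alpha>e[OF that] by simp
      then show ?thesis using LI by simp
    next
      assume "c' = - 1"
      then have "\<phi> l = inv\<^bsub>L\<^esub> l" if "l \<in> I" for l
        using comm[OF e_carrier[OF that]] c[OF e_carrier[OF that]] c' \<alpha>e[OF that]
          inv_H[OF e_carrier[OF that]] \<alpha>.hom_inv[OF e_carrier[OF that]] by simp
      then show ?thesis using LI by simp
    qed
  qed
  then have "rigid_epi H L \<alpha>" unfolding rigid_epi_def using epi by blast
  then show ?thesis by blast
qed

end

text \<open>\<open>S1\<close>, \<open>S2\<close> and \<open>S3\<close> parametrize the candidate
  nontrivial homomorphisms from \<open>G\<close> to \<open>H\<close>, non-torsion homomorphisms from
  \<open>H\<close> to \<open>G\<close>, and non-scalar endomorphisms of \<open>H\<close>. They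
  consist of values in \<open>G\<close> and of rationals and do not mention \<open>a\<close>, so
  they can be listed before \<open>H\<close> is built; one sequence \<open>a\<close> then defeats
  all of them.\<close>

lemma (in reduced_qd_group) rigid_epi_from_torsion_free:
  fixes L :: "('l, 'm) monoid_scheme"
  assumes nf: "no_nonzero_free_summand G" and L: "comm_group L" and fin: "finite (carrier L)"
  obtains H :: "(rat \<times> ('l \<Rightarrow> rat)) monoid" where
    "countable (carrier H)" "torsion_free_group H" "\<exists>\<alpha>. rigid_epi H L \<alpha>"
    "\<And>f x. f \<in> hom G H \<Longrightarrow> x \<in> carrier G \<Longrightarrow> f x = \<one>\<^bsub>H\<^esub>"
    "\<And>f. f \<in> hom H G \<Longrightarrow> \<exists>M::nat. M > 0 \<and> (\<forall>h \<in> carrier H. f h [^] M = \<one>)"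
proof -
  interpret L: comm_group L by fact
  let ?I = "carrier L"
  let ?A = "{f :: 'a \<Rightarrow> rat. f \<in> extensional (carrier G) \<and>
     (\<forall>x \<in> carrier G. \<forall>y \<in> carrier G. f (x \<otimes> y) = f x + f y)}"
  let ?P1 = "\<lambda>(f, \<phi>, i) a N. \<exists>g \<in> carrier G. of_nat N * f g \<in> \<int> \<and> \<phi> g - f g * of_int (a i) \<notin> (\<int> :: rat set)"
  let ?P2 = "\<lambda>(g0, g) a N. g0 \<otimes> (\<Otimes>i\<in>?I. g i [^] (a i :: int)) \<notin> multiples G N"
  let ?P3 = "\<lambda>(p0 :: rat, q0 :: rat, p, q, i) a N. \<exists>d>0. d dvd N \<and>
    of_nat N * ((p0 + (\<Sum>j\<in>?I. of_int (a j) * p j)) / of_nat d) \<in> \<int> \<and>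
    (q0 + (\<Sum>j\<in>?I. of_int (a j) * q j)) / of_nat d
      - (p0 + (\<Sum>j\<in>?I. of_int (a j) * p j)) / of_nat d * of_int (a i) \<notin> \<int>"
  define S1 where "S1 = {(f, \<phi>, i). f \<in> ?A \<and> \<phi> \<in> ?A \<and> i \<in> ?I \<and> (\<exists>x \<in> carrier G. f x \<noteq> 0 \<or> \<phi> x \<noteq> 0)}"
  define S2 where "S2 = {(g0, g). g0 \<in> carrier G \<and> g \<in> ?I \<rightarrow>\<^sub>E carrier G \<and>
     (g0 \<notin> torsion_part G \<or> (\<exists>i \<in> ?I. g i \<notin> torsion_part G))}"
  define S3 where "S3 = {(p0 :: rat, q0 :: rat, p :: 'l \<Rightarrow> rat, q :: 'l \<Rightarrow> rat, i). p \<in> ?I \<rightarrow>\<^sub>E UNIV \<and> q \<in> ?I \<rightarrow>\<^sub>E UNIV \<and> i \<in> ?I \<and>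
     \<not> ((\<forall>j\<in>?I. p j = 0) \<and> (\<forall>j\<in>?I - {i}. q j = 0) \<and> q i = p0 \<and> q0 = 0)}"
  have cI: "countable ?I" using fin by (rule countable_finite)
  have cQ: "countable (?I \<rightarrow>\<^sub>E (UNIV :: rat set))" using fin by (intro countable_PiE) auto
  have cG: "countable (?I \<rightarrow>\<^sub>E carrier G)" using fin countable_carrier by (intro countable_PiE) auto
  have "S1 \<subseteq> ?A \<times> ?A \<times> ?I" unfolding S1_def by blast
  moreover have "countable (?A \<times> ?A \<times> ?I)" using countable_additive_rat cI by (intro countable_SIGMA)
  ultimately have c1: "countable S1" by (rule countable_subset)
  have "S2 \<subseteq> carrier G \<times> (?I \<rightarrow>\<^sub>E carrier G)" unfolding S2_def by blast
  moreover have "countable (carrier G \<times> (?I \<rightarrow>\<^sub>E carrier G))" using countable_carrier cG by (intro countable_SIGMA)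
  ultimately have c2: "countable S2" by (rule countable_subset)
  have "S3 \<subseteq> UNIV \<times> UNIV \<times> (?I \<rightarrow>\<^sub>E UNIV) \<times> (?I \<rightarrow>\<^sub>E UNIV) \<times> ?I" unfolding S3_def by blast
  moreover have "countable ((UNIV :: rat set) \<times> (UNIV :: rat set) \<times> (?I \<rightarrow>\<^sub>E (UNIV :: rat set)) \<times> (?I \<rightarrow>\<^sub>E (UNIV :: rat set)) \<times> ?I)"
    using cQ cI by (intro countable_SIGMA) auto
  ultimately have c3: "countable S3" by (rule countable_subset)
  have d1: "dense_pred P" if "P \<in> ?P1 ` S1" for P
    using that by (auto simp: S1_def intro!: dense_hom_to[OF nf])
  have d2: "dense_pred P" if "P \<in> ?P2 ` S2" for P
    using that fin by (auto simp: S2_def intro!: dense_hom_from mem_all_multiples_imp_one)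
  have d3: "dense_pred P" if "P \<in> ?P3 ` S3" for P
    using that fin unfolding S3_def by (auto simp only: mem_Collect_eq case_prod_conv split: prod.splits intro!: dense_endomorphism)
  define R where "R = ?P1 ` S1 \<union> ?P2 ` S2 \<union> ?P3 ` S3"
  have cR: "countable R" unfolding R_def using c1 c2 c3 by (intro countable_Un countable_image)
  have dR: "dense_pred P" if "P \<in> R" for P
    using that unfolding R_def by (elim UnE) (erule d1 d2 d3)+
  obtain a N where N: "\<And>k. N k > 0" "\<And>k. N k dvd N (Suc k)" "\<And>k. Suc k dvd N (Suc k)"
    and a: "\<And>k i. int (N k) dvd a (Suc k) i - a k i"
    and gen: "\<And>P. P \<in> R \<Longrightarrow> \<exists>k. P (a k) (N k)"
    using generic_sequence[OF cR dR] by blast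
  interpret adic_sequence ?I a N
    by unfold_locales (use fin N a in auto)
  have gen1: "\<exists>k. \<exists>g \<in> carrier G. of_nat (N k) * f g \<in> \<int> \<and> \<phi> g - f g * of_int (a k i) \<notin> \<int>"
    if i: "i \<in> ?I" and f: "\<And>x y. x \<in> carrier G \<Longrightarrow> y \<in> carrier G \<Longrightarrow> f (x \<otimes> y) = f x + f y"
      and \<phi>: "\<And>x y. x \<in> carrier G \<Longrightarrow> y \<in> carrier G \<Longrightarrow> \<phi> (x \<otimes> y) = \<phi> x + \<phi> y"
      and nz: "\<exists>x \<in> carrier G. f x \<noteq> 0 \<or> \<phi> x \<noteq> 0" for f \<phi> :: "'a \<Rightarrow> rat" and i
  proof -
    \<comment> \<open>Only extensional maps are listed in \<open>S1\<close>; the values off the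
      carrier do not affect the condition.\<close>
    have "(restrict f (carrier G), restrict \<phi> (carrier G), i) \<in> S1"
      using i f \<phi> nz by (simp add: S1_def)
    then have "?P1 (restrict f (carrier G), restrict \<phi> (carrier G), i) \<in> R" unfolding R_def by blast
    from gen[OF this] have "\<exists>k. ?P1 (restrict f (carrier G), restrict \<phi> (carrier G), i) (a k) (N k)" .
    then show ?thesis by auto
  qed
  have gen2: "\<exists>k. g0 \<otimes> (\<Otimes>i\<in>?I. g i [^] a k i) \<notin> multiples G (N k)"
    if "g0 \<in> carrier G" "g \<in> ?I \<rightarrow>\<^sub>E carrier G" "g0 \<notin> torsion_part G \<or> (\<exists>i \<in> ?I. g i \<notin> torsion_part G)" for g0 g
  proof -
    have "(g0, g) \<in> S2" using that by (simp add: S2_def)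
    then have "?P2 (g0, g) \<in> R" unfolding R_def by blast
    from gen[OF this] have "\<exists>k. ?P2 (g0, g) (a k) (N k)" .
    then show ?thesis by simp
  qed
  have gen3: "\<exists>k. \<exists>d>0. d dvd N k \<and>
        of_nat (N k) * ((p0 + (\<Sum>j\<in>?I. of_int (a k j) * p j)) / of_nat d) \<in> \<int> \<and>
        (q0 + (\<Sum>j\<in>?I. of_int (a k j) * q j)) / of_nat d
          - (p0 + (\<Sum>j\<in>?I. of_int (a k j) * p j)) / of_nat d * of_int (a k i) \<notin> \<int>"
    if "i \<in> ?I" "p \<in> ?I \<rightarrow>\<^sub>E UNIV" "q \<in> ?I \<rightarrow>\<^sub>E UNIV"
      "\<not> ((\<forall>j\<in>?I. p j = 0) \<and> (\<forall>j\<in>?I - {i}. q j = 0) \<and> q i = p0 \<and> q0 = 0)" for p q :: "'l \<Rightarrow> rat" and p0 q0 i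
  proof -
    have "(p0, q0, p, q, i) \<in> S3" using that by (simp add: S3_def)
    then have "?P3 (p0, q0, p, q, i) \<in> R" unfolding R_def by blast
    from gen[OF this] have "\<exists>k. ?P3 (p0, q0, p, q, i) (a k) (N k)" .
    then show ?thesis by simp
  qed
  show thesis
  proof (rule that[of H])
    show "countable (carrier H)" by (rule countable_H)
    show "torsion_free_group H" by (rule torsion_free_H)
    show "\<exists>\<alpha>. rigid_epi H L \<alpha>"
      by (rule rigid_epi_exists[OF L refl endomorphism_H_scalar]) (rule gen3)
    show "f x = \<one>\<^bsub>H\<^esub>" if "f \<in> hom G H" "x \<in> carrier G" for f x
      by (rule hom_to_H_trivial[OF comm_group_axioms _ that]) (rule gen1; blast)
    show "\<exists>M::nat. M > 0 \<and> (\<forall>h \<in> carrier H. f h [^] M = \<one>)" if "f \<in> hom H G" for f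
      by (rule hom_from_H_torsion[OF comm_group_axioms _ _ that])
        (blast intro: mem_all_multiples_imp_one, rule gen2)
  qed
qed

section \<open>Transport to a given infinite type\<close>

text \<open>Cancellation and the final statement speak of groups on the type \<open>'u\<close>,
  whereas \<open>H\<close> and the pullbacks live on product and function types. Countable carriers
  can be copied into any infinite type.\<close>

lemma countable_comm_group_transport:
  assumes H: "comm_group H" and c: "countable (carrier H)" and inf: "infinite (UNIV :: 'u set)"
  obtains H' :: "'u monoid" and j where "comm_group H'" "j \<in> iso H' H"
proof -
  interpret H: comm_group H by fact
  obtain s :: "nat \<Rightarrow> 'u" where s: "inj s" using infinite_countable_subset[OF inf] by blast
  define i where "i = s \<circ> to_nat_on (carrier H)"
  have i: "inj_on i (carrier H)"
    unfolding i_def using c s by (intro comp_inj_on) (auto intro: inj_on_subset)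
  define j where "j = inv_into (carrier H) i"
  have ji: "j (i x) = x" if "x \<in> carrier H" for x unfolding j_def using i that by simp
  define H' where "H' = \<lparr>carrier = i ` carrier H, monoid.mult = (\<lambda>x y. i (j x \<otimes>\<^bsub>H\<^esub> j y)), one = i \<one>\<^bsub>H\<^esub>\<rparr>"
  have "comm_group H'"
  proof (rule comm_groupI)
    fix x assume "x \<in> carrier H'"
    then obtain u where u: "u \<in> carrier H" "x = i u" by (auto simp: H'_def)
    then have "i (inv\<^bsub>H\<^esub> u) \<in> carrier H'" "i (inv\<^bsub>H\<^esub> u) \<otimes>\<^bsub>H'\<^esub> x = \<one>\<^bsub>H'\<^esub>" by (auto simp: H'_def ji)
    then show "\<exists>y\<in>carrier H'. y \<otimes>\<^bsub>H'\<^esub> x = \<one>\<^bsub>H'\<^esub>" by blast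
  qed (auto simp: H'_def ji H.m_ac)
  moreover have "j \<in> iso H' H"
  proof (rule isoI)
    show "j \<in> hom H' H" by (rule homI) (auto simp: H'_def ji)
    show "bij_betw j (carrier H') (carrier H)"
      unfolding H'_def by (rule bij_betwI[where g = i]) (auto simp: ji)
  qed
  ultimately show thesis by (rule that)
qed

lemma torsion_free_group_iso:
  assumes j: "j \<in> iso H' H" and H': "comm_group H'" and H: "torsion_free_group H"
  shows "torsion_free_group H'"
proof -
  have cH: "comm_group H" using H by (simp add: torsion_free_group_def)
  interpret H: comm_group H by fact
  interpret H': comm_group H' by fact
  interpret j: group_hom H' H j
    using j by (intro group_hom.intro group_hom_axioms.intro) (auto simp: H.is_group H'.is_group iso_def)
  have inj: "inj_on j (carrier H')" using j by (simp add: iso_def bij_betw_def)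
  have "x = \<one>\<^bsub>H'\<^esub>" if x: "x \<in> carrier H'" and n: "n > 0" "x [^]\<^bsub>H'\<^esub> (n::nat) = \<one>\<^bsub>H'\<^esub>" for x n
  proof -
    have "j x [^]\<^bsub>H\<^esub> n = \<one>\<^bsub>H\<^esub>" using j.hom_nat_pow[OF x, of n] n by simp
    then have "j x \<in> torsion_part H" using x n by (auto simp: torsion_part_def)
    then have "j x = j \<one>\<^bsub>H'\<^esub>" using H by (simp add: torsion_free_group_def)
    then show ?thesis using inj_onD[OF inj] x by simp
  qed
  then have "torsion_part H' = {\<one>\<^bsub>H'\<^esub>}"
    by (auto simp: torsion_part_def intro!: exI[of _ "1::nat"])
  then show ?thesis using H' by (simp add: torsion_free_group_def)
qed

lemma rigid_epi_iso:
  assumes j: "j \<in> iso H' H" and H': "group H'" and H: "group H" and \<alpha>: "rigid_epi H L \<alpha>"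
  shows "rigid_epi H' L (\<alpha> \<circ> j)"
proof -
  define j' where "j' = inv_into (carrier H') j"
  have j': "j' \<in> iso H H'" unfolding j'_def using H' j by (rule group.iso_set_sym)
  have bij: "bij_betw j (carrier H') (carrier H)" using j by (simp add: iso_def)
  then have jj': "j (j' y) = y" if "y \<in> carrier H" for y
    unfolding j'_def using that by (simp add: bij_betw_inv_into_right)
  have "\<alpha> \<in> epi H L" using \<alpha> by (simp add: rigid_epi_def)
  then have "\<alpha> \<in> hom H L" "\<alpha> ` carrier H = carrier L" by (auto simp: epi_def)
  moreover have "(\<alpha> \<circ> j) ` carrier H' = \<alpha> ` carrier H"
    by (simp only: image_comp[symmetric] bij_betw_imp_surj_on[OF bij])
  ultimately have "\<alpha> \<circ> j \<in> epi H' L"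
    using Group.hom_compose[of j H' H \<alpha> L] j by (simp only: epi_def iso_def mem_Collect_eq)
  moreover have "(\<forall>y \<in> carrier L. \<phi> y = y) \<or> (\<forall>y \<in> carrier L. \<phi> y = inv\<^bsub>L\<^esub> y)"
    if \<psi>: "\<psi> \<in> iso H' H'" and \<phi>: "\<phi> \<in> iso L L"
      and comm: "\<forall>x \<in> carrier H'. (\<alpha> \<circ> j) (\<psi> x) = \<phi> ((\<alpha> \<circ> j) x)" for \<psi> \<phi>
  proof -
    have "j \<circ> (\<psi> \<circ> j') \<in> iso H H" using j j' \<psi> by (intro iso_set_trans)
    moreover have "\<forall>y \<in> carrier H. \<alpha> ((j \<circ> (\<psi> \<circ> j')) y) = \<phi> (\<alpha> y)"
    proof
      fix y assume y: "y \<in> carrier H"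
      then have "j' y \<in> carrier H'" using j' by (auto simp: iso_def hom_def)
      then have "\<alpha> (j (\<psi> (j' y))) = \<phi> (\<alpha> (j (j' y)))" using comm by simp
      then show "\<alpha> ((j \<circ> (\<psi> \<circ> j')) y) = \<phi> (\<alpha> y)" using jj'[OF y] by simp
    qed
    ultimately show ?thesis using \<alpha> \<phi> unfolding rigid_epi_def by blast
  qed
  ultimately show ?thesis unfolding rigid_epi_def by blast
qed

lemma (in reduced_qd_group) rigid_epi_exists_on_type:
  fixes L :: "('l, 'm) monoid_scheme"
  assumes nf: "no_nonzero_free_summand G" and L: "comm_group L" "finite (carrier L)"
    and inf: "infinite (UNIV :: 'u set)"
  obtains H :: "'u monoid" and \<alpha> where
    "torsion_free_group H" "rigid_epi H L \<alpha>" "countable (carrier H)"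
    "\<And>f x. f \<in> hom G H \<Longrightarrow> x \<in> carrier G \<Longrightarrow> f x = \<one>\<^bsub>H\<^esub>"
    "\<And>f. f \<in> hom H G \<Longrightarrow> \<exists>M::nat. M > 0 \<and> (\<forall>h \<in> carrier H. f h [^] M = \<one>)"
proof -
  obtain H :: "(rat \<times> ('l \<Rightarrow> rat)) monoid" where H: "countable (carrier H)" "torsion_free_group H"
    "\<exists>\<alpha>. rigid_epi H L \<alpha>" and hto: "\<And>f x. f \<in> hom G H \<Longrightarrow> x \<in> carrier G \<Longrightarrow> f x = \<one>\<^bsub>H\<^esub>"
    and hfrom: "\<And>f. f \<in> hom H G \<Longrightarrow> \<exists>M::nat. M > 0 \<and> (\<forall>h \<in> carrier H. f h [^] M = \<one>)"
    using rigid_epi_from_torsion_free[OF nf L] by blast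
  have cH: "comm_group H" using H by (simp add: torsion_free_group_def)
  then interpret H: comm_group H .
  obtain H' :: "'u monoid" and j where H': "comm_group H'" and j: "j \<in> iso H' H"
    using countable_comm_group_transport[OF cH H(1) inf] by blast
  interpret H': comm_group H' by fact
  obtain \<alpha> where \<alpha>: "rigid_epi H L \<alpha>" using H by blast
  define j' where "j' = inv_into (carrier H') j"
  have j': "j' \<in> iso H H'" unfolding j'_def using H'.is_group j by (rule group.iso_set_sym)
  have jh: "j \<in> hom H' H" and jh': "j' \<in> hom H H'" using j j' by (auto simp: iso_def)
  have bij: "bij_betw j (carrier H') (carrier H)" using j by (simp add: iso_def)
  then have j'j: "j' (j y) = y" if "y \<in> carrier H'" for y
    unfolding j'_def using that by (simp add: bij_betw_inv_into_left)
  show thesis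
  proof (rule that[of H' "\<alpha> \<circ> j"])
    show "torsion_free_group H'" by (rule torsion_free_group_iso[OF j H' H(2)])
    show "rigid_epi H' L (\<alpha> \<circ> j)" by (rule rigid_epi_iso[OF j H'.is_group H.is_group \<alpha>])
    show "countable (carrier H')"
      using bij H(1) by (metis bij_betw_def countable_image_inj_eq)
    show "f x = \<one>\<^bsub>H'\<^esub>" if f: "f \<in> hom G H'" and x: "x \<in> carrier G" for f x
    proof -
      have "j (f x) = \<one>\<^bsub>H\<^esub>" using hto[OF Group.hom_compose[OF f jh] x] by simp
      then have "j' (j (f x)) = \<one>\<^bsub>H'\<^esub>" using hom_one[OF jh' H.is_group H'.is_group] by simp
      then show ?thesis using j'j hom_in_carrier[OF f x] by simp
    qed
    show "\<exists>M::nat. M > 0 \<and> (\<forall>h \<in> carrier H'. f h [^] M = \<one>)" if f: "f \<in> hom H' G" for f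
    proof -
      obtain M :: nat where M: "M > 0" "\<And>h. h \<in> carrier H \<Longrightarrow> (f \<circ> j') h [^] M = \<one>"
        using hfrom[OF Group.hom_compose[OF jh' f]] by blast
      have "f h [^] M = \<one>" if "h \<in> carrier H'" for h
        using M(2)[OF hom_in_carrier[OF jh that]] j'j[OF that] by simp
      then show ?thesis using M(1) by blast
    qed
  qed
qed

section \<open>Cancellation and lifting of units\<close>

context comm_group
begin

lemma hom_torsion_part: "f \<in> hom G G \<Longrightarrow> x \<in> torsion_part G \<Longrightarrow> f x \<in> torsion_part G"
  using hom_nat_pow[of f G G x] hom_one[of f G G] is_group hom_in_carrier[of f G G x]
  by (auto simp: torsion_part_def) metis

text \<open>Serves the round trips through an isomorphism of pullbacks, whose components in
  \<open>G\<close> are known only up to the torsion factors \<open>t\<close> and \<open>t'\<close>: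
  the composite is then the identity up to torsion.\<close>

lemma hom_torsion_perturbation:
  assumes f: "f \<in> hom G G" and t: "t \<in> torsion_part G" "t' \<in> torsion_part G"
    and x: "x \<in> carrier G" and g: "g = t' \<otimes> f (t \<otimes> x)"
  shows "f x \<otimes> inv g \<in> torsion_part G"
proof -
  interpret T: subgroup "torsion_part G" G by (rule subgroup_torsion_part)
  have t'': "t' \<otimes> f t \<in> torsion_part G" using hom_torsion_part[OF f t(1)] t(2) by simp
  have c: "f x \<in> carrier G" "f t \<in> carrier G" using hom_in_carrier[OF f] x t by auto
  have "g = (t' \<otimes> f t) \<otimes> f x"
    unfolding g using hom_mult[OF f T.mem_carrier[OF t(1)] x] t(2) c by (simp add: m_assoc)
  then have "inv g = inv (t' \<otimes> f t) \<otimes> inv (f x)" using inv_mult[OF T.mem_carrier[OF t''] c(1)] by simp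
  then have "f x \<otimes> inv g = inv (t' \<otimes> f t)"
    using mult_inv_cancel(2)[of "f x" "inv (t' \<otimes> f t)"] T.mem_carrier[OF t''] c by simp
  then show ?thesis using t'' by simp
qed

lemma hom_n_part:
  assumes "f \<in> hom G G" "x \<in> n_part G n" "n > 0"
  shows "f x \<in> n_part G n"
  using assms(2) hom_nat_pow[OF assms(1) _ is_group is_group, of x] hom_one[OF assms(1) is_group is_group]
    hom_in_carrier[OF assms(1), of x]
  unfolding n_part_iff[OF assms(3)] by metis

end

text \<open>The kernel of the projection of \<open>G\<close> onto G(n)/nG(n), described without a
  choice of complement. In this form every endomorphism visibly preserves it, so End(G) acts on the
  quotient.\<close>

definition reduction_kernel :: "('a, 'b) monoid_scheme \<Rightarrow> nat \<Rightarrow> 'a set" where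
  "reduction_kernel G n = n_part G n <#>\<^bsub>G\<^esub> multiples G n"

context comm_group
begin

lemma subgroup_reduction_kernel: "subgroup (reduction_kernel G n) G"
  unfolding reduction_kernel_def by (rule mult_subgroups[OF subgroup_n_part subgroup_multiples])

lemma reduction_kernel_iff:
  "x \<in> reduction_kernel G n \<longleftrightarrow> (\<exists>t \<in> n_part G n. \<exists>y \<in> carrier G. x = t \<otimes> y [^] n)"
  unfolding reduction_kernel_def set_mult_def multiples_def by blast

lemma n_part_subset_reduction_kernel:
  assumes "x \<in> n_part G n"
  shows "x \<in> reduction_kernel G n"
proof -
  have "x = x \<otimes> \<one> [^] n" using subgroup.mem_carrier[OF subgroup_n_part assms] by simp
  then show ?thesis unfolding reduction_kernel_iff using assms one_closed by blast
qed

lemma multiples_subset_reduction_kernel: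
  assumes "y \<in> carrier G"
  shows "y [^] n \<in> reduction_kernel G n"
proof -
  have "y [^] n = \<one> \<otimes> y [^] n" using assms by simp
  then show ?thesis
    unfolding reduction_kernel_iff using assms subgroup.one_closed[OF subgroup_n_part] by blast
qed

lemma hom_reduction_kernel:
  assumes f: "f \<in> hom G G" and "x \<in> reduction_kernel G n" "n > 0"
  shows "f x \<in> reduction_kernel G n"
proof -
  obtain t y where ty: "t \<in> n_part G n" "y \<in> carrier G" "x = t \<otimes> y [^] n"
    using assms(2) unfolding reduction_kernel_iff by blast
  have "f x = f t \<otimes> f y [^] n"
    using hom_mult[OF f subgroup.mem_carrier[OF subgroup_n_part ty(1)] nat_pow_closed[OF ty(2)]]
      hom_nat_pow[OF f ty(2) is_group is_group] ty by simp
  then show ?thesis unfolding reduction_kernel_iff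
    using hom_n_part[OF f ty(1) assms(3)] hom_in_carrier[OF f ty(2)] by blast
qed

end

context reduced_qd_group
begin

text \<open>Torsion of order prime to \<open>n\<close> consists of n-th powers, and the rest lies in
  the n-part. Consequently endomorphisms with torsion image act as zero on the quotient, and the
  action of End(G) factors through the Walk-endomorphism ring.\<close>

lemma torsion_part_subset_reduction_kernel:
  assumes n: "n > 0" and x: "x \<in> torsion_part G"
  shows "x \<in> reduction_kernel G n"
proof -
  obtain e where e: "\<And>x. x \<in> n_part G n \<Longrightarrow> x [^] (n ^ e) = \<one>" using n_part_bounded[OF n] by blast
  have xc: "x \<in> carrier G" using x by (simp add: torsion_part_def)
  let ?P = "\<lambda>m::nat. m > 0 \<and> (x [^] (n ^ e)) [^] m = \<one>"
  obtain m0 :: nat where m0: "m0 > 0" "x [^] m0 = \<one>" using x by (auto simp: torsion_part_def)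
  have "(x [^] (n ^ e)) [^] m0 = (x [^] m0) [^] (n ^ e)" using xc by (simp add: nat_pow_pow mult.commute)
  then have "?P m0" using m0 by simp
  define m where "m = (LEAST m. ?P m)"
  have Pm: "?P m" unfolding m_def using \<open>?P m0\<close> by (rule LeastI)
  \<comment> \<open>\<open>m\<close> is the order of \<open>x [^] (n ^ e)\<close>. If a prime
    \<open>p\<close> divided \<open>m\<close> and \<open>n\<close>, then \<open>x [^] m'\<close>
    with \<open>m' = m / p\<close> would lie in the n-part and be killed by \<open>n ^ e\<close>
    already, against the minimality of \<open>m\<close>.\<close>
  have "coprime m n"
  proof (rule ccontr)
    assume "\<not> coprime m n"
    then have "gcd m n \<noteq> 1" by (simp add: coprime_iff_gcd_eq_1)
    then obtain p where "Factorial_Ring.prime p" "p dvd gcd m n" using prime_factor_nat by blast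
    then have p: "Factorial_Ring.prime p" "p dvd m" "p dvd n" by auto
    obtain m' where m': "m = p * m'" using p(2) by auto
    obtain n' where n': "n = p * n'" using p(3) by auto
    have m'0: "m' > 0" "m' < m" using m' Pm prime_gt_1_nat[OF p(1)] by auto
    have "(x [^] m') [^] (n ^ Suc e) = ((x [^] (n ^ e)) [^] m) [^] n'"
      using xc by (simp add: nat_pow_pow m' n' mult_ac)
    then have "(x [^] m') [^] (n ^ Suc e) = \<one>" using Pm by simp
    then have "x [^] m' \<in> n_part G n" unfolding n_part_iff[OF n] using xc by blast
    then have "(x [^] m') [^] (n ^ e) = \<one>" by (rule e)
    then have "?P m'" using xc m'0 by (simp add: nat_pow_pow mult.commute)
    then have "m \<le> m'" unfolding m_def by (rule Least_le)
    then show False using m'0 by simp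
  qed
  then show ?thesis
  proof (rule coprime_pow_mem[OF subgroup_reduction_kernel xc])
    have "(x [^] m) [^] (n ^ e) = \<one>" using Pm xc by (simp add: nat_pow_pow mult.commute)
    then have "x [^] m \<in> n_part G n" unfolding n_part_iff[OF n] using xc by blast
    then show "x [^] m \<in> reduction_kernel G n" by (rule n_part_subset_reduction_kernel)
    show "x [^] n \<in> reduction_kernel G n" using xc by (rule multiples_subset_reduction_kernel)
  qed
qed

lemma finite_reduction:
  assumes n: "n > 0"
  shows "finite (carrier (G Mod reduction_kernel G n))"
proof -
  let ?K = "reduction_kernel G n"
  obtain B where B: "finite B" "B \<subseteq> carrier G"
    "\<And>x. x \<in> carrier G \<Longrightarrow> \<exists>c \<in> B. \<exists>y \<in> carrier G. x = c \<otimes> y [^] n"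
    using finite_mod_multiples[OF n] by blast
  have "carrier (G Mod ?K) \<subseteq> (\<lambda>c. ?K #> c) ` B"
  proof
    fix k assume "k \<in> carrier (G Mod ?K)"
    then obtain x where x: "x \<in> carrier G" "k = ?K #> x" by (auto simp: carrier_FactGroup)
    obtain c y where c: "c \<in> B" "y \<in> carrier G" "x = c \<otimes> y [^] n" using B(3)[OF x(1)] by blast
    have cc: "c \<in> carrier G" using B(2) c by blast
    have "x \<otimes> inv c = y [^] n" unfolding c(3) using c(2) cc by (simp add: mult_inv_cancel)
    then have "x \<in> ?K #> c"
      using subgroup.rcos_module[OF subgroup_reduction_kernel is_group cc x(1), of n]
        multiples_subset_reduction_kernel[OF c(2), of n] by simp
    then have "?K #> c = ?K #> x" by (rule repr_independence[OF _ cc subgroup_reduction_kernel])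
    then show "k \<in> (\<lambda>c. ?K #> c) ` B" using x c by blast
  qed
  then show ?thesis using B(1) finite_surj by blast
qed

text \<open>Multiplication by \<open>n\<close> is injective on a complement of the \<open>n\<close>-part, so an endomorphism that
  vanishes modulo \<open>n\<close> on that complement is \<open>n\<close> times another one, up to torsion.\<close>

lemma hom_into_reduction_kernel:
  assumes n: "n > 0" and \<delta>: "\<delta> \<in> hom G G" and K: "\<And>x. x \<in> carrier G \<Longrightarrow> \<delta> x \<in> reduction_kernel G n"
  obtains \<rho> where "\<rho> \<in> hom G G" "\<And>x. x \<in> carrier G \<Longrightarrow> \<exists>t \<in> torsion_part G. \<delta> x = t \<otimes> \<rho> x [^] n"
proof -
  obtain C where C: "internal_direct_sum G (n_part G n) C"
    using n_part_direct_summand[OF comm_group_axioms finite_n_part[OF n] n] by blast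
  note Cd = internal_direct_sumD[OF C]
  have cC: "x \<in> carrier G" if "x \<in> C" for x using subgroup.mem_carrier[OF Cd(2) that] .
  obtain \<pi> where \<pi>: "\<pi> \<in> hom G G" "\<And>x. x \<in> carrier G \<Longrightarrow> \<pi> x \<in> C"
    "\<And>x. x \<in> carrier G \<Longrightarrow> \<exists>a \<in> n_part G n. x = a \<otimes> \<pi> x" "\<And>x. x \<in> n_part G n \<Longrightarrow> \<pi> x = \<one>"
    "\<And>x. x \<in> C \<Longrightarrow> \<pi> x = x"
    by (rule direct_sum_projection[OF C]) (rule that)
  have inj: "c = d" if "c \<in> C" "d \<in> C" "c [^] n = d [^] n" for c d
  proof -
    have "(c \<otimes> inv d) [^] (n ^ 1) = \<one>" using pow_inv_eq_one[OF cC[OF that(1)] cC[OF that(2)] that(3)] by simp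
    then have "c \<otimes> inv d \<in> n_part G n" unfolding n_part_iff[OF n] using that cC by blast
    moreover have "c \<otimes> inv d \<in> C" using that Cd(2) by (simp add: subgroup.m_closed subgroup.m_inv_closed)
    ultimately have "c \<otimes> inv d = \<one>" using Cd(3) by blast
    then show ?thesis using eq_of_mult_inv_eq_one that cC by blast
  qed
  have "\<exists>c \<in> C. \<pi> (\<delta> x) = c [^] n" if x: "x \<in> carrier G" for x
  proof -
    obtain t y where ty: "t \<in> n_part G n" "y \<in> carrier G" "\<delta> x = t \<otimes> y [^] n"
      using K[OF x] unfolding reduction_kernel_iff by blast
    have "\<pi> (\<delta> x) = \<pi> t \<otimes> \<pi> (y [^] n)"
      unfolding ty(3) by (rule hom_mult[OF \<pi>(1) subgroup.mem_carrier[OF subgroup_n_part ty(1)] nat_pow_closed[OF ty(2)]])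
    also have "\<dots> = \<pi> y [^] n"
      using \<pi>(4)[OF ty(1)] hom_nat_pow[OF \<pi>(1) ty(2) is_group is_group] cC \<pi>(2)[OF ty(2)] by simp
    finally show ?thesis using \<pi>(2)[OF ty(2)] by blast
  qed
  then obtain \<rho> where \<rho>: "\<And>x. x \<in> carrier G \<Longrightarrow> \<rho> x \<in> C \<and> \<pi> (\<delta> x) = \<rho> x [^] n" by metis
  have "\<rho> \<in> hom G G"
  proof (rule homI)
    fix x y assume x: "x \<in> carrier G" and y: "y \<in> carrier G"
    show "\<rho> (x \<otimes> y) = \<rho> x \<otimes> \<rho> y"
    proof (rule inj)
      show "\<rho> (x \<otimes> y) \<in> C" using \<rho> x y by simp
      show "\<rho> x \<otimes> \<rho> y \<in> C" using \<rho>[OF x] \<rho>[OF y] by (simp add: subgroup.m_closed[OF Cd(2)])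
      have "\<rho> (x \<otimes> y) [^] n = \<pi> (\<delta> (x \<otimes> y))" using \<rho> x y by simp
      also have "\<dots> = \<pi> (\<delta> x) \<otimes> \<pi> (\<delta> y)"
        using hom_mult[OF \<delta> x y] hom_mult[OF \<pi>(1)] hom_in_carrier[OF \<delta>] x y by simp
      also have "\<dots> = (\<rho> x \<otimes> \<rho> y) [^] n" using \<rho>[OF x] \<rho>[OF y] cC by (simp add: nat_pow_distrib)
      finally show "\<rho> (x \<otimes> y) [^] n = (\<rho> x \<otimes> \<rho> y) [^] n" .
    qed
  qed (use \<rho> cC in blast)
  moreover have "\<exists>t \<in> torsion_part G. \<delta> x = t \<otimes> \<rho> x [^] n" if x: "x \<in> carrier G" for x
  proof -
    obtain t where t: "t \<in> n_part G n" "\<delta> x = t \<otimes> \<pi> (\<delta> x)"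
      using \<pi>(3)[OF hom_in_carrier[OF \<delta> x]] by blast
    obtain k where "t [^] (n ^ k) = \<one>" "t \<in> carrier G" using t(1) unfolding n_part_iff[OF n] by blast
    moreover have "n ^ k > 0" using n by simp
    ultimately have "t \<in> torsion_part G" unfolding torsion_part_def by blast
    then show ?thesis using t(2) \<rho>[OF x] by metis
  qed
  ultimately show thesis by (rule that)
qed

end

section \<open>Pullbacks that become isomorphic after adding \<open>G\<close>\<close>

definition pullback :: "('a, 'm) monoid_scheme \<Rightarrow> ('b, 'n) monoid_scheme \<Rightarrow> ('a \<Rightarrow> 'c) \<Rightarrow> ('b \<Rightarrow> 'c) \<Rightarrow> ('a \<times> 'b) monoid" where
  "pullback G H f \<alpha> = (G \<times>\<times> H)\<lparr>carrier := {(g, h). g \<in> carrier G \<and> h \<in> carrier H \<and> f g = \<alpha> h}\<rparr>"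

lemma pullback_simps [simp]:
  "(g, h) \<in> carrier (pullback G H f \<alpha>) \<longleftrightarrow> g \<in> carrier G \<and> h \<in> carrier H \<and> f g = \<alpha> h"
  "(g, h) \<otimes>\<^bsub>pullback G H f \<alpha>\<^esub> (g', h') = (g \<otimes>\<^bsub>G\<^esub> g', h \<otimes>\<^bsub>H\<^esub> h')"
  "\<one>\<^bsub>pullback G H f \<alpha>\<^esub> = (\<one>\<^bsub>G\<^esub>, \<one>\<^bsub>H\<^esub>)"
  by (simp_all add: pullback_def)

lemma comm_group_pullback:
  assumes "comm_group G" "comm_group H" "group L" "f \<in> hom G L" "\<alpha> \<in> hom H L"
  shows "comm_group (pullback G H f \<alpha>)"
proof -
  interpret G: comm_group G by fact
  interpret H: comm_group H by fact
  interpret L: group L by fact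
  interpret f: group_hom G L f
    by (intro group_homI assms G.is_group)
  interpret \<alpha>: group_hom H L \<alpha>
    by (intro group_homI assms H.is_group)
  show ?thesis
  proof (rule comm_groupI)
    fix x assume x: "x \<in> carrier (pullback G H f \<alpha>)"
    obtain g h where gh: "x = (g, h)" by fastforce
    have "(inv\<^bsub>G\<^esub> g, inv\<^bsub>H\<^esub> h) \<in> carrier (pullback G H f \<alpha>)"
      "(inv\<^bsub>G\<^esub> g, inv\<^bsub>H\<^esub> h) \<otimes>\<^bsub>pullback G H f \<alpha>\<^esub> x = \<one>\<^bsub>pullback G H f \<alpha>\<^esub>"
      using x unfolding gh by auto
    then show "\<exists>y\<in>carrier (pullback G H f \<alpha>). y \<otimes>\<^bsub>pullback G H f \<alpha>\<^esub> x = \<one>\<^bsub>pullback G H f \<alpha>\<^esub>" by blast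
  next
    fix x y assume "x \<in> carrier (pullback G H f \<alpha>)" "y \<in> carrier (pullback G H f \<alpha>)"
    then show "x \<otimes>\<^bsub>pullback G H f \<alpha>\<^esub> y \<in> carrier (pullback G H f \<alpha>)"
      by (cases x; cases y) auto
    show "x \<otimes>\<^bsub>pullback G H f \<alpha>\<^esub> y = y \<otimes>\<^bsub>pullback G H f \<alpha>\<^esub> x"
      if "x \<in> carrier (pullback G H f \<alpha>)" "y \<in> carrier (pullback G H f \<alpha>)"
      using that by (cases x; cases y) (auto simp: G.m_comm H.m_comm)
    fix z assume "z \<in> carrier (pullback G H f \<alpha>)"
    then show "x \<otimes>\<^bsub>pullback G H f \<alpha>\<^esub> y \<otimes>\<^bsub>pullback G H f \<alpha>\<^esub> z
       = x \<otimes>\<^bsub>pullback G H f \<alpha>\<^esub> (y \<otimes>\<^bsub>pullback G H f \<alpha>\<^esub> z)"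
      if "x \<in> carrier (pullback G H f \<alpha>)" "y \<in> carrier (pullback G H f \<alpha>)"
      using that by (cases x; cases y; cases z) (auto simp: G.m_assoc H.m_assoc)
  next
    fix x assume "x \<in> carrier (pullback G H f \<alpha>)"
    then show "\<one>\<^bsub>pullback G H f \<alpha>\<^esub> \<otimes>\<^bsub>pullback G H f \<alpha>\<^esub> x = x" by (cases x) auto
  qed simp
qed

text \<open>If \<open>\<phi>\<close> is invertible modulo the kernel of \<open>\<beta>\<close>, with inverse \<open>\<phi>'\<close>, then \<open>diag(\<phi>, \<phi>')\<close> is a product
  of elementary matrices modulo that kernel. These lift to automorphisms of \<open>G \<oplus> G\<close>.\<close>

lemma DirProd_pullback_iso:
  assumes G: "comm_group G" and L: "group L" and \<beta>: "\<beta> \<in> hom G L"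
    and \<phi>: "\<phi> \<in> hom G G" and \<phi>': "\<phi>' \<in> hom G G"
    and ker: "\<And>f x. f \<in> hom G G \<Longrightarrow> x \<in> carrier G \<Longrightarrow> \<beta> x = \<one>\<^bsub>L\<^esub> \<Longrightarrow> \<beta> (f x) = \<one>\<^bsub>L\<^esub>"
    and inv1: "\<And>x. x \<in> carrier G \<Longrightarrow> \<beta> (\<phi> (\<phi>' x)) = \<beta> x"
    and inv2: "\<And>x. x \<in> carrier G \<Longrightarrow> \<beta> (\<phi>' (\<phi> x)) = \<beta> x"
  shows "G \<times>\<times> pullback G H \<beta> \<alpha> \<cong> G \<times>\<times> pullback G H (\<lambda>g. \<beta> (\<phi> g)) \<alpha>"
proof -
  interpret G: comm_group G by fact
  interpret L: group L by fact
  interpret \<beta>: group_hom G L \<beta>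
    by (intro group_homI \<beta> G.is_group L.is_group)
  interpret \<phi>: group_hom G G \<phi>
    by (intro group_homI \<phi> G.is_group)
  interpret \<phi>': group_hom G G \<phi>'
    by (intro group_homI \<phi>' G.is_group)
  \<comment> \<open>In additive terms \<open>u = \<phi> x - y\<close>,
    \<open>v = x - \<phi>' u\<close> and \<open>w = u + \<phi> v\<close>: modulo the kernel of
    \<open>\<beta>\<close> the pair \<open>(w, v)\<close> is \<open>(\<phi> x, \<phi>' y)\<close>.
    Each operation can be undone exactly, even though \<open>\<phi>\<close> is invertible only
    modulo the kernel.\<close>
  define u where "u x y = \<phi> x \<otimes>\<^bsub>G\<^esub> inv\<^bsub>G\<^esub> y" for x y
  define v where "v x y = x \<otimes>\<^bsub>G\<^esub> inv\<^bsub>G\<^esub> \<phi>' (u x y)" for x y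
  define w where "w x y = u x y \<otimes>\<^bsub>G\<^esub> \<phi> (v x y)" for x y
  have ucl: "u x y \<in> carrier G" if "x \<in> carrier G" "y \<in> carrier G" for x y using that by (simp add: u_def)
  have vcl: "v x y \<in> carrier G" if "x \<in> carrier G" "y \<in> carrier G" for x y using that ucl by (simp add: v_def)
  have wcl: "w x y \<in> carrier G" if "x \<in> carrier G" "y \<in> carrier G" for x y using that ucl vcl by (simp add: w_def)
  have umult: "u (x \<otimes>\<^bsub>G\<^esub> x') (y \<otimes>\<^bsub>G\<^esub> y') = u x y \<otimes>\<^bsub>G\<^esub> u x' y'"
    if "x \<in> carrier G" "y \<in> carrier G" "x' \<in> carrier G" "y' \<in> carrier G" for x y x' y'
    using that by (simp add: u_def G.inv_mult G.m_ac)
  have vmult: "v (x \<otimes>\<^bsub>G\<^esub> x') (y \<otimes>\<^bsub>G\<^esub> y') = v x y \<otimes>\<^bsub>G\<^esub> v x' y'"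
    if "x \<in> carrier G" "y \<in> carrier G" "x' \<in> carrier G" "y' \<in> carrier G" for x y x' y'
    using that ucl by (simp add: v_def umult G.inv_mult G.m_ac)
  have wmult: "w (x \<otimes>\<^bsub>G\<^esub> x') (y \<otimes>\<^bsub>G\<^esub> y') = w x y \<otimes>\<^bsub>G\<^esub> w x' y'"
    if "x \<in> carrier G" "y \<in> carrier G" "x' \<in> carrier G" "y' \<in> carrier G" for x y x' y'
    using that ucl vcl by (simp add: w_def umult vmult G.m_ac)
  have \<beta>eq: "\<beta> (\<phi> x) = \<beta> (\<phi> y)" if "x \<in> carrier G" "y \<in> carrier G" "\<beta> x = \<beta> y" for x y
  proof -
    have "\<beta> (x \<otimes>\<^bsub>G\<^esub> inv\<^bsub>G\<^esub> y) = \<one>\<^bsub>L\<^esub>" using that by simp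
    then have "\<beta> (\<phi> (x \<otimes>\<^bsub>G\<^esub> inv\<^bsub>G\<^esub> y)) = \<one>\<^bsub>L\<^esub>" using that by (intro ker[OF \<phi>]) auto
    then have "\<beta> (\<phi> x) \<otimes>\<^bsub>L\<^esub> inv\<^bsub>L\<^esub> \<beta> (\<phi> y) = \<one>\<^bsub>L\<^esub>" using that by simp
    then show ?thesis using that by (metis L.inv_closed L.inv_equality L.inv_inv \<beta>.hom_closed \<phi>.hom_closed)
  qed
  \<comment> \<open>Exactly what makes \<open>(v x y, h)\<close> belong to the second pullback when
    \<open>(y, h)\<close> belongs to the first.\<close>
  have \<beta>v: "\<beta> (\<phi> (v x y)) = \<beta> y" if x: "x \<in> carrier G" and y: "y \<in> carrier G" for x y
  proof -
    have "\<phi>' (u x y) = \<phi>' (\<phi> x) \<otimes>\<^bsub>G\<^esub> inv\<^bsub>G\<^esub> \<phi>' y" using x y by (simp add: u_def)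
    then have "\<beta> (v x y) = \<beta> x \<otimes>\<^bsub>L\<^esub> inv\<^bsub>L\<^esub> (\<beta> x \<otimes>\<^bsub>L\<^esub> inv\<^bsub>L\<^esub> \<beta> (\<phi>' y))"
      using x y inv2[OF x] by (simp add: v_def)
    also have "\<dots> = \<beta> x \<otimes>\<^bsub>L\<^esub> (\<beta> (\<phi>' y) \<otimes>\<^bsub>L\<^esub> inv\<^bsub>L\<^esub> \<beta> x)"
      using x y by (simp add: L.inv_mult_group)
    also have "\<dots> = \<beta> (x \<otimes>\<^bsub>G\<^esub> (\<phi>' y \<otimes>\<^bsub>G\<^esub> inv\<^bsub>G\<^esub> x))" using x y by simp
    also have "x \<otimes>\<^bsub>G\<^esub> (\<phi>' y \<otimes>\<^bsub>G\<^esub> inv\<^bsub>G\<^esub> x) = \<phi>' y" using x y by (simp add: G.mult_inv_cancel)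
    finally have "\<beta> (v x y) = \<beta> (\<phi>' y)" .
    then have "\<beta> (\<phi> (v x y)) = \<beta> (\<phi> (\<phi>' y))" using \<beta>eq vcl x y by simp
    then show ?thesis using inv1[OF y] by simp
  qed
  let ?P = "pullback G H \<beta> \<alpha>" and ?P' = "pullback G H (\<lambda>g. \<beta> (\<phi> g)) \<alpha>"
  let ?F = "\<lambda>(x, y, h). (w x y, v x y, h)"
  \<comment> \<open>The elementary operations undone in reverse order; \<open>r\<close> recovers
    \<open>u x y\<close>.\<close>
  let ?E = "\<lambda>(s, t, h). let r = s \<otimes>\<^bsub>G\<^esub> inv\<^bsub>G\<^esub> \<phi> t; x = t \<otimes>\<^bsub>G\<^esub> \<phi>' r in (x, \<phi> x \<otimes>\<^bsub>G\<^esub> inv\<^bsub>G\<^esub> r, h)"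
  have "?F \<in> iso (G \<times>\<times> ?P) (G \<times>\<times> ?P')"
  proof (rule isoI)
    show "?F \<in> hom (G \<times>\<times> ?P) (G \<times>\<times> ?P')"
      by (rule homI) (auto simp: wcl vcl \<beta>v wmult vmult)
    have EF: "?E (?F (x, y, h)) = (x, y, h)" if x: "x \<in> carrier G" and y: "y \<in> carrier G" for x y h
    proof -
      have 1: "w x y \<otimes>\<^bsub>G\<^esub> inv\<^bsub>G\<^esub> \<phi> (v x y) = u x y" using x y ucl vcl by (simp add: w_def G.m_assoc)
      have 2: "v x y \<otimes>\<^bsub>G\<^esub> \<phi>' (u x y) = x" using x y ucl by (simp add: v_def G.m_assoc)
      have "inv\<^bsub>G\<^esub> u x y = y \<otimes>\<^bsub>G\<^esub> inv\<^bsub>G\<^esub> \<phi> x" using x y by (simp add: u_def G.inv_mult_group)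
      then have 3: "\<phi> x \<otimes>\<^bsub>G\<^esub> inv\<^bsub>G\<^esub> u x y = y" using x y by (simp add: G.m_lcomm)
      show ?thesis by (simp add: Let_def 1 2 3)
    qed
    have FE: "?F (?E (s, t, h)) = (s, t, h) \<and> fst (?E (s, t, h)) \<in> carrier G \<and> fst (snd (?E (s, t, h))) \<in> carrier G"
      if s: "s \<in> carrier G" and t: "t \<in> carrier G" for s t h
    proof -
      define r where "r = s \<otimes>\<^bsub>G\<^esub> inv\<^bsub>G\<^esub> \<phi> t"
      define x where "x = t \<otimes>\<^bsub>G\<^esub> \<phi>' r"
      have r: "r \<in> carrier G" using s t by (simp add: r_def)
      have x: "x \<in> carrier G" using r t by (simp add: x_def)
      have "inv\<^bsub>G\<^esub> (\<phi> x \<otimes>\<^bsub>G\<^esub> inv\<^bsub>G\<^esub> r) = r \<otimes>\<^bsub>G\<^esub> inv\<^bsub>G\<^esub> \<phi> x" using r x by (simp add: G.inv_mult_group)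
      then have 1: "u x (\<phi> x \<otimes>\<^bsub>G\<^esub> inv\<^bsub>G\<^esub> r) = r" using r x by (simp add: u_def G.m_lcomm)
      have 2: "v x (\<phi> x \<otimes>\<^bsub>G\<^esub> inv\<^bsub>G\<^esub> r) = t" unfolding v_def 1 using r t by (simp add: x_def G.m_assoc)
      have 3: "w x (\<phi> x \<otimes>\<^bsub>G\<^esub> inv\<^bsub>G\<^esub> r) = s" unfolding w_def 1 2 using s t by (simp add: r_def G.m_assoc)
      have "?E (s, t, h) = (x, \<phi> x \<otimes>\<^bsub>G\<^esub> inv\<^bsub>G\<^esub> r, h)" by (simp add: Let_def r_def x_def)
      then show ?thesis using 2 3 x r by simp
    qed
    show "bij_betw ?F (carrier (G \<times>\<times> ?P)) (carrier (G \<times>\<times> ?P'))"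
    proof (rule bij_betwI[where g = ?E])
      show "?F \<in> carrier (G \<times>\<times> ?P) \<rightarrow> carrier (G \<times>\<times> ?P')" by (auto simp: wcl vcl \<beta>v)
      show "?E \<in> carrier (G \<times>\<times> ?P') \<rightarrow> carrier (G \<times>\<times> ?P)"
      proof
        fix z assume z: "z \<in> carrier (G \<times>\<times> ?P')"
        obtain s t h where sth: "z = (s, t, h)" by (metis prod.collapse)
        have st: "s \<in> carrier G" "t \<in> carrier G" "h \<in> carrier H" "\<beta> (\<phi> t) = \<alpha> h" using z unfolding sth by auto
        obtain x y where xy: "?E (s, t, h) = (x, y, h)" by (auto simp: Let_def)
        have c: "x \<in> carrier G" "y \<in> carrier G" "v x y = t" using FE[OF st(1,2), of h] unfolding xy by auto
        then have "\<beta> y = \<alpha> h" using \<beta>v[OF c(1,2)] st(4) by simp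
        then show "?E z \<in> carrier (G \<times>\<times> ?P)" unfolding sth xy using c st by simp
      qed
      show "?E (?F z) = z" if z: "z \<in> carrier (G \<times>\<times> ?P)" for z
      proof -
        obtain x y h where xyh: "z = (x, y, h)" by (metis prod.collapse)
        then show ?thesis using EF[of x y h] z by auto
      qed
      show "?F (?E z) = z" if z: "z \<in> carrier (G \<times>\<times> ?P')" for z
      proof -
        obtain x y h where xyh: "z = (x, y, h)" by (metis prod.collapse)
        then show ?thesis using FE[of x y h] z by auto
      qed
    qed
  qed
  then show ?thesis by (rule is_isoI)
qed

lemma nat_pow_pullback:
  "(g, h) [^]\<^bsub>pullback G H f \<alpha>\<^esub> (n::nat) = (g [^]\<^bsub>G\<^esub> n, h [^]\<^bsub>H\<^esub> n)"
  by (induction n) simp_all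

section \<open>From an isomorphism of pullbacks to a lift of the unit\<close>

context reduced_qd_group
begin

lemma n_part_torsion: "n > 0 \<Longrightarrow> x \<in> n_part G n \<Longrightarrow> x \<in> torsion_part G"
  unfolding n_part_iff torsion_part_def by (metis (mono_tags, lifting) mem_Collect_eq zero_less_power)

text \<open>The off-diagonal parts of \<open>\<theta>\<close> come from homomorphisms between
  \<open>G\<close> and \<open>H\<close>. The part from \<open>G\<close> to \<open>H\<close>
  vanishes, and the part from \<open>H\<close> to \<open>G\<close> is bounded torsion, so after
  projecting that torsion away \<open>\<theta>\<close> is diagonal.\<close>

lemma pullback_hom_components:
  assumes H: "torsion_free_group H" and L: "group L" and n: "n > 0"
    and f1: "f1 \<in> hom G L" and f2: "f2 \<in> hom G L" and \<alpha>: "\<alpha> \<in> hom H L"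
    and sf: "f1 ` carrier G = carrier L" and s\<alpha>: "\<alpha> ` carrier H = carrier L"
    and ef: "\<And>x. x \<in> carrier G \<Longrightarrow> f1 (x [^] (n::nat)) = \<one>\<^bsub>L\<^esub>"
    and e\<alpha>: "\<And>h. h \<in> carrier H \<Longrightarrow> \<alpha> (h [^]\<^bsub>H\<^esub> n) = \<one>\<^bsub>L\<^esub>"
    and hto: "\<And>f x. f \<in> hom G H \<Longrightarrow> x \<in> carrier G \<Longrightarrow> f x = \<one>\<^bsub>H\<^esub>"
    and hfrom: "\<And>f. f \<in> hom H G \<Longrightarrow> \<exists>M::nat. M > 0 \<and> (\<forall>h \<in> carrier H. f h [^] M = \<one>)"
    and \<theta>: "\<theta> \<in> hom (pullback G H f1 \<alpha>) (pullback G H f2 \<alpha>)"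
  shows "\<exists>\<psi> \<in> hom H H. \<exists>\<gamma> \<in> hom G G. \<forall>g \<in> carrier G. \<forall>h \<in> carrier H. f1 g = \<alpha> h \<longrightarrow>
      snd (\<theta> (g, h)) = \<psi> h \<and> (\<exists>t \<in> torsion_part G. fst (\<theta> (g, h)) = t \<otimes> \<gamma> g)"
proof -
  have cH: "comm_group H" using H by (simp add: torsion_free_group_def)
  then interpret H: comm_group H .
  interpret L: group L by fact
  interpret f1: group_hom G L f1
    by (intro group_homI f1 is_group L.is_group)
  interpret \<alpha>: group_hom H L \<alpha>
    by (intro group_homI \<alpha> H.is_group L.is_group)
  let ?P = "pullback G H f1 \<alpha>" and ?P' = "pullback G H f2 \<alpha>"
  interpret P: comm_group ?P by (rule comm_group_pullback[OF comm_group_axioms cH L f1 \<alpha>])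
  interpret P': comm_group ?P' by (rule comm_group_pullback[OF comm_group_axioms cH L f2 \<alpha>])
  interpret \<theta>: group_hom ?P ?P' \<theta>
    by (intro group_homI \<theta> P.is_group P'.is_group)
  let ?a = "\<lambda>g h. fst (\<theta> (g, h))" and ?b = "\<lambda>g h. snd (\<theta> (g, h))"
  have P: "(g, h) \<in> carrier ?P" if "g \<in> carrier G" "h \<in> carrier H" "f1 g = \<alpha> h" for g h
    using that by simp
  have cl: "?a g h \<in> carrier G \<and> ?b g h \<in> carrier H" if "(g, h) \<in> carrier ?P" for g h
    using \<theta>.hom_closed[OF that] by (cases "\<theta> (g, h)") simp
  have mult: "?a (g \<otimes> g') (h \<otimes>\<^bsub>H\<^esub> h') = ?a g h \<otimes> ?a g' h' \<and> ?b (g \<otimes> g') (h \<otimes>\<^bsub>H\<^esub> h') = ?b g h \<otimes>\<^bsub>H\<^esub> ?b g' h'"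
    if "(g, h) \<in> carrier ?P" "(g', h') \<in> carrier ?P" for g h g' h'
    using \<theta>.hom_mult[OF that] by (cases "\<theta> (g, h)"; cases "\<theta> (g', h')") simp
  have pow: "?a (g [^] m) (h [^]\<^bsub>H\<^esub> m) = ?a g h [^] m \<and> ?b (g [^] m) (h [^]\<^bsub>H\<^esub> m) = ?b g h [^]\<^bsub>H\<^esub> m"
    if "(g, h) \<in> carrier ?P" for g h and m :: nat
    using \<theta>.hom_nat_pow[OF that, of m] unfolding nat_pow_pullback
    by (cases "\<theta> (g, h)") (simp add: nat_pow_pullback)
  have gn: "(g [^] n, \<one>\<^bsub>H\<^esub>) \<in> carrier ?P" if "g \<in> carrier G" for g using that ef by simp
  have hn: "(\<one>, h [^]\<^bsub>H\<^esub> n) \<in> carrier ?P" if "h \<in> carrier H" for h using that e\<alpha> by simp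
  \<comment> \<open>The pairs \<open>(g, 1)\<close> of the pullback need \<open>g\<close> in the
    kernel of \<open>f1\<close>, so homomorphisms on all of \<open>G\<close> are obtained by passing
    to n-th powers first; torsion-freeness of \<open>H\<close> undoes this afterwards. The same
    detour is used for the other component.\<close>
  have "(\<lambda>g. ?b (g [^] n) \<one>\<^bsub>H\<^esub>) \<in> hom G H"
  proof (rule homI)
    fix x y assume x: "x \<in> carrier G" and y: "y \<in> carrier G"
    show "?b ((x \<otimes> y) [^] n) \<one>\<^bsub>H\<^esub> = ?b (x [^] n) \<one>\<^bsub>H\<^esub> \<otimes>\<^bsub>H\<^esub> ?b (y [^] n) \<one>\<^bsub>H\<^esub>"
      using mult[OF gn[OF x] gn[OF y]] x y by (simp add: nat_pow_distrib)
  qed (use cl[OF gn] in blast)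
  then have bn: "?b (g [^] n) \<one>\<^bsub>H\<^esub> = \<one>\<^bsub>H\<^esub>" if "g \<in> carrier G" for g using hto that by blast
  have b1: "?b g \<one>\<^bsub>H\<^esub> = \<one>\<^bsub>H\<^esub>" if g: "g \<in> carrier G" "f1 g = \<one>\<^bsub>L\<^esub>" for g
  proof -
    have gP: "(g, \<one>\<^bsub>H\<^esub>) \<in> carrier ?P" using g by simp
    have "?b g \<one>\<^bsub>H\<^esub> [^]\<^bsub>H\<^esub> n = \<one>\<^bsub>H\<^esub>" using pow[OF gP, of n] bn[OF g(1)] by simp
    then have "?b g \<one>\<^bsub>H\<^esub> \<in> torsion_part H" using cl[OF gP] n by (auto simp: torsion_part_def)
    then show ?thesis using H by (simp add: torsion_free_group_def)
  qed
  have "(\<lambda>h. ?a \<one> (h [^]\<^bsub>H\<^esub> n)) \<in> hom H G"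
  proof (rule homI)
    fix x y assume x: "x \<in> carrier H" and y: "y \<in> carrier H"
    show "?a \<one> ((x \<otimes>\<^bsub>H\<^esub> y) [^]\<^bsub>H\<^esub> n) = ?a \<one> (x [^]\<^bsub>H\<^esub> n) \<otimes> ?a \<one> (y [^]\<^bsub>H\<^esub> n)"
      using mult[OF hn[OF x] hn[OF y]] x y by (simp add: H.nat_pow_distrib)
  qed (use cl[OF hn] in blast)
  then obtain M :: nat where M: "M > 0" "\<And>h. h \<in> carrier H \<Longrightarrow> ?a \<one> (h [^]\<^bsub>H\<^esub> n) [^] M = \<one>"
    using hfrom by blast
  \<comment> \<open>The factor \<open>n\<close> stems from the passage to n-th powers and
    \<open>M\<close> from the torsion of Hom(H, G); the product kills the whole unwanted
    contribution of \<open>H\<close> to the first component.\<close>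
  define q where "q = n * M"
  have q: "q > 0" using n M by (simp add: q_def)
  have a1: "?a \<one> k \<in> n_part G q" if k: "k \<in> carrier H" "\<alpha> k = \<one>\<^bsub>L\<^esub>" for k
  proof -
    have kP: "(\<one>, k) \<in> carrier ?P" using k by simp
    have "?a \<one> k [^] (q ^ 1) = (?a \<one> k [^] n) [^] M" using cl[OF kP] by (simp add: q_def nat_pow_pow)
    also have "?a \<one> k [^] n = ?a \<one> (k [^]\<^bsub>H\<^esub> n)" using pow[OF kP, of n] by simp
    also have "?a \<one> (k [^]\<^bsub>H\<^esub> n) [^] M = \<one>" by (rule M(2)[OF k(1)])
    finally show ?thesis unfolding n_part_iff[OF q] using cl[OF kP] by blast
  qed
  obtain C where C: "internal_direct_sum G (n_part G q) C"
    using n_part_direct_summand[OF comm_group_axioms finite_n_part[OF q] q] by blast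
  obtain \<pi> where \<pi>: "\<pi> \<in> hom G G" and "\<And>x. x \<in> carrier G \<Longrightarrow> \<pi> x \<in> C"
    and \<pi>2: "\<And>x. x \<in> carrier G \<Longrightarrow> \<exists>a \<in> n_part G q. x = a \<otimes> \<pi> x"
    and \<pi>3: "\<And>x. x \<in> n_part G q \<Longrightarrow> \<pi> x = \<one>"
    and "\<And>x. x \<in> C \<Longrightarrow> \<pi> x = x"
    by (rule direct_sum_projection[OF C]) (rule that)
  \<comment> \<open>\<open>s\<close> and \<open>r\<close> choose arbitrary partners in the pullback.
    The facts \<open>\<psi>\<close> and \<open>\<gamma>\<close> below show that the choice does not
    matter, which is what makes both maps homomorphisms.\<close>
  have "\<forall>h \<in> carrier H. \<exists>g. g \<in> carrier G \<and> f1 g = \<alpha> h" using sf \<alpha>.hom_closed by (metis imageE)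
  then obtain s where s: "\<And>h. h \<in> carrier H \<Longrightarrow> s h \<in> carrier G \<and> f1 (s h) = \<alpha> h" by metis
  have "\<forall>g \<in> carrier G. \<exists>h. h \<in> carrier H \<and> \<alpha> h = f1 g" using s\<alpha> f1.hom_closed by (metis imageE)
  then obtain r where r: "\<And>g. g \<in> carrier G \<Longrightarrow> r g \<in> carrier H \<and> \<alpha> (r g) = f1 g" by metis
  define \<psi> where "\<psi> h = ?b (s h) h" for h
  define \<gamma> where "\<gamma> g = \<pi> (?a g (r g))" for g
  have \<psi>: "?b g h = \<psi> h" if gh: "(g, h) \<in> carrier ?P" for g h
  proof -
    have h: "h \<in> carrier H" and g: "g \<in> carrier G" and e: "f1 g = \<alpha> h" using gh by auto
    have k: "g \<otimes> inv (s h) \<in> carrier G" "f1 (g \<otimes> inv (s h)) = \<one>\<^bsub>L\<^esub>"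
      using s[OF h] g e \<alpha>.hom_closed[OF h] by auto
    have "?b ((g \<otimes> inv (s h)) \<otimes> s h) (\<one>\<^bsub>H\<^esub> \<otimes>\<^bsub>H\<^esub> h) = ?b (g \<otimes> inv (s h)) \<one>\<^bsub>H\<^esub> \<otimes>\<^bsub>H\<^esub> ?b (s h) h"
      using mult[of "g \<otimes> inv (s h)" "\<one>\<^bsub>H\<^esub>" "s h" h] k s[OF h] h by simp
    moreover have "(g \<otimes> inv (s h)) \<otimes> s h = g" using g s[OF h] by (simp add: m_assoc)
    moreover have "?b (s h) h \<in> carrier H" using cl[OF P] s[OF h] h by blast
    ultimately show ?thesis using b1[OF k] h by (simp add: \<psi>_def)
  qed
  have \<gamma>: "\<pi> (?a g h) = \<gamma> g" if gh: "(g, h) \<in> carrier ?P" for g h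
  proof -
    have h: "h \<in> carrier H" and g: "g \<in> carrier G" and e: "f1 g = \<alpha> h" using gh by auto
    have k: "inv\<^bsub>H\<^esub> (r g) \<otimes>\<^bsub>H\<^esub> h \<in> carrier H" "\<alpha> (inv\<^bsub>H\<^esub> (r g) \<otimes>\<^bsub>H\<^esub> h) = \<one>\<^bsub>L\<^esub>"
      using r[OF g] h e \<alpha>.hom_closed[OF h] by auto
    have m: "?a (g \<otimes> \<one>) (r g \<otimes>\<^bsub>H\<^esub> (inv\<^bsub>H\<^esub> (r g) \<otimes>\<^bsub>H\<^esub> h)) = ?a g (r g) \<otimes> ?a \<one> (inv\<^bsub>H\<^esub> (r g) \<otimes>\<^bsub>H\<^esub> h)"
      using mult[of g "r g" \<one> "inv\<^bsub>H\<^esub> (r g) \<otimes>\<^bsub>H\<^esub> h"] k r[OF g] g by simp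
    have "r g \<otimes>\<^bsub>H\<^esub> (inv\<^bsub>H\<^esub> (r g) \<otimes>\<^bsub>H\<^esub> h) = h" using h r[OF g] by (simp flip: H.m_assoc)
    then have m': "?a g h = ?a g (r g) \<otimes> ?a \<one> (inv\<^bsub>H\<^esub> (r g) \<otimes>\<^bsub>H\<^esub> h)" using m g by simp
    have c1: "?a g (r g) \<in> carrier G" using cl[OF P] r[OF g] g by simp
    have c2: "?a \<one> (inv\<^bsub>H\<^esub> (r g) \<otimes>\<^bsub>H\<^esub> h) \<in> carrier G"
      using subgroup.mem_carrier[OF subgroup_n_part a1[OF k]] .
    show ?thesis unfolding m' \<gamma>_def hom_mult[OF \<pi> c1 c2] \<pi>3[OF a1[OF k]]
      using hom_in_carrier[OF \<pi> c1] by simp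
  qed
  show ?thesis
  proof (intro bexI ballI impI)
    show "\<psi> \<in> hom H H"
    proof (rule homI)
      fix x assume x: "x \<in> carrier H"
      then show "\<psi> x \<in> carrier H" unfolding \<psi>_def using cl[OF P] s[OF x] by blast
      fix y assume y: "y \<in> carrier H"
      have "(s x, x) \<in> carrier ?P" "(s y, y) \<in> carrier ?P" using s x y by auto
      moreover from this have "(s x \<otimes> s y, x \<otimes>\<^bsub>H\<^esub> y) \<in> carrier ?P" using x y by auto
      ultimately show "\<psi> (x \<otimes>\<^bsub>H\<^esub> y) = \<psi> x \<otimes>\<^bsub>H\<^esub> \<psi> y"
        using mult[of "s x" x "s y" y] \<psi> by metis
    qed
    show "\<gamma> \<in> hom G G"
    proof (rule homI)
      fix x assume x: "x \<in> carrier G"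
      then have xP: "(x, r x) \<in> carrier ?P" using r by auto
      then show "\<gamma> x \<in> carrier G" unfolding \<gamma>_def using cl hom_in_carrier[OF \<pi>] by blast
      fix y assume y: "y \<in> carrier G"
      then have yP: "(y, r y) \<in> carrier ?P" using r by auto
      have "(x \<otimes> y, r x \<otimes>\<^bsub>H\<^esub> r y) \<in> carrier ?P" using xP yP by auto
      then have "\<gamma> (x \<otimes> y) = \<pi> (?a x (r x) \<otimes> ?a y (r y))" using \<gamma> mult[OF xP yP] by metis
      then show "\<gamma> (x \<otimes> y) = \<gamma> x \<otimes> \<gamma> y"
        using hom_mult[OF \<pi>] cl[OF xP] cl[OF yP] by (simp add: \<gamma>_def)
    qed
    fix g h assume gh: "g \<in> carrier G" "h \<in> carrier H" "f1 g = \<alpha> h"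
    obtain t where "t \<in> n_part G q" "?a g h = t \<otimes> \<pi> (?a g h)" using \<pi>2 cl[OF P[OF gh]] by blast
    then show "?b g h = \<psi> h \<and> (\<exists>t \<in> torsion_part G. ?a g h = t \<otimes> \<gamma> g)"
      using \<psi>[OF P[OF gh]] \<gamma>[OF P[OF gh]] n_part_torsion[OF q] by metis
  qed
qed

text \<open>An isomorphism of the two pullbacks has diagonal components \<open>\<psi>\<close> on
  \<open>H\<close> and \<open>\<gamma>\<close> on \<open>G\<close>, with \<open>\<gamma>\<close>
  invertible modulo torsion. Compatibility with the maps to \<open>L\<close> says that
  \<open>\<phi> \<gamma>\<close> induces an automorphism of \<open>L\<close> that lifts to
  \<open>\<psi>\<close>. By rigidity it is 1 or -1, so up to sign \<open>\<phi>\<close> agrees on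
  \<open>L\<close> with the inverse of \<open>\<gamma>\<close>.\<close>

lemma lift_unit_of_cancellation:
  fixes \<phi> \<phi>' :: "'a \<Rightarrow> 'a"
  assumes nf: "no_nonzero_free_summand G" and inf: "infinite (UNIV :: 'u set)"
    and canc: "cancellation_property TYPE('u) G" and n: "n > 0"
    and \<phi>: "\<phi> \<in> hom G G" and \<phi>': "\<phi>' \<in> hom G G"
    and inv1: "\<And>x. x \<in> carrier G \<Longrightarrow> \<phi> (\<phi>' x) \<otimes> inv x \<in> reduction_kernel G n"
    and inv2: "\<And>x. x \<in> carrier G \<Longrightarrow> \<phi>' (\<phi> x) \<otimes> inv x \<in> reduction_kernel G n"
  obtains v v' where "v \<in> hom G G" "v' \<in> hom G G"
    "\<And>x. x \<in> carrier G \<Longrightarrow> v (v' x) \<otimes> inv x \<in> torsion_part G"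
    "\<And>x. x \<in> carrier G \<Longrightarrow> v' (v x) \<otimes> inv x \<in> torsion_part G"
    "\<And>x. x \<in> carrier G \<Longrightarrow> \<phi> x \<otimes> inv (v x) \<in> reduction_kernel G n"
proof -
  let ?K = "reduction_kernel G n"
  have K: "subgroup ?K G" by (rule subgroup_reduction_kernel)
  define L where "L = G Mod ?K"
  define \<beta> where "\<beta> x = ?K #> x" for x
  have cL: "comm_group L" unfolding L_def by (rule abelian_FactGroup[OF K])
  then interpret L: comm_group L .
  have \<beta>: "\<beta> \<in> hom G L" unfolding \<beta>_def L_def
    by (rule normal.r_coset_hom_Mod[OF subgroup_imp_normal[OF K]])
  interpret \<beta>: group_hom G L \<beta>
    by (intro group_homI \<beta> is_group L.is_group)
  have s\<beta>: "\<beta> ` carrier G = carrier L" unfolding \<beta>_def L_def carrier_FactGroup by simp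
  have \<beta>1: "\<beta> x = \<one>\<^bsub>L\<^esub> \<longleftrightarrow> x \<in> ?K" if "x \<in> carrier G" for x
    unfolding \<beta>_def L_def one_FactGroup using coset_join1[OF _ that K] coset_join2[OF that K] K
    by (metis subgroup.subset)
  have \<beta>eq: "\<beta> x = \<beta> y \<longleftrightarrow> x \<otimes> inv y \<in> ?K" if x: "x \<in> carrier G" and y: "y \<in> carrier G" for x y
  proof -
    have "x \<otimes> inv y \<in> ?K \<longleftrightarrow> \<beta> x \<otimes>\<^bsub>L\<^esub> inv\<^bsub>L\<^esub> \<beta> y = \<one>\<^bsub>L\<^esub>" using \<beta>1[of "x \<otimes> inv y"] x y by simp
    also have "\<dots> \<longleftrightarrow> \<beta> x = \<beta> y" using L.eq_of_mult_inv_eq_one[of "\<beta> x" "\<beta> y"] x y by auto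
    finally show ?thesis by simp
  qed
  have ker: "\<beta> (f x) = \<one>\<^bsub>L\<^esub>" if "f \<in> hom G G" "x \<in> carrier G" "\<beta> x = \<one>\<^bsub>L\<^esub>" for f x
    using that hom_reduction_kernel[OF that(1) _ n] \<beta>1 hom_in_carrier by metis
  have hom_\<beta>eq: "\<beta> (f x) = \<beta> (f y)" if f: "f \<in> hom G G" and "x \<in> carrier G" "y \<in> carrier G" "\<beta> x = \<beta> y" for f x y
  proof -
    have "f (x \<otimes> inv y) \<in> ?K" using that \<beta>eq hom_reduction_kernel[OF f _ n] by blast
    moreover have "f (x \<otimes> inv y) = f x \<otimes> inv (f y)"
      using group_hom.hom_inv[of G G f y] hom_mult[OF f] that is_group
      by (simp add: group_hom_def group_hom_axioms_def)
    ultimately show ?thesis using \<beta>eq hom_in_carrier[OF f] that by simp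
  qed
  have \<beta>tors: "\<beta> t = \<one>\<^bsub>L\<^esub>" if "t \<in> torsion_part G" for t
    using \<beta>1[of t] torsion_part_subset_reduction_kernel[OF n that] that by (simp add: torsion_part_def)
  have \<beta>t: "\<beta> (t \<otimes> x) = \<beta> x" if "t \<in> torsion_part G" "x \<in> carrier G" for t x
    using \<beta>tors[OF that(1)] that by (simp add: torsion_part_def)
  have ex\<beta>: "\<beta> (x [^] n) = \<one>\<^bsub>L\<^esub>" if "x \<in> carrier G" for x
    using \<beta>1[of "x [^] n"] multiples_subset_reduction_kernel[OF that, of n] that by simp
  have exL: "y [^]\<^bsub>L\<^esub> n = \<one>\<^bsub>L\<^esub>" if y: "y \<in> carrier L" for y
  proof -
    obtain x where "x \<in> carrier G" "y = \<beta> x" using y s\<beta> by blast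
    then show ?thesis using ex\<beta> \<beta>.hom_nat_pow by simp
  qed
  have finL: "finite (carrier L)" unfolding L_def by (rule finite_reduction[OF n])
  have \<beta>12: "\<beta> (\<phi> (\<phi>' x)) = \<beta> x" "\<beta> (\<phi>' (\<phi> x)) = \<beta> x" if "x \<in> carrier G" for x
    using \<beta>eq inv1 inv2 that hom_in_carrier[OF \<phi>] hom_in_carrier[OF \<phi>'] by simp_all
  obtain H :: "'u monoid" and \<alpha> where H: "torsion_free_group H" and rig: "rigid_epi H L \<alpha>"
    and cnt: "countable (carrier H)"
    and hto: "\<And>f x. f \<in> hom G H \<Longrightarrow> x \<in> carrier G \<Longrightarrow> f x = \<one>\<^bsub>H\<^esub>"
    and hfrom: "\<And>f. f \<in> hom H G \<Longrightarrow> \<exists>M::nat. M > 0 \<and> (\<forall>h \<in> carrier H. f h [^] M = \<one>)"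
    using rigid_epi_exists_on_type[OF nf cL finL inf] by blast
  have cH: "comm_group H" using H by (simp add: torsion_free_group_def)
  then interpret H: comm_group H .
  have \<alpha>: "\<alpha> \<in> hom H L" and s\<alpha>: "\<alpha> ` carrier H = carrier L"
    using rig by (auto simp: rigid_epi_def epi_def)
  interpret \<alpha>: group_hom H L \<alpha>
    by (intro group_homI \<alpha> H.is_group L.is_group)
  have ex\<alpha>: "\<alpha> (h [^]\<^bsub>H\<^esub> n) = \<one>\<^bsub>L\<^esub>" if "h \<in> carrier H" for h
    using exL \<alpha>.hom_nat_pow[OF that, of n] that by simp
  have \<beta>\<phi>: "(\<lambda>g. \<beta> (\<phi> g)) \<in> hom G L" using Group.hom_compose[OF \<phi> \<beta>] by (simp add: comp_def)
  have s\<beta>\<phi>: "(\<lambda>g. \<beta> (\<phi> g)) ` carrier G = carrier L"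
  proof
    show "(\<lambda>g. \<beta> (\<phi> g)) ` carrier G \<subseteq> carrier L" using \<beta>\<phi> by (rule hom_carrier)
    show "carrier L \<subseteq> (\<lambda>g. \<beta> (\<phi> g)) ` carrier G"
    proof
      fix y assume "y \<in> carrier L"
      then obtain x where x: "x \<in> carrier G" "y = \<beta> x" using s\<beta> by blast
      then have "y = \<beta> (\<phi> (\<phi>' x))" using \<beta>12 by simp
      then show "y \<in> (\<lambda>g. \<beta> (\<phi> g)) ` carrier G" using hom_in_carrier[OF \<phi>' x(1)] by blast
    qed
  qed
  have ex\<beta>\<phi>: "\<beta> (\<phi> (x [^] n)) = \<one>\<^bsub>L\<^esub>" if "x \<in> carrier G" for x
    using ker[OF \<phi> _ ex\<beta>[OF that]] that by simp
  let ?P = "pullback G H \<beta> \<alpha>" and ?P' = "pullback G H (\<lambda>g. \<beta> (\<phi> g)) \<alpha>"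
  have P: "comm_group ?P" by (rule comm_group_pullback[OF comm_group_axioms cH L.is_group \<beta> \<alpha>])
  have P': "comm_group ?P'" by (rule comm_group_pullback[OF comm_group_axioms cH L.is_group \<beta>\<phi> \<alpha>])
  have cPr: "countable (carrier G \<times> carrier H)" using countable_carrier cnt by (intro countable_SIGMA)
  have "carrier ?P \<subseteq> carrier G \<times> carrier H" "carrier ?P' \<subseteq> carrier G \<times> carrier H" by auto
  then have cP: "countable (carrier ?P)" and cP': "countable (carrier ?P')"
    using countable_subset[OF _ cPr] by blast+
  \<comment> \<open>Copies on the type \<open>'u\<close>, where the cancellation hypothesis
    applies.\<close>
  obtain M1 :: "'u monoid" and j1 where M1: "comm_group M1" and j1: "j1 \<in> iso M1 ?P"
    using countable_comm_group_transport[OF P cP inf] by blast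
  obtain M2 :: "'u monoid" and j2 where M2: "comm_group M2" and j2: "j2 \<in> iso M2 ?P'"
    using countable_comm_group_transport[OF P' cP' inf] by blast
  have grp: "group M1" "group M2" using M1 M2 by (simp_all add: comm_group.axioms(2))
  have i1: "M1 \<cong> ?P" and i2: "M2 \<cong> ?P'" using j1 j2 by (auto simp: is_iso_def)
  have "G \<times>\<times> M1 \<cong> G \<times>\<times> ?P" using DirProd_iso_trans[OF iso_refl i1] .
  also have "G \<times>\<times> ?P \<cong> G \<times>\<times> ?P'"
    by (rule DirProd_pullback_iso[OF comm_group_axioms L.is_group \<beta> \<phi> \<phi>']) (simp_all add: ker \<beta>12)
  also have "G \<times>\<times> ?P' \<cong> G \<times>\<times> M2"
    using DirProd_iso_trans[OF iso_refl group.iso_sym[OF grp(2) i2]] .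
  finally have "M1 \<cong> M2" using canc M1 M2 unfolding cancellation_property_def by blast
  then have "?P \<cong> ?P'" using iso_trans[OF group.iso_sym[OF grp(1) i1]] iso_trans[OF _ i2] by blast
  then obtain \<theta> where \<theta>: "\<theta> \<in> iso ?P ?P'" by (auto simp: is_iso_def)
  define \<theta>' where "\<theta>' = inv_into (carrier ?P) \<theta>"
  have \<theta>': "\<theta>' \<in> iso ?P' ?P" unfolding \<theta>'_def
    using group.iso_set_sym[OF comm_group.axioms(2)[OF P] \<theta>] .
  have bij: "bij_betw \<theta> (carrier ?P) (carrier ?P')" using \<theta> by (simp add: iso_def)
  have \<theta>'\<theta>: "\<theta>' (\<theta> z) = z" if "z \<in> carrier ?P" for z
    unfolding \<theta>'_def using bij that by (rule bij_betw_inv_into_left)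
  have \<theta>\<theta>': "\<theta> (\<theta>' z) = z" if "z \<in> carrier ?P'" for z
    unfolding \<theta>'_def using bij that by (rule bij_betw_inv_into_right)
  obtain \<psi> \<gamma> where \<psi>: "\<psi> \<in> hom H H" and \<gamma>: "\<gamma> \<in> hom G G"
    and c: "\<And>g h. g \<in> carrier G \<Longrightarrow> h \<in> carrier H \<Longrightarrow> \<beta> g = \<alpha> h \<Longrightarrow>
      snd (\<theta> (g, h)) = \<psi> h \<and> (\<exists>t \<in> torsion_part G. fst (\<theta> (g, h)) = t \<otimes> \<gamma> g)"
  proof -
    have "\<exists>\<psi> \<in> hom H H. \<exists>\<gamma> \<in> hom G G. \<forall>g \<in> carrier G. \<forall>h \<in> carrier H. \<beta> g = \<alpha> h \<longrightarrow>
      snd (\<theta> (g, h)) = \<psi> h \<and> (\<exists>t \<in> torsion_part G. fst (\<theta> (g, h)) = t \<otimes> \<gamma> g)"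
      by (rule pullback_hom_components[OF H L.is_group n \<beta> \<beta>\<phi> \<alpha> s\<beta> s\<alpha>])
        (erule ex\<beta>, erule ex\<alpha>, erule (1) hto, erule hfrom, rule iso_imp_homomorphism[OF \<theta>])
    then show thesis using that by blast
  qed
  obtain \<psi>' \<gamma>' where \<psi>': "\<psi>' \<in> hom H H" and \<gamma>': "\<gamma>' \<in> hom G G"
    and c': "\<And>g h. g \<in> carrier G \<Longrightarrow> h \<in> carrier H \<Longrightarrow> \<beta> (\<phi> g) = \<alpha> h \<Longrightarrow>
      snd (\<theta>' (g, h)) = \<psi>' h \<and> (\<exists>t \<in> torsion_part G. fst (\<theta>' (g, h)) = t \<otimes> \<gamma>' g)"
  proof -
    have "\<exists>\<psi> \<in> hom H H. \<exists>\<gamma> \<in> hom G G. \<forall>g \<in> carrier G. \<forall>h \<in> carrier H. \<beta> (\<phi> g) = \<alpha> h \<longrightarrow>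
      snd (\<theta>' (g, h)) = \<psi> h \<and> (\<exists>t \<in> torsion_part G. fst (\<theta>' (g, h)) = t \<otimes> \<gamma> g)"
      by (rule pullback_hom_components[OF H L.is_group n \<beta>\<phi> \<beta> \<alpha> s\<beta>\<phi> s\<alpha>])
        (erule ex\<beta>\<phi>, erule ex\<alpha>, erule (1) hto, erule hfrom, rule iso_imp_homomorphism[OF \<theta>'])
    then show thesis using that by blast
  qed
  have tc: "t \<in> carrier G" if "t \<in> torsion_part G" for t using that by (simp add: torsion_part_def)
  have \<gamma>c: "\<gamma> x \<in> carrier G" "\<gamma>' x \<in> carrier G" "\<phi> x \<in> carrier G" if "x \<in> carrier G" for x
    using hom_in_carrier[OF \<gamma> that] hom_in_carrier[OF \<gamma>' that] hom_in_carrier[OF \<phi> that] by auto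
  \<comment> \<open>The first two conclusions come from following \<open>(g, h)\<close> through
    \<open>\<theta>\<close> and back; the third is the membership of the image in the second
    pullback, with the torsion factor dropped because \<open>\<beta>\<close> kills torsion.\<close>
  have round_trip: "\<psi>' (\<psi> h) = h \<and> \<gamma>' (\<gamma> g) \<otimes> inv g \<in> torsion_part G \<and> \<beta> (\<phi> (\<gamma> g)) = \<alpha> (\<psi> h)"
    if g: "g \<in> carrier G" and h: "h \<in> carrier H" and e: "\<beta> g = \<alpha> h" for g h
  proof -
    obtain t where t: "t \<in> torsion_part G" "\<theta> (g, h) = (t \<otimes> \<gamma> g, \<psi> h)"
      using c[OF g h e] by (metis prod.collapse)
    have ghP: "(g, h) \<in> carrier ?P" using g h e by simp
    have "(t \<otimes> \<gamma> g, \<psi> h) \<in> carrier ?P'"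
      using hom_in_carrier[OF iso_imp_homomorphism[OF \<theta>] ghP] t(2) by simp
    then have 1: "t \<otimes> \<gamma> g \<in> carrier G" "\<psi> h \<in> carrier H" "\<beta> (\<phi> (t \<otimes> \<gamma> g)) = \<alpha> (\<psi> h)" by auto
    obtain t' where t': "t' \<in> torsion_part G" "\<theta>' (t \<otimes> \<gamma> g, \<psi> h) = (t' \<otimes> \<gamma>' (t \<otimes> \<gamma> g), \<psi>' (\<psi> h))"
      using c'[OF 1] by (metis prod.collapse)
    then have 2: "g = t' \<otimes> \<gamma>' (t \<otimes> \<gamma> g)" "h = \<psi>' (\<psi> h)" using \<theta>'\<theta>[OF ghP] t(2) by auto
    have 3: "\<gamma>' (\<gamma> g) \<otimes> inv g \<in> torsion_part G"
      by (rule hom_torsion_perturbation[OF \<gamma>' t(1) t'(1) \<gamma>c(1)[OF g] 2(1)])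
    have "\<phi> (t \<otimes> \<gamma> g) = \<phi> t \<otimes> \<phi> (\<gamma> g)" using hom_mult[OF \<phi> tc[OF t(1)] \<gamma>c(1)[OF g]] .
    then have "\<beta> (\<phi> (\<gamma> g)) = \<alpha> (\<psi> h)" using 1(3) \<beta>t[OF hom_torsion_part[OF \<phi> t(1)]] \<gamma>c g by simp
    then show ?thesis using 2 3 by simp
  qed
  have round_trip2: "\<psi> (\<psi>' h) = h \<and> \<gamma> (\<gamma>' g) \<otimes> inv g \<in> torsion_part G"
    if g: "g \<in> carrier G" and h: "h \<in> carrier H" and e: "\<beta> (\<phi> g) = \<alpha> h" for g h
  proof -
    obtain t where t: "t \<in> torsion_part G" "\<theta>' (g, h) = (t \<otimes> \<gamma>' g, \<psi>' h)"
      using c'[OF g h e] by (metis prod.collapse)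
    have ghP: "(g, h) \<in> carrier ?P'" using g h e by simp
    have "(t \<otimes> \<gamma>' g, \<psi>' h) \<in> carrier ?P"
      using hom_in_carrier[OF iso_imp_homomorphism[OF \<theta>'] ghP] t(2) by simp
    then have 1: "t \<otimes> \<gamma>' g \<in> carrier G" "\<psi>' h \<in> carrier H" "\<beta> (t \<otimes> \<gamma>' g) = \<alpha> (\<psi>' h)" by auto
    obtain t' where t': "t' \<in> torsion_part G" "\<theta> (t \<otimes> \<gamma>' g, \<psi>' h) = (t' \<otimes> \<gamma> (t \<otimes> \<gamma>' g), \<psi> (\<psi>' h))"
      using c[OF 1] by (metis prod.collapse)
    then have 2: "g = t' \<otimes> \<gamma> (t \<otimes> \<gamma>' g)" "h = \<psi> (\<psi>' h)" using \<theta>\<theta>'[OF ghP] t(2) by auto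
    have "\<gamma> (\<gamma>' g) \<otimes> inv g \<in> torsion_part G"
      by (rule hom_torsion_perturbation[OF \<gamma> t(1) t'(1) \<gamma>c(2)[OF g] 2(1)])
    then show ?thesis using 2 by simp
  qed
  have lift\<beta>: "\<exists>h \<in> carrier H. y = \<alpha> h" if "y \<in> carrier L" for y using that s\<alpha> by blast
  have lift\<alpha>: "\<exists>g \<in> carrier G. \<beta> g = \<alpha> h" "\<exists>g \<in> carrier G. \<beta> (\<phi> g) = \<alpha> h" if "h \<in> carrier H" for h
    using \<alpha>.hom_closed[OF that] s\<beta> s\<beta>\<phi> by (metis imageE)+
  have \<gamma>\<gamma>': "\<gamma> (\<gamma>' g) \<otimes> inv g \<in> torsion_part G" if g: "g \<in> carrier G" for g
    using round_trip2[OF g] lift\<beta>[OF \<beta>.hom_closed[OF \<gamma>c(3)[OF g]]] by blast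
  have \<gamma>'\<gamma>: "\<gamma>' (\<gamma> g) \<otimes> inv g \<in> torsion_part G" if g: "g \<in> carrier G" for g
    using round_trip[OF g] lift\<beta>[OF \<beta>.hom_closed[OF g]] by blast
  have \<beta>\<gamma>: "\<beta> (\<gamma> (\<gamma>' g)) = \<beta> g" "\<beta> (\<gamma>' (\<gamma> g)) = \<beta> g" if g: "g \<in> carrier G" for g
    using \<beta>eq \<gamma>\<gamma>'[OF g] \<gamma>'\<gamma>[OF g] torsion_part_subset_reduction_kernel[OF n] \<gamma>c g by simp_all
  have \<psi>iso: "\<psi> \<in> iso H H"
  proof (rule isoI[OF \<psi>])
    show "bij_betw \<psi> (carrier H) (carrier H)"
    proof (rule bij_betwI[where g = \<psi>'])
      show "\<psi> \<in> carrier H \<rightarrow> carrier H" "\<psi>' \<in> carrier H \<rightarrow> carrier H"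
        using \<psi> \<psi>' by (auto simp: hom_def)
      show "\<psi>' (\<psi> h) = h" "\<psi> (\<psi>' h) = h" if "h \<in> carrier H" for h
        using lift\<alpha>[OF that] round_trip[OF _ that] round_trip2[OF _ that] by blast+
    qed
  qed
  \<comment> \<open>\<open>F\<close> induces the automorphism \<open>\<Phi>\<close> of
    \<open>L\<close> to which rigidity is applied, and \<open>F'\<close> induces its
    inverse.\<close>
  define F where "F g = \<phi> (\<gamma> g)" for g
  define F' where "F' g = \<gamma>' (\<phi>' g)" for g
  have F: "F \<in> hom G G" and F': "F' \<in> hom G G"
    using Group.hom_compose[OF \<gamma> \<phi>] Group.hom_compose[OF \<phi>' \<gamma>'] by (simp_all add: comp_def F_def[abs_def] F'_def[abs_def])
  have FF': "\<beta> (F (F' g)) = \<beta> g" "\<beta> (F' (F g)) = \<beta> g" if g: "g \<in> carrier G" for g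
  proof -
    have p: "\<phi>' g \<in> carrier G" using hom_in_carrier[OF \<phi>' g] .
    have "\<beta> (F (F' g)) = \<beta> (\<phi> (\<phi>' g))"
      unfolding F_def F'_def by (rule hom_\<beta>eq[OF \<phi> _ p \<beta>\<gamma>(1)[OF p]]) (use p \<gamma>c in blast)
    then show "\<beta> (F (F' g)) = \<beta> g" using \<beta>12(1)[OF g] by simp
    have "\<beta> (F' (F g)) = \<beta> (\<gamma>' (\<gamma> g))"
      unfolding F_def F'_def
      by (rule hom_\<beta>eq[OF \<gamma>' _ _ \<beta>12(2)]) (use \<gamma>c g hom_in_carrier[OF \<phi>'] in blast)+
    then show "\<beta> (F' (F g)) = \<beta> g" using \<beta>\<gamma>(2)[OF g] by simp
  qed
  have ind: "\<exists>\<Phi>. \<Phi> \<in> hom L L \<and> (\<forall>x \<in> carrier G. \<Phi> (\<beta> x) = \<beta> (f x))" if f: "f \<in> hom G G" for f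
  proof -
    have "\<beta> \<circ> f \<in> hom G L" using Group.hom_compose[OF f \<beta>] .
    then obtain \<Phi> where "\<Phi> \<in> hom (G Mod ?K) L" "\<And>x. x \<in> carrier G \<Longrightarrow> \<Phi> (?K #> x) = (\<beta> \<circ> f) x"
      using FactGroup_universal[OF _ subgroup_imp_normal[OF K], of "\<beta> \<circ> f" L] hom_\<beta>eq[OF f]
      unfolding \<beta>_def by (metis comp_apply)
    then show ?thesis unfolding L_def \<beta>_def by auto
  qed
  obtain \<Phi> where \<Phi>: "\<Phi> \<in> hom L L" "\<And>x. x \<in> carrier G \<Longrightarrow> \<Phi> (\<beta> x) = \<beta> (F x)" using ind[OF F] by blast
  obtain \<Phi>' where \<Phi>': "\<Phi>' \<in> hom L L" "\<And>x. x \<in> carrier G \<Longrightarrow> \<Phi>' (\<beta> x) = \<beta> (F' x)" using ind[OF F'] by blast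
  have \<Phi>iso: "\<Phi> \<in> iso L L"
  proof (rule isoI[OF \<Phi>(1)])
    show "bij_betw \<Phi> (carrier L) (carrier L)"
    proof (rule bij_betwI[where g = \<Phi>'])
      show "\<Phi> \<in> carrier L \<rightarrow> carrier L" "\<Phi>' \<in> carrier L \<rightarrow> carrier L"
        using \<Phi>(1) \<Phi>'(1) by (auto simp: hom_def)
      fix y assume "y \<in> carrier L"
      then obtain x where x: "x \<in> carrier G" "y = \<beta> x" using s\<beta> by blast
      show "\<Phi>' (\<Phi> y) = y" "\<Phi> (\<Phi>' y) = y"
        using x \<Phi>(2) \<Phi>'(2) hom_in_carrier[OF F x(1)] hom_in_carrier[OF F' x(1)] FF'[OF x(1)] by simp_all
    qed
  qed
  have "\<forall>h \<in> carrier H. \<alpha> (\<psi> h) = \<Phi> (\<alpha> h)"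
  proof
    fix h assume h: "h \<in> carrier H"
    then obtain g where g: "g \<in> carrier G" "\<beta> g = \<alpha> h" using lift\<alpha> by blast
    then show "\<alpha> (\<psi> h) = \<Phi> (\<alpha> h)" using round_trip[OF g(1) h g(2)] \<Phi>(2)[OF g(1)] by (simp add: F_def)
  qed
  then have "(\<forall>y \<in> carrier L. \<Phi> y = y) \<or> (\<forall>y \<in> carrier L. \<Phi> y = inv\<^bsub>L\<^esub> y)"
    using rig \<psi>iso \<Phi>iso unfolding rigid_epi_def by blast
  then show thesis
  proof
    \<comment> \<open>On \<open>L\<close> the composite \<open>\<phi> \<gamma>\<close> is the
      identity, so \<open>\<phi>\<close> acts there as \<open>\<gamma>'\<close>, and
      \<open>\<gamma>'\<close> is the lift.\<close>
    assume id: "\<forall>y \<in> carrier L. \<Phi> y = y"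
    have "\<phi> x \<otimes> inv (\<gamma>' x) \<in> ?K" if x: "x \<in> carrier G" for x
    proof -
      have "\<beta> (\<phi> x) = \<beta> (\<phi> (\<gamma> (\<gamma>' x)))"
        by (rule hom_\<beta>eq[OF \<phi> x _ \<beta>\<gamma>(1)[OF x, symmetric]]) (use \<gamma>c x in blast)
      also have "\<dots> = \<beta> (\<gamma>' x)" using \<Phi>(2)[OF \<gamma>c(2)[OF x]] id \<gamma>c[OF x] by (simp add: F_def)
      finally show ?thesis using \<beta>eq \<gamma>c x by simp
    qed
    then show thesis using that[OF \<gamma>' \<gamma>] \<gamma>'\<gamma> \<gamma>\<gamma>' by blast
  next
    assume neg: "\<forall>y \<in> carrier L. \<Phi> y = inv\<^bsub>L\<^esub> y"
    \<comment> \<open>Here \<open>\<phi> \<gamma>\<close> acts as -1 on \<open>L\<close>, so the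
      lift is the negative of \<open>\<gamma>'\<close>, with the negative of \<open>\<gamma>\<close>
      as its inverse up to torsion.\<close>
    have invhom: "(\<lambda>x. inv (f x)) \<in> hom G G" if "f \<in> hom G G" for f
      using that by (auto simp: hom_def Pi_iff inv_mult)
    have f_inv: "f (inv x) = inv (f x)" if "f \<in> hom G G" "x \<in> carrier G" for f x
      using that group_hom.hom_inv[of G G f x] is_group by (simp add: group_hom_def group_hom_axioms_def)
    show thesis
    proof (rule that[OF invhom[OF \<gamma>'] invhom[OF \<gamma>]])
      fix x assume x: "x \<in> carrier G"
      show "inv (\<gamma>' (inv (\<gamma> x))) \<otimes> inv x \<in> torsion_part G"
        using \<gamma>'\<gamma>[OF x] f_inv[OF \<gamma>' \<gamma>c(1)[OF x]] \<gamma>c x by simp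
      show "inv (\<gamma> (inv (\<gamma>' x))) \<otimes> inv x \<in> torsion_part G"
        using \<gamma>\<gamma>'[OF x] f_inv[OF \<gamma> \<gamma>c(2)[OF x]] \<gamma>c x by simp
      have "\<beta> (\<phi> x) = \<beta> (\<phi> (\<gamma> (\<gamma>' x)))"
        by (rule hom_\<beta>eq[OF \<phi> x _ \<beta>\<gamma>(1)[OF x, symmetric]]) (use \<gamma>c x in blast)
      also have "\<dots> = \<beta> (inv (\<gamma>' x))" using \<Phi>(2)[OF \<gamma>c(2)[OF x]] neg \<gamma>c[OF x] by (simp add: F_def)
      finally show "\<phi> x \<otimes> inv (inv (\<gamma>' x)) \<in> ?K" using \<beta>eq \<gamma>c x by (metis inv_closed)
    qed
  qed
qed

end

section \<open>The endomorphism ring, the Walk-endomorphism ring and its reduction modulo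
  \<open>n\<close>\<close>

lemma hom_group_inv:
  assumes "group G" "comm_group H" "f \<in> carrier (hom_group G H)"
  shows "inv\<^bsub>hom_group G H\<^esub> f = (\<lambda>x \<in> carrier G. inv\<^bsub>H\<^esub> f x)"
proof (rule group.inv_equality)
  interpret H: comm_group H by fact
  show "group (hom_group G H)" using comm_group_hom_group[OF assms(1,2)] by (simp add: comm_group.axioms(2))
  show "(\<lambda>x \<in> carrier G. inv\<^bsub>H\<^esub> f x) \<otimes>\<^bsub>hom_group G H\<^esub> f = \<one>\<^bsub>hom_group G H\<^esub>"
    using assms(3) by (auto simp: hom_def Pi_iff intro!: restrict_ext)
  show "(\<lambda>x\<in>carrier G. inv\<^bsub>H\<^esub> f x) \<in> carrier (hom_group G H)"
    using assms(3) group.is_monoid[OF assms(1)] by (auto simp: hom_def Pi_iff H.inv_mult monoid.m_closed)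
  show "f \<in> carrier (hom_group G H)" by fact
qed

lemma End_ring_simps:
  "carrier (End_ring G) = hom G G \<inter> extensional (carrier G)"
  "f \<otimes>\<^bsub>End_ring G\<^esub> g = compose (carrier G) f g"
  "\<one>\<^bsub>End_ring G\<^esub> = (\<lambda>x \<in> carrier G. x)"
  "f \<oplus>\<^bsub>End_ring G\<^esub> g = (\<lambda>x \<in> carrier G. f x \<otimes>\<^bsub>G\<^esub> g x)"
  by (simp_all add: End_ring_def)

lemma add_monoid_End_ring: "add_monoid (End_ring G) = hom_group G G"
  by (simp add: End_ring_def hom_group_def)

lemma add_pow_End_ring:
  fixes n :: nat
  shows "x \<in> carrier G \<Longrightarrow> ([n] \<cdot>\<^bsub>End_ring G\<^esub> f) x = f x [^]\<^bsub>G\<^esub> n"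
  unfolding add_pow_def add_monoid_End_ring by (rule hom_group_nat_pow)

context comm_group
begin

lemma ring_End_ring: "ring (End_ring G)"
proof (rule ringI)
  show "abelian_group (End_ring G)"
    by (rule comm_group_abelian_groupI)
      (use comm_group_hom_group[OF is_group comm_group_axioms] in \<open>simp only: add_monoid_End_ring\<close>)
  show "monoid (End_ring G)"
  proof (rule monoidI)
    fix f g h assume *: "f \<in> carrier (End_ring G)" "g \<in> carrier (End_ring G)" "h \<in> carrier (End_ring G)"
    show "f \<otimes>\<^bsub>End_ring G\<^esub> g \<otimes>\<^bsub>End_ring G\<^esub> h = f \<otimes>\<^bsub>End_ring G\<^esub> (g \<otimes>\<^bsub>End_ring G\<^esub> h)"
      using * by (auto simp: End_ring_simps compose_def hom_in_carrier intro!: restrict_ext)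
  next
    fix f g assume "f \<in> carrier (End_ring G)" "g \<in> carrier (End_ring G)"
    then show "f \<otimes>\<^bsub>End_ring G\<^esub> g \<in> carrier (End_ring G)"
      by (auto simp: End_ring_simps compose_extensional intro: hom_compose)
  next
    show "\<one>\<^bsub>End_ring G\<^esub> \<in> carrier (End_ring G)" by (auto simp: End_ring_simps hom_def)
  next
    fix f assume f: "f \<in> carrier (End_ring G)"
    then show "\<one>\<^bsub>End_ring G\<^esub> \<otimes>\<^bsub>End_ring G\<^esub> f = f" "f \<otimes>\<^bsub>End_ring G\<^esub> \<one>\<^bsub>End_ring G\<^esub> = f"
      by (auto simp: End_ring_simps compose_def hom_in_carrier restrict_def extensional_def fun_eq_iff)
  qed
  fix f g h assume *: "f \<in> carrier (End_ring G)" "g \<in> carrier (End_ring G)" "h \<in> carrier (End_ring G)"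
  show "(f \<oplus>\<^bsub>End_ring G\<^esub> g) \<otimes>\<^bsub>End_ring G\<^esub> h = f \<otimes>\<^bsub>End_ring G\<^esub> h \<oplus>\<^bsub>End_ring G\<^esub> g \<otimes>\<^bsub>End_ring G\<^esub> h"
    using * by (auto simp: End_ring_simps compose_def hom_in_carrier intro!: restrict_ext)
  show "h \<otimes>\<^bsub>End_ring G\<^esub> (f \<oplus>\<^bsub>End_ring G\<^esub> g) = h \<otimes>\<^bsub>End_ring G\<^esub> f \<oplus>\<^bsub>End_ring G\<^esub> h \<otimes>\<^bsub>End_ring G\<^esub> g"
    using * by (auto simp: End_ring_simps compose_def hom_in_carrier hom_mult intro!: restrict_ext)
qed

lemma a_minus_End_ring:
  assumes "f \<in> carrier (End_ring G)" "g \<in> carrier (End_ring G)" "x \<in> carrier G"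
  shows "(f \<ominus>\<^bsub>End_ring G\<^esub> g) x = f x \<otimes> inv (g x)"
proof -
  have "\<ominus>\<^bsub>End_ring G\<^esub> g = (\<lambda>x \<in> carrier G. inv (g x))"
    unfolding a_inv_def add_monoid_End_ring
    using hom_group_inv[OF is_group comm_group_axioms, of g] assms(2) by (simp add: End_ring_simps)
  then show ?thesis using assms(3) by (simp add: a_minus_def End_ring_simps)
qed

lemma ideal_torsion_endomorphisms:
  "ideal {f \<in> carrier (End_ring G). f ` carrier G \<subseteq> torsion_part G} (End_ring G)" (is "ideal ?J ?E")
proof (rule idealI[OF ring_End_ring])
  interpret T: subgroup "torsion_part G" G by (rule subgroup_torsion_part)
  interpret A: comm_group "hom_group G G" by (rule comm_group_hom_group[OF is_group comm_group_axioms])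
  show "subgroup ?J (add_monoid ?E)"
    unfolding add_monoid_End_ring
  proof (rule A.subgroupI)
    show "?J \<subseteq> carrier (hom_group G G)" by (auto simp: End_ring_simps)
    have "(\<lambda>x \<in> carrier G. \<one>) \<in> ?J" by (auto simp: End_ring_simps hom_def)
    then show "?J \<noteq> {}" by blast
  next
    fix f assume f: "f \<in> ?J"
    then have "f \<in> carrier (hom_group G G)" by (simp add: End_ring_simps)
    then have "inv\<^bsub>hom_group G G\<^esub> f \<in> carrier (hom_group G G)"
      "inv\<^bsub>hom_group G G\<^esub> f = (\<lambda>x \<in> carrier G. inv (f x))"
      using hom_group_inv[OF is_group comm_group_axioms] by (blast intro: A.inv_closed)+
    then show "inv\<^bsub>hom_group G G\<^esub> f \<in> ?J" using f by (auto simp: End_ring_simps)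
  next
    fix f g assume fg: "f \<in> ?J" "g \<in> ?J"
    then have "f \<otimes>\<^bsub>hom_group G G\<^esub> g \<in> carrier (hom_group G G)"
      by (intro A.m_closed) (auto simp: End_ring_simps)
    then show "f \<otimes>\<^bsub>hom_group G G\<^esub> g \<in> ?J" using fg by (auto simp: End_ring_simps)
  qed
next
  interpret E: ring ?E by (rule ring_End_ring)
  fix f g assume f: "f \<in> ?J" and g: "g \<in> carrier ?E"
  have gh: "g \<in> hom G G" using g by (simp add: End_ring_simps)
  have "g \<otimes>\<^bsub>?E\<^esub> f \<in> carrier ?E" "f \<otimes>\<^bsub>?E\<^esub> g \<in> carrier ?E" using f g by auto
  moreover have "(g \<otimes>\<^bsub>?E\<^esub> f) ` carrier G \<subseteq> torsion_part G"
    using f hom_torsion_part[OF gh] by (auto simp: End_ring_simps compose_def)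
  moreover have "(f \<otimes>\<^bsub>?E\<^esub> g) ` carrier G \<subseteq> torsion_part G"
    using f hom_in_carrier[OF gh] by (auto simp: End_ring_simps compose_def)
  ultimately show "g \<otimes>\<^bsub>?E\<^esub> f \<in> ?J" "f \<otimes>\<^bsub>?E\<^esub> g \<in> ?J" by auto
qed

end

lemma carrier_FactRing: "carrier (R Quot I) = (\<lambda>x. I +>\<^bsub>R\<^esub> x) ` carrier R"
  by (auto simp: FactRing_def A_RCOSETS_def')

lemma (in ring) ideal_ring_multiples: "ideal (ring_multiples R n) R"
proof (rule idealI[OF ring_axioms])
  have "ring_multiples R n = multiples (add_monoid R) n"
    by (simp add: ring_multiples_def multiples_def add_pow_def)
  then show "subgroup (ring_multiples R n) (add_monoid R)"
    using comm_group.subgroup_multiples[OF a_comm_group] by simp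
next
  fix a x assume "a \<in> ring_multiples R n" and x: "x \<in> carrier R"
  then obtain r where "r \<in> carrier R" "a = [n] \<cdot> r" by (auto simp: ring_multiples_def)
  then show "x \<otimes> a \<in> ring_multiples R n" "a \<otimes> x \<in> ring_multiples R n"
    using x by (auto simp: ring_multiples_def add_pow_rdistr add_pow_ldistr)
qed

context reduced_qd_group
begin

lemma Walk_End_coset_eq_iff:
  assumes f: "f \<in> carrier (End_ring G)" and g: "g \<in> carrier (End_ring G)"
  defines "J \<equiv> {f \<in> carrier (End_ring G). f ` carrier G \<subseteq> torsion_part G}"
  shows "J +>\<^bsub>End_ring G\<^esub> f = J +>\<^bsub>End_ring G\<^esub> g \<longleftrightarrow> (\<forall>x \<in> carrier G. f x \<otimes> inv (g x) \<in> torsion_part G)"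
proof -
  interpret E: ring "End_ring G" by (rule ring_End_ring)
  have J: "ideal J (End_ring G)" unfolding J_def by (rule ideal_torsion_endomorphisms)
  have "J +>\<^bsub>End_ring G\<^esub> f = J +>\<^bsub>End_ring G\<^esub> g \<longleftrightarrow> f \<ominus>\<^bsub>End_ring G\<^esub> g \<in> J"
    using E.quotient_eq_iff_same_a_r_cos[OF J f g] by simp
  also have "\<dots> \<longleftrightarrow> (\<forall>x \<in> carrier G. f x \<otimes> inv (g x) \<in> torsion_part G)"
    using f g a_minus_End_ring[OF f g] E.minus_closed[OF f g] by (auto simp: J_def image_subset_iff)
  finally show ?thesis .
qed

text \<open>Equality in the double quotient means that two endomorphisms induce the same map on
  G(n)/nG(n). In one direction torsion and n-th powers both lie in the reduction kernel; in the
  other, \<open>hom_into_reduction_kernel\<close> writes the difference as \<open>n\<close> times an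
  endomorphism up to torsion.\<close>

lemma Walk_End_mod_coset_eq_iff:
  assumes n: "n > 0" and f: "f \<in> carrier (End_ring G)" and g: "g \<in> carrier (End_ring G)"
  defines "J \<equiv> {f \<in> carrier (End_ring G). f ` carrier G \<subseteq> torsion_part G}"
  shows "ring_multiples (Walk_End G) n +>\<^bsub>Walk_End G\<^esub> (J +>\<^bsub>End_ring G\<^esub> f)
      = ring_multiples (Walk_End G) n +>\<^bsub>Walk_End G\<^esub> (J +>\<^bsub>End_ring G\<^esub> g)
    \<longleftrightarrow> (\<forall>x \<in> carrier G. f x \<otimes> inv (g x) \<in> reduction_kernel G n)" (is "?L \<longleftrightarrow> ?R")
proof -
  let ?E = "End_ring G" and ?W = "Walk_End G"
  let ?q = "\<lambda>f. J +>\<^bsub>?E\<^esub> f"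
  interpret E: ring ?E by (rule ring_End_ring)
  have J: "ideal J ?E" unfolding J_def by (rule ideal_torsion_endomorphisms)
  have W: "?W = ?E Quot J" unfolding Walk_End_def J_def ..
  interpret q: ring_hom_ring ?E ?W ?q unfolding W by (rule ideal.rcos_ring_hom_ring[OF J])
  have I: "ideal (ring_multiples ?W n) ?W" by (rule q.S.ideal_ring_multiples)
  have qpow: "?q ([n] \<cdot>\<^bsub>?E\<^esub> \<sigma>) = [n] \<cdot>\<^bsub>?W\<^esub> ?q \<sigma>" if "\<sigma> \<in> carrier ?E" for \<sigma>
    using group_hom.hom_nat_pow[OF q.a_group_hom, of \<sigma> n] that by (simp add: add_pow_def)
  have surj: "\<exists>\<sigma> \<in> carrier ?E. r = ?q \<sigma>" if "r \<in> carrier ?W" for r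
    using that unfolding W carrier_FactRing by blast
  have fc: "f x \<in> carrier G" "g x \<in> carrier G" if "x \<in> carrier G" for x
    using f g that by (auto simp: End_ring_simps hom_in_carrier)
  have "?L \<longleftrightarrow> ?q f \<ominus>\<^bsub>?W\<^esub> ?q g \<in> ring_multiples ?W n"
    using q.S.quotient_eq_iff_same_a_r_cos[OF I q.hom_closed[OF f] q.hom_closed[OF g]] by simp
  also have "\<dots> \<longleftrightarrow> (\<exists>\<sigma> \<in> carrier ?E. ?q f \<ominus>\<^bsub>?W\<^esub> ?q g = ?q ([n] \<cdot>\<^bsub>?E\<^esub> \<sigma>))"
    using surj q.hom_closed qpow unfolding ring_multiples_def by (auto; metis)
  also have "\<dots> \<longleftrightarrow> (\<exists>\<sigma> \<in> carrier ?E. \<forall>x \<in> carrier G. f x \<otimes> inv (g x) \<otimes> inv (\<sigma> x [^] n) \<in> torsion_part G)"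
  proof (rule bex_cong[OF refl])
    fix \<sigma> assume \<sigma>: "\<sigma> \<in> carrier ?E"
    have d: "f \<ominus>\<^bsub>?E\<^esub> g \<in> carrier ?E" using f g by simp
    have p: "[n] \<cdot>\<^bsub>?E\<^esub> \<sigma> \<in> carrier ?E" using \<sigma> by simp
    have "?q f \<ominus>\<^bsub>?W\<^esub> ?q g = ?q (f \<ominus>\<^bsub>?E\<^esub> g)"
      using f g by (simp add: a_minus_def)
    then have "?q f \<ominus>\<^bsub>?W\<^esub> ?q g = ?q ([n] \<cdot>\<^bsub>?E\<^esub> \<sigma>) \<longleftrightarrow>
        (\<forall>x \<in> carrier G. (f \<ominus>\<^bsub>?E\<^esub> g) x \<otimes> inv (([n] \<cdot>\<^bsub>?E\<^esub> \<sigma>) x) \<in> torsion_part G)"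
      using Walk_End_coset_eq_iff[OF d p] unfolding J_def by simp
    then show "?q f \<ominus>\<^bsub>?W\<^esub> ?q g = ?q ([n] \<cdot>\<^bsub>?E\<^esub> \<sigma>) \<longleftrightarrow>
        (\<forall>x \<in> carrier G. f x \<otimes> inv (g x) \<otimes> inv (\<sigma> x [^] n) \<in> torsion_part G)"
      using a_minus_End_ring[OF f g] by (simp add: add_pow_End_ring)
  qed
  also have "\<dots> \<longleftrightarrow> ?R"
  proof
    assume "\<exists>\<sigma> \<in> carrier ?E. \<forall>x \<in> carrier G. f x \<otimes> inv (g x) \<otimes> inv (\<sigma> x [^] n) \<in> torsion_part G"
    then obtain \<sigma> where \<sigma>: "\<sigma> \<in> carrier ?E"
      "\<And>x. x \<in> carrier G \<Longrightarrow> f x \<otimes> inv (g x) \<otimes> inv (\<sigma> x [^] n) \<in> torsion_part G" by blast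
    show ?R
    proof
      fix x assume x: "x \<in> carrier G"
      have "\<sigma> \<in> hom G G" using \<sigma>(1) by (simp add: End_ring_simps)
      then have sx: "\<sigma> x \<in> carrier G" using x by (rule hom_in_carrier)
      have "inv (\<sigma> x [^] n) \<in> reduction_kernel G n"
        using multiples_subset_reduction_kernel[OF sx] subgroup.m_inv_closed[OF subgroup_reduction_kernel] by blast
      moreover have "f x \<otimes> inv (g x) \<in> carrier G" using fc[OF x] by simp
      ultimately show "f x \<otimes> inv (g x) \<in> reduction_kernel G n"
        using subgroup_mult_cancel_right[OF subgroup_reduction_kernel]
          torsion_part_subset_reduction_kernel[OF n \<sigma>(2)[OF x]] by blast
    qed
  next
    assume R: ?R
    have fh: "f \<in> hom G G" "g \<in> hom G G" using f g by (auto simp: End_ring_simps)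
    define \<delta> where "\<delta> x = f x \<otimes> inv (g x)" for x
    have \<delta>: "\<delta> \<in> hom G G"
    proof (rule homI)
      fix x y assume "x \<in> carrier G" "y \<in> carrier G"
      then show "\<delta> (x \<otimes> y) = \<delta> x \<otimes> \<delta> y"
        using fc by (simp add: \<delta>_def hom_mult[OF fh(1)] hom_mult[OF fh(2)] inv_mult m_ac)
    qed (use fc in \<open>simp add: \<delta>_def\<close>)
    have "\<delta> x \<in> reduction_kernel G n" if "x \<in> carrier G" for x using R that by (simp add: \<delta>_def)
    from hom_into_reduction_kernel[OF n \<delta> this] obtain \<rho> where \<rho>: "\<rho> \<in> hom G G" "\<And>x. x \<in> carrier G \<Longrightarrow> \<exists>t \<in> torsion_part G. \<delta> x = t \<otimes> \<rho> x [^] n"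
      by blast
    have "restrict \<rho> (carrier G) \<in> carrier ?E" using \<rho>(1) by (auto simp: End_ring_simps hom_def)
    moreover have "f x \<otimes> inv (g x) \<otimes> inv (restrict \<rho> (carrier G) x [^] n) \<in> torsion_part G"
      if x: "x \<in> carrier G" for x
    proof -
      obtain t where t: "t \<in> torsion_part G" "\<delta> x = t \<otimes> \<rho> x [^] n" using \<rho>(2)[OF x] by blast
      have "t \<in> carrier G" using t by (simp add: torsion_part_def)
      then have "\<delta> x \<otimes> inv (\<rho> x [^] n) = t" using t hom_in_carrier[OF \<rho>(1) x] by (simp add: m_assoc)
      then show ?thesis using t x by (simp add: \<delta>_def)
    qed
    ultimately show "\<exists>\<sigma> \<in> carrier ?E. \<forall>x \<in> carrier G. f x \<otimes> inv (g x) \<otimes> inv (\<sigma> x [^] n) \<in> torsion_part G"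
      by blast
  qed
  finally show ?thesis .
qed

text \<open>A translation: units modulo \<open>n\<close> become pairs of endomorphisms inverse to
  each other modulo the reduction kernel, units of the Walk-endomorphism ring become pairs inverse
  modulo torsion, and \<open>lift_unit_of_cancellation\<close> passes from the first kind to the
  second.\<close>

lemma unit_lifting_of_cancellation:
  assumes nf: "no_nonzero_free_summand G" and inf: "infinite (UNIV :: 'u set)"
    and canc: "cancellation_property TYPE('u) G"
  shows "unit_lifting_property (Walk_End G)"
  unfolding unit_lifting_property_def
proof (intro allI impI ballI)
  fix n :: nat and u assume n: "n > 0"
  let ?E = "End_ring G" and ?W = "Walk_End G"
  let ?N = "ring_multiples ?W n"
  assume u: "u \<in> Units (?W Quot ?N)"
  define J where "J = {f \<in> carrier ?E. f ` carrier G \<subseteq> torsion_part G}"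
  let ?q = "\<lambda>f. J +>\<^bsub>?E\<^esub> f" and ?p = "\<lambda>r. ?N +>\<^bsub>?W\<^esub> r"
  interpret E: ring ?E by (rule ring_End_ring)
  have J: "ideal J ?E" unfolding J_def by (rule ideal_torsion_endomorphisms)
  have W: "?W = ?E Quot J" unfolding Walk_End_def J_def ..
  interpret q: ring_hom_ring ?E ?W ?q unfolding W by (rule ideal.rcos_ring_hom_ring[OF J])
  interpret p: ring_hom_ring ?W "?W Quot ?N" ?p
    by (rule ideal.rcos_ring_hom_ring[OF q.S.ideal_ring_multiples])
  have q_eq: "?q f = ?q g \<longleftrightarrow> (\<forall>x \<in> carrier G. f x \<otimes> inv (g x) \<in> torsion_part G)"
    if "f \<in> carrier ?E" "g \<in> carrier ?E" for f g
    using Walk_End_coset_eq_iff[OF that] by (simp add: J_def)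
  have p_eq: "?p (?q f) = ?p (?q g) \<longleftrightarrow> (\<forall>x \<in> carrier G. f x \<otimes> inv (g x) \<in> reduction_kernel G n)"
    if "f \<in> carrier ?E" "g \<in> carrier ?E" for f g
    using Walk_End_mod_coset_eq_iff[OF n that] by (simp add: J_def)
  have surj: "\<exists>f \<in> carrier ?E. y = ?p (?q f)" if y: "y \<in> carrier (?W Quot ?N)" for y
  proof -
    obtain r where r: "r \<in> carrier ?W" "y = ?p r" using y unfolding carrier_FactRing by blast
    then obtain f where "f \<in> carrier ?E" "r = ?q f" unfolding W carrier_FactRing by blast
    then show ?thesis using r by blast
  qed
  obtain u' where u': "u \<in> carrier (?W Quot ?N)" "u' \<in> carrier (?W Quot ?N)"
    "u' \<otimes>\<^bsub>?W Quot ?N\<^esub> u = \<one>\<^bsub>?W Quot ?N\<^esub>" "u \<otimes>\<^bsub>?W Quot ?N\<^esub> u' = \<one>\<^bsub>?W Quot ?N\<^esub>"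
    using u by (auto simp: Units_def)
  obtain f f' where f: "f \<in> carrier ?E" "u = ?p (?q f)" and f': "f' \<in> carrier ?E" "u' = ?p (?q f')"
    using surj[OF u'(1)] surj[OF u'(2)] by blast
  have fh: "f \<in> hom G G" "f' \<in> hom G G" using f f' by (auto simp: End_ring_simps)
  have "?p (?q (f \<otimes>\<^bsub>?E\<^esub> f')) = ?p (?q \<one>\<^bsub>?E\<^esub>)" "?p (?q (f' \<otimes>\<^bsub>?E\<^esub> f)) = ?p (?q \<one>\<^bsub>?E\<^esub>)"
    using u'(3,4) f f' by simp_all
  then have "\<forall>x \<in> carrier G. (f \<otimes>\<^bsub>?E\<^esub> f') x \<otimes> inv (\<one>\<^bsub>?E\<^esub> x) \<in> reduction_kernel G n"
    "\<forall>x \<in> carrier G. (f' \<otimes>\<^bsub>?E\<^esub> f) x \<otimes> inv (\<one>\<^bsub>?E\<^esub> x) \<in> reduction_kernel G n"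
    using p_eq[OF E.m_closed[OF f(1) f'(1)] E.one_closed] p_eq[OF E.m_closed[OF f'(1) f(1)] E.one_closed]
    by blast+
  then have inv: "f (f' x) \<otimes> inv x \<in> reduction_kernel G n" "f' (f x) \<otimes> inv x \<in> reduction_kernel G n"
    if "x \<in> carrier G" for x
    using that by (auto simp: End_ring_simps(2,3) compose_def)
  obtain v v' where v: "v \<in> hom G G" "v' \<in> hom G G"
    "\<And>x. x \<in> carrier G \<Longrightarrow> v (v' x) \<otimes> inv x \<in> torsion_part G"
    "\<And>x. x \<in> carrier G \<Longrightarrow> v' (v x) \<otimes> inv x \<in> torsion_part G"
    "\<And>x. x \<in> carrier G \<Longrightarrow> f x \<otimes> inv (v x) \<in> reduction_kernel G n"
    using lift_unit_of_cancellation[OF nf inf canc n fh inv] by blast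
  define w where "w = restrict v (carrier G)"
  define w' where "w' = restrict v' (carrier G)"
  have w: "w \<in> carrier ?E" "w' \<in> carrier ?E"
    using v(1,2) by (auto simp: w_def w'_def End_ring_simps hom_def)
  have "?q (w \<otimes>\<^bsub>?E\<^esub> w') = ?q \<one>\<^bsub>?E\<^esub>" "?q (w' \<otimes>\<^bsub>?E\<^esub> w) = ?q \<one>\<^bsub>?E\<^esub>"
    using v(3,4) hom_in_carrier[OF v(1)] hom_in_carrier[OF v(2)] w
    by (simp_all only: q_eq E.m_closed E.one_closed)
      (auto simp: End_ring_simps(2,3) compose_def w_def w'_def)
  then have "?q w \<otimes>\<^bsub>?W\<^esub> ?q w' = \<one>\<^bsub>?W\<^esub>" "?q w' \<otimes>\<^bsub>?W\<^esub> ?q w = \<one>\<^bsub>?W\<^esub>" using w by simp_all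
  then have "?q w \<in> Units ?W" using w unfolding Units_def by (auto intro!: bexI[of _ "?q w'"])
  moreover have "?p (?q w) = u"
    unfolding f(2) using p_eq[OF f(1) w(1)] v(5) by (auto simp: w_def)
  ultimately show "\<exists>v\<in>Units ?W. ?p v = u" by blast
qed

end

theorem proposition3p4:
  fixes G :: "'a monoid"
  assumes "comm_group G"
    and "reduced_group G"
    and "quotient_divisible G"
    and "no_nonzero_free_summand G"
    and "infinite (UNIV :: 'u set)"
  shows "self_small TYPE('i) G \<and> torsion_free_rank G < \<infinity> \<and>
    (\<forall>n::nat. n > 0 \<longrightarrow>
      (\<exists>C. internal_direct_sum G (n_part G n) C) \<and>
      (\<forall>C. internal_direct_sum G (n_part G n) C \<longrightarrow>
        (\<exists>H :: 'u monoid. torsion_free_group H \<and>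
          (\<exists>\<alpha>. rigid_epi H
             ((G\<lparr>carrier := C\<rparr>) Mod multiples (G\<lparr>carrier := C\<rparr>) n) \<alpha>) \<and>
          trivial_group (hom_group G H) \<and>
          torsion_group (hom_group H G)))) \<and>
    (cancellation_property TYPE('u) G \<longrightarrow> unit_lifting_property (Walk_End G))"
proof -
  obtain S where "reduced_qd_group G S"
    using comm_group.reduced_qd_groupI[OF assms(1-3)] by blast
  then interpret reduced_qd_group G S .
  have "\<exists>H :: 'u monoid. torsion_free_group H \<and>
      (\<exists>\<alpha>. rigid_epi H ((G\<lparr>carrier := C\<rparr>) Mod multiples (G\<lparr>carrier := C\<rparr>) n) \<alpha>) \<and>
      trivial_group (hom_group G H) \<and> torsion_group (hom_group H G)"
    if n: "n > 0" and C: "internal_direct_sum G (n_part G n) C" for n C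
  proof -
    let ?C = "G\<lparr>carrier := C\<rparr>"
    let ?L = "?C Mod multiples ?C n"
    interpret C: comm_group ?C using internal_direct_sumD(2)[OF C] by (rule subgroup_comm_group)
    have "comm_group ?L" by (rule C.abelian_FactGroup[OF C.subgroup_multiples])
    moreover have "finite (carrier ?L)" by (rule finite_complement_mod_multiples[OF C n])
    ultimately obtain H :: "'u monoid" and \<alpha> where H: "torsion_free_group H" "rigid_epi H ?L \<alpha>"
      and "countable (carrier H)"
      and hto: "\<And>f x. f \<in> hom G H \<Longrightarrow> x \<in> carrier G \<Longrightarrow> f x = \<one>\<^bsub>H\<^esub>"
      and hfrom: "\<And>f. f \<in> hom H G \<Longrightarrow> \<exists>M::nat. M > 0 \<and> (\<forall>h \<in> carrier H. f h [^]\<^bsub>G\<^esub> M = \<one>\<^bsub>G\<^esub>)"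
      using rigid_epi_exists_on_type[OF assms(4) _ _ assms(5)] by blast
    have cH: "comm_group H" using H(1) by (simp add: torsion_free_group_def)
    then interpret H: comm_group H .
    have "trivial_group (hom_group G H)"
    proof -
      have "f = (\<lambda>x \<in> carrier G. \<one>\<^bsub>H\<^esub>)" if "f \<in> carrier (hom_group G H)" for f
        using that hto[of f] by (intro extensionalityI[of _ "carrier G"]) auto
      moreover have "(\<lambda>x \<in> carrier G. \<one>\<^bsub>H\<^esub>) \<in> carrier (hom_group G H)" by (auto simp: hom_def)
      ultimately have "carrier (hom_group G H) = {\<one>\<^bsub>hom_group G H\<^esub>}" by auto
      then show ?thesis
        using comm_group_hom_group[OF is_group cH] by (simp add: trivial_group_def comm_group.axioms(2))
    qed
    moreover have "torsion_group (hom_group H G)"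
    proof -
      \<comment> \<open>An element of the group of homomorphisms has finite order only if one
        exponent kills all of its values, which is the uniform form in which \<open>hfrom\<close> is
        available.\<close>
      have "f \<in> torsion_part (hom_group H G)" if f: "f \<in> carrier (hom_group H G)" for f
      proof -
        have "f \<in> hom H G" using f by simp
        then obtain M :: nat where M: "M > 0" "\<And>h. h \<in> carrier H \<Longrightarrow> f h [^]\<^bsub>G\<^esub> M = \<one>\<^bsub>G\<^esub>"
          using hfrom by blast
        interpret A: comm_group "hom_group H G" by (rule comm_group_hom_group[OF H.is_group comm_group_axioms])
        have "f [^]\<^bsub>hom_group H G\<^esub> M \<in> carrier (hom_group H G)" using f by (rule A.nat_pow_closed)
        then have "f [^]\<^bsub>hom_group H G\<^esub> M = (\<lambda>x \<in> carrier H. \<one>\<^bsub>G\<^esub>)"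
          using M(2) by (intro extensionalityI[of _ "carrier H"]) (auto simp: hom_group_nat_pow)
        then show ?thesis using f M(1) by (auto simp: torsion_part_def)
      qed
      then have "torsion_part (hom_group H G) = carrier (hom_group H G)" by (auto simp: torsion_part_def)
      then show ?thesis
        using comm_group_hom_group[OF H.is_group comm_group_axioms] by (simp add: torsion_group_def)
    qed
    ultimately show ?thesis using H by blast
  qed
  moreover have "\<exists>C. internal_direct_sum G (n_part G n) C" if "n > 0" for n
    by (rule n_part_direct_summand[OF comm_group_axioms finite_n_part[OF that] that])
  moreover have "torsion_free_rank G < \<infinity>" using assms(3) by (simp add: quotient_divisible_def)
  ultimately show ?thesis
    using self_small unit_lifting_of_cancellation[OF assms(4,5)] by blast
qed

end
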